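(* Let $0<\alpha<\pi/2$. For inputs consisting of a root $r\in\mathbb{R}^2$ and terminals $t_1,\dots,t_n\in\mathbb{R}^2$ such that $t_i\notin\mathcal{R}_{t_j}$ for all $i\neq j$ (where $\mathcal{R}_p$ denotes the spiral region of $p$), an optimal spiral tree can be computed exactly in $O(n^3)$ time.
   Context: The root $r$ is placed at the origin. For a point $p$ with polar coordinates $(R,\phi)$ the right spiral $\mathcal{S}^+_p$ is given by $R(t)=Re^{-t}$, $\phi(t)=\phi+\tan(\alpha)\,t$, and the left spiral $\mathcal{S}^-_p$ by the same equations with $\alpha$ replaced by $-\alpha$. A spiral segment is a connected piece of a right or left spiral (possibly including the limit endpoint $r$), directed towards $r$. A spiral tree for root $r$ and terminals $t_1,\dots,t_n$ is a finite tree drawn in the plane, rooted at $r$, whose nodes include $r$ and all terminals and possibly additional (Steiner) nodes, with arcs directed from the terminals towards the root, each arc being a concatenation of (arbitrarily many) spiral segments. Its length is the sum of the lengths of its arcs; an optimal spiral tree is one of minimum length. A curve directed towards $r$ is angle-restricted if at every point $p\neq r$ of it the angle between its tangent vector at $p$ and the vector from $p$ to $r$ is at most $\alpha$. The spiral region $\mathcal{R}_p$ of a point $p$ is the set of all points reachable from $p$ by an angle-restricted path; equivalently, the region bounded by the parts of $\mathcal{S}^+_p$ and $\mathcal{S}^-_p$ with $0\le t\le \pi\cot(\alpha)$. Running time is measured in the real-RAM model, with elementary operations on spirals taking constant time. *)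

theory Defs
  imports "HOL-Analysis.Analysis" "HOL-Library.Landau_Symbols"
begin

section \<open>Spirals\<close>

text \<open>The plane is the type \<^typ>\<open>complex\<close>; the root \<open>r\<close> is an arbitrary point, and polar
  coordinates are taken around it.\<close>

datatype turn = Right | Left

fun turn_sign :: "turn \<Rightarrow> real" where
  "turn_sign Right = 1"
| "turn_sign Left = - 1"

text \<open>If \<open>p\<close> has polar coordinates \<open>(R, \<phi>)\<close> around \<open>r\<close>, then \<open>spiral \<alpha> r d p t\<close> has polar
  coordinates \<open>(R * exp (- t), \<phi> + tan \<alpha> * t)\<close> for \<open>d = Right\<close>, and the same with \<open>- \<alpha>\<close> in place
  of \<open>\<alpha>\<close> for \<open>d = Left\<close>.\<close>

definition spiral :: "real \<Rightarrow> complex \<Rightarrow> turn \<Rightarrow> complex \<Rightarrow> real \<Rightarrow> complex" where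
  "spiral \<alpha> r d p t = r + (p - r) * of_real (exp (- t)) * cis (tan (turn_sign d * \<alpha>) * t)"

section \<open>Angle-restricted paths and spiral regions\<close>

definition vec_angle :: "complex \<Rightarrow> complex \<Rightarrow> real" where
  "vec_angle u v = arccos (u \<bullet> v / (norm u * norm v))"

text \<open>Paths may have finitely many corners, where no tangent exists.\<close>

definition angle_restricted :: "real \<Rightarrow> complex \<Rightarrow> real \<Rightarrow> (real \<Rightarrow> complex) \<Rightarrow> bool" where
  "angle_restricted \<alpha> r b \<gamma> \<longleftrightarrow>
     continuous_on {0..b} \<gamma> \<and>
     (\<exists>K. finite K \<and>
       (\<forall>t\<in>{0..b} - K. \<gamma> t \<noteq> r \<longrightarrow>
         (\<exists>D. (\<gamma> has_vector_derivative D) (at t within {0..b}) \<and> D \<noteq> 0 \<and>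
              vec_angle D (r - \<gamma> t) \<le> \<alpha>)))"

text \<open>The case \<open>b = 0\<close> is the trivial path, so \<open>p\<close> always belongs to its own region.\<close>

definition spiral_region :: "real \<Rightarrow> complex \<Rightarrow> complex \<Rightarrow> complex set" where
  "spiral_region \<alpha> r p =
     {q. \<exists>b\<ge>0. \<exists>\<gamma>. angle_restricted \<alpha> r b \<gamma> \<and> \<gamma> 0 = p \<and> \<gamma> b = q}"

section \<open>Spiral trees\<close>

text \<open>A segment leaving a given point is a pair \<open>(d, e)\<close>: it follows the spiral of direction \<open>d\<close>
  up to parameter \<open>T\<close> if \<open>e = Some T\<close>, and all the way to the limit point \<open>r\<close> if \<open>e = None\<close>.\<close>

type_synonym segment = "turn \<times> real option"

fun seg_valid :: "complex \<Rightarrow> complex \<Rightarrow> segment \<Rightarrow> bool" where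
  "seg_valid r p (d, None) \<longleftrightarrow> p \<noteq> r"
| "seg_valid r p (d, Some T) \<longleftrightarrow> p \<noteq> r \<and> T > 0"

fun seg_end :: "real \<Rightarrow> complex \<Rightarrow> complex \<Rightarrow> segment \<Rightarrow> complex" where
  "seg_end \<alpha> r p (d, None) = r"
| "seg_end \<alpha> r p (d, Some T) = spiral \<alpha> r d p T"

definition arc_length :: "(real \<Rightarrow> complex) \<Rightarrow> real set \<Rightarrow> real" where
  "arc_length \<gamma> I = integral I (\<lambda>t. norm (vector_derivative \<gamma> (at t)))"

fun seg_length :: "real \<Rightarrow> complex \<Rightarrow> complex \<Rightarrow> segment \<Rightarrow> real" where
  "seg_length \<alpha> r p (d, None) = arc_length (spiral \<alpha> r d p) {0..}"
| "seg_length \<alpha> r p (d, Some T) = arc_length (spiral \<alpha> r d p) {0..T}"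

text \<open>A list of segments is read as their concatenation, starting in \<open>p\<close>. The function
  \<open>path_points\<close> lists the end points of the successive segments.\<close>

fun path_valid :: "real \<Rightarrow> complex \<Rightarrow> complex \<Rightarrow> segment list \<Rightarrow> bool" where
  "path_valid \<alpha> r p [] \<longleftrightarrow> True"
| "path_valid \<alpha> r p (s # ss) \<longleftrightarrow> seg_valid r p s \<and> path_valid \<alpha> r (seg_end \<alpha> r p s) ss"

fun path_points :: "real \<Rightarrow> complex \<Rightarrow> complex \<Rightarrow> segment list \<Rightarrow> complex list" where
  "path_points \<alpha> r p [] = []"
| "path_points \<alpha> r p (s # ss) = seg_end \<alpha> r p s # path_points \<alpha> r (seg_end \<alpha> r p s) ss"

fun path_length :: "real \<Rightarrow> complex \<Rightarrow> complex \<Rightarrow> segment list \<Rightarrow> real" where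
  "path_length \<alpha> r p [] = 0"
| "path_length \<alpha> r p (s # ss) = seg_length \<alpha> r p s + path_length \<alpha> r (seg_end \<alpha> r p s) ss"

text \<open>Every node other than the root has exactly one outgoing arc, which leads to its parent. The
  fields \<open>parent\<close> and \<open>out_arc\<close> carry no information outside \<open>nodes - {r}\<close>.\<close>

record tree =
  nodes :: "complex set"
  parent :: "complex \<Rightarrow> complex"
  out_arc :: "complex \<Rightarrow> segment list"

definition spiral_tree :: "real \<Rightarrow> complex \<Rightarrow> complex set \<Rightarrow> tree \<Rightarrow> bool" where
  "spiral_tree \<alpha> r P T \<longleftrightarrow>
     finite (nodes T) \<and> r \<in> nodes T \<and> P \<subseteq> nodes T \<and>
     (\<forall>v\<in>nodes T - {r}.
        parent T v \<in> nodes T \<and>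
        out_arc T v \<noteq> [] \<and>
        path_valid \<alpha> r v (out_arc T v) \<and>
        last (path_points \<alpha> r v (out_arc T v)) = parent T v \<and>
        (\<exists>k. (parent T ^^ k) v = r))"

definition tree_length :: "real \<Rightarrow> complex \<Rightarrow> tree \<Rightarrow> real" where
  "tree_length \<alpha> r T = (\<Sum>v\<in>nodes T - {r}. path_length \<alpha> r v (out_arc T v))"

definition optimal_spiral_tree :: "real \<Rightarrow> complex \<Rightarrow> complex set \<Rightarrow> tree \<Rightarrow> bool" where
  "optimal_spiral_tree \<alpha> r P T \<longleftrightarrow>
     spiral_tree \<alpha> r P T \<and>
     (\<forall>T'. spiral_tree \<alpha> r P T' \<longrightarrow> tree_length \<alpha> r T \<le> tree_length \<alpha> r T')"

section \<open>Real RAM\<close>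

text \<open>The machine has index memory holding natural numbers and data memory holding exact reals, each
  organised as finitely many (named) unbounded arrays with indirect addressing; a scalar variable
  is entry 0 of an array. There is no conversion from reals to indices, in particular no
  rounding. Programs are structured, and every executed operation, constant and memory access costs
  one unit. Subtraction of indices is truncated.\<close>

record store =
  idx :: "string \<Rightarrow> nat \<Rightarrow> nat"
  dat :: "string \<Rightarrow> nat \<Rightarrow> real"

datatype iexp =
    IConst nat
  | IGet string iexp
  | IAdd iexp iexp
  | ISub iexp iexp
  | IMul iexp iexp

text \<open>Besides the four arithmetic operations there are two operations on spirals around the
  point given as the first argument: \<open>Meet\<close>, the first common point of the right spiral of one
  point with the left spiral of another, and \<open>SpiralLength\<close>, the length of the
  spiral from a point to the root. Points are pairs of reals; they are not stored in a single
  memory cell.\<close>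

datatype rexp =
    RConst int
  | RGet string iexp
  | RAdd rexp rexp
  | RSub rexp rexp
  | RMul rexp rexp
  | RDiv rexp rexp
  | XCoord pexp
  | YCoord pexp
  | SpiralLength pexp pexp
and pexp =
    Point rexp rexp
  | Meet pexp pexp pexp

datatype bexp =
    ILess iexp iexp
  | RLess rexp rexp
  | BNot bexp
  | BAnd bexp bexp

datatype com =
    Skip
  | ISet string iexp iexp
  | RSet string iexp rexp
  | Seq com com
  | Cond bexp com com
  | While bexp com

definition first_meet :: "real \<Rightarrow> complex \<Rightarrow> complex \<Rightarrow> complex \<Rightarrow> complex" where
  "first_meet \<alpha> r p q =
     spiral \<alpha> r Right p (Inf {t. 0 \<le> t \<and> spiral \<alpha> r Right p t \<in> spiral \<alpha> r Left q ` {0..}})"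

primrec ival :: "iexp \<Rightarrow> store \<Rightarrow> nat" where
  "ival (IConst n) s = n"
| "ival (IGet a e) s = idx s a (ival e s)"
| "ival (IAdd e f) s = ival e s + ival f s"
| "ival (ISub e f) s = ival e s - ival f s"
| "ival (IMul e f) s = ival e s * ival f s"

primrec rval :: "real \<Rightarrow> rexp \<Rightarrow> store \<Rightarrow> real"
  and pval :: "real \<Rightarrow> pexp \<Rightarrow> store \<Rightarrow> complex" where
  "rval \<alpha> (RConst c) s = of_int c"
| "rval \<alpha> (RGet a e) s = dat s a (ival e s)"
| "rval \<alpha> (RAdd e f) s = rval \<alpha> e s + rval \<alpha> f s"
| "rval \<alpha> (RSub e f) s = rval \<alpha> e s - rval \<alpha> f s"
| "rval \<alpha> (RMul e f) s = rval \<alpha> e s * rval \<alpha> f s"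
| "rval \<alpha> (RDiv e f) s = rval \<alpha> e s / rval \<alpha> f s"
| "rval \<alpha> (XCoord p) s = Re (pval \<alpha> p s)"
| "rval \<alpha> (YCoord p) s = Im (pval \<alpha> p s)"
| "rval \<alpha> (SpiralLength r p) s = seg_length \<alpha> (pval \<alpha> r s) (pval \<alpha> p s) (Right, None)"
| "pval \<alpha> (Point e f) s = Complex (rval \<alpha> e s) (rval \<alpha> f s)"
| "pval \<alpha> (Meet r p q) s = first_meet \<alpha> (pval \<alpha> r s) (pval \<alpha> p s) (pval \<alpha> q s)"

primrec bval :: "real \<Rightarrow> bexp \<Rightarrow> store \<Rightarrow> bool" where
  "bval \<alpha> (ILess e f) s \<longleftrightarrow> ival e s < ival f s"
| "bval \<alpha> (RLess e f) s \<longleftrightarrow> rval \<alpha> e s < rval \<alpha> f s"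
| "bval \<alpha> (BNot b) s \<longleftrightarrow> \<not> bval \<alpha> b s"
| "bval \<alpha> (BAnd b c) s \<longleftrightarrow> bval \<alpha> b s \<and> bval \<alpha> c s"

primrec icost :: "iexp \<Rightarrow> nat" where
  "icost (IConst n) = 1"
| "icost (IGet a e) = 1 + icost e"
| "icost (IAdd e f) = 1 + icost e + icost f"
| "icost (ISub e f) = 1 + icost e + icost f"
| "icost (IMul e f) = 1 + icost e + icost f"

primrec rcost :: "rexp \<Rightarrow> nat" and pcost :: "pexp \<Rightarrow> nat" where
  "rcost (RConst c) = 1"
| "rcost (RGet a e) = 1 + icost e"
| "rcost (RAdd e f) = 1 + rcost e + rcost f"
| "rcost (RSub e f) = 1 + rcost e + rcost f"
| "rcost (RMul e f) = 1 + rcost e + rcost f"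
| "rcost (RDiv e f) = 1 + rcost e + rcost f"
| "rcost (XCoord p) = 1 + pcost p"
| "rcost (YCoord p) = 1 + pcost p"
| "rcost (SpiralLength r p) = 1 + pcost r + pcost p"
| "pcost (Point e f) = 1 + rcost e + rcost f"
| "pcost (Meet r p q) = 1 + pcost r + pcost p + pcost q"

primrec bcost :: "bexp \<Rightarrow> nat" where
  "bcost (ILess e f) = 1 + icost e + icost f"
| "bcost (RLess e f) = 1 + rcost e + rcost f"
| "bcost (BNot b) = 1 + bcost b"
| "bcost (BAnd b c) = 1 + bcost b + bcost c"

text \<open>\<open>exec \<alpha> c s n s'\<close>: started in \<open>s\<close>, the program \<open>c\<close> halts in \<open>s'\<close> after \<open>n\<close> steps.\<close>

inductive exec :: "real \<Rightarrow> com \<Rightarrow> store \<Rightarrow> nat \<Rightarrow> store \<Rightarrow> bool" for \<alpha> :: real where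
  exec_Skip: "exec \<alpha> Skip s 1 s"
| exec_ISet: "exec \<alpha> (ISet a i e) s (1 + icost i + icost e)
     (s\<lparr>idx := (idx s)(a := (idx s a)(ival i s := ival e s))\<rparr>)"
| exec_RSet: "exec \<alpha> (RSet a i e) s (1 + icost i + rcost e)
     (s\<lparr>dat := (dat s)(a := (dat s a)(ival i s := rval \<alpha> e s))\<rparr>)"
| exec_Seq: "exec \<alpha> c s m s' \<Longrightarrow> exec \<alpha> d s' n s'' \<Longrightarrow> exec \<alpha> (Seq c d) s (m + n) s''"
| exec_IfTrue: "bval \<alpha> b s \<Longrightarrow> exec \<alpha> c s n s' \<Longrightarrow> exec \<alpha> (Cond b c d) s (1 + bcost b + n) s'"
| exec_IfFalse: "\<not> bval \<alpha> b s \<Longrightarrow> exec \<alpha> d s n s' \<Longrightarrow> exec \<alpha> (Cond b c d) s (1 + bcost b + n) s'"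
| exec_WhileFalse: "\<not> bval \<alpha> b s \<Longrightarrow> exec \<alpha> (While b c) s (1 + bcost b) s"
| exec_WhileTrue: "bval \<alpha> b s \<Longrightarrow> exec \<alpha> c s m s' \<Longrightarrow> exec \<alpha> (While b c) s' n s'' \<Longrightarrow>
     exec \<alpha> (While b c) s (1 + bcost b + m + n) s''"

section \<open>Input and output conventions\<close>

text \<open>All cells not mentioned in the input contain 0.\<close>

definition input_store :: "complex \<Rightarrow> complex list \<Rightarrow> store" where
  "input_store r ts =
     \<lparr>idx = (\<lambda>a i. if a = ''n'' \<and> i = 0 then length ts else 0),
      dat = (\<lambda>a i.
        if a = ''rx'' \<and> i = 0 then Re r
        else if a = ''ry'' \<and> i = 0 then Im r
        else if a = ''x'' \<and> i < length ts then Re (ts ! i)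
        else if a = ''y'' \<and> i < length ts then Im (ts ! i)
        else 0)\<rparr>"

text \<open>Output: the nodes are numbered from 0 to below \<open>nodes[0]\<close>, without repetition. Node \<open>k\<close> has
  coordinates \<open>(X[k], Y[k])\<close> and, unless it is the root, its parent is node \<open>parent[k]\<close>. Its arc consists of
  the segments numbered from \<open>start[k]\<close> to below \<open>stop[k]\<close>; segment \<open>j\<close> is a piece of a right
  (\<open>turn[j] = 0\<close>) or left (\<open>turn[j] = 1\<close>) spiral and ends in \<open>(SX[j], SY[j])\<close>. A spiral
  never returns to the same distance from the root, so these data determine the segment.\<close>

definition output_tree :: "real \<Rightarrow> complex \<Rightarrow> store \<Rightarrow> tree \<Rightarrow> bool" where
  "output_tree \<alpha> r s T \<longleftrightarrow>
     (let m = idx s ''nodes'' 0;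
          node = (\<lambda>k. Complex (dat s ''X'' k) (dat s ''Y'' k));
          turn_code = (\<lambda>d. case d of Right \<Rightarrow> 0 | Left \<Rightarrow> 1);
          seg_point = (\<lambda>j. Complex (dat s ''SX'' j) (dat s ''SY'' j))
      in inj_on node {..<m} \<and> nodes T = node ` {..<m} \<and>
         (\<forall>k<m. node k \<noteq> r \<longrightarrow>
            idx s ''parent'' k < m \<and>
            parent T (node k) = node (idx s ''parent'' k) \<and>
            (let js = [idx s ''start'' k..<idx s ''stop'' k] in
               map (turn_code \<circ> fst) (out_arc T (node k)) = map (idx s ''turn'') js \<and>
               path_points \<alpha> r (node k) (out_arc T (node k)) = map seg_point js)))"

end

theory Submission
  imports Defs
begin

text \<open>In the coordinates \<open>a = u - x\<close>, \<open>b = u + x\<close>, where \<open>u = - ln R\<close> and \<open>x = \<phi> / tan \<alpha>\<close>, right and left spirals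
  become lines along the two axes, and the points reachable from a point are those with larger
  \<open>a\<close> and \<open>b\<close>, up to full turns. A spiral arc from \<open>p\<close> to \<open>q\<close> has length proportional to
  \<open>|p - r| - |q - r|\<close>, whatever spirals it uses. Hence the length of a tree is, up to a constant
  factor, the sum of the distances of the terminals from \<open>r\<close>, minus one saving
  \<open>|v - r|\<close> for each binary merge at a node \<open>v\<close>.

  Terminals outside each other's regions can be lifted to a bi-infinite sequence along which \<open>a\<close>
  decreases and \<open>b\<close> increases strictly. So the saving of merging a set of lifted terminals is
  at most \<open>exp (- (a l + b m) / 2)\<close> for its extreme elements \<open>l\<close> and \<open>m\<close>, which is the distance of
  the meeting point of the right spiral of \<open>l\<close> and the left spiral of \<open>m\<close>. An exchange argument,
  which uses only that this bound decreases when the interval grows, shows that trees merging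
  adjacent intervals are best; the best one of these is found by dynamic programming over the
  circular intervals.\<close>

section \<open>Binary trees over cyclically ordered terminals\<close>

text \<open>The lower bound must hold against every spiral tree, also one whose merges join distant
  terminals or whose arcs wind around the root. So a merge tree cannot be assumed to live on one
  lift of the terminals: its leaves carry integers, different subtrees may use different lifts, and
  only residues modulo the number of terminals are counted. The hypothesis on spiral regions is what
  makes \<open>a\<close> and \<open>b\<close> monotone in opposite directions; therefore the largest
  \<open>a\<close> and the largest \<open>b\<close> in a set of lifts occur at its least and its
  greatest index, and the bound on a saving depends on these two alone. The bound is attained on
  sets spanning less than a full turn, where the spirals of the two extremes first meet at the
  corner \<open>pt (a l) (b m)\<close>. This is enough, since a tree of adjacent merges lies in a
  window of n consecutive positions. Where the circle has to be cut is unknown, so all n windows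
  compete; laying the sorted terminals out twice makes each of them an ordinary interval of one
  table with O(n^2) cells and O(n) splits per cell.\<close>

text \<open>A leaf is a block of consecutive integers, taken modulo the number of terminals.\<close>

datatype ltree = Leaf int int | Node ltree ltree

primrec lft :: "ltree \<Rightarrow> int" where
  "lft (Leaf l r) = l"
| "lft (Node s t) = min (lft s) (lft t)"

primrec rgt :: "ltree \<Rightarrow> int" where
  "rgt (Leaf l r) = r"
| "rgt (Node s t) = max (rgt s) (rgt t)"

primrec proper :: "ltree \<Rightarrow> bool" where
  "proper (Leaf l r) \<longleftrightarrow> l \<le> r"
| "proper (Node s t) \<longleftrightarrow> proper s \<and> proper t"

primrec subtrees :: "ltree \<Rightarrow> ltree set" where
  "subtrees (Leaf l r) = {Leaf l r}"
| "subtrees (Node s t) = insert (Node s t) (subtrees s \<union> subtrees t)"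

primrec leaves :: "ltree \<Rightarrow> nat" where
  "leaves (Leaf l r) = 1"
| "leaves (Node s t) = leaves s + leaves t"

primrec shift :: "int \<Rightarrow> ltree \<Rightarrow> ltree" where
  "shift d (Leaf l r) = Leaf (l + d) (r + d)"
| "shift d (Node s t) = Node (shift d s) (shift d t)"

lemma lft_shift [simp]: "lft (shift d t) = lft t + d"
  by (induction t) auto

lemma rgt_shift [simp]: "rgt (shift d t) = rgt t + d"
  by (induction t) auto

lemma proper_shift [simp]: "proper (shift d t) = proper t"
  by (induction t) auto

lemma leaves_shift [simp]: "leaves (shift d t) = leaves t"
  by (induction t) auto

lemma subtrees_refl [simp]: "t \<in> subtrees t"
  by (cases t) auto

lemma subtrees_trans: "s \<in> subtrees t \<Longrightarrow> u \<in> subtrees s \<Longrightarrow> u \<in> subtrees t"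
  by (induction t) auto

lemma subtrees_proper: "s \<in> subtrees t \<Longrightarrow> proper t \<Longrightarrow> proper s"
  by (induction t) auto

lemma subtrees_bounds: "s \<in> subtrees t \<Longrightarrow> lft t \<le> lft s \<and> rgt s \<le> rgt t"
  by (induction t) (auto simp: min_def max_def)

lemma lft_le_rgt: "proper t \<Longrightarrow> lft t \<le> rgt t"
  by (induction t) (auto simp: min_def max_def)

lemma lft_leaf: "\<exists>r. Leaf (lft t) r \<in> subtrees t"
  by (induction t) (auto simp: min_def)

lemma rgt_leaf: "\<exists>l. Leaf l (rgt t) \<in> subtrees t"
  by (induction t) (auto simp: max_def)

lemma ex_cherry: "t = Node x y \<Longrightarrow>
    \<exists>l1 r1 l2 r2. Node (Leaf l1 r1) (Leaf l2 r2) \<in> subtrees t"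
proof (induction t arbitrary: x y)
  case (Node u v)
  show ?case
  proof (cases u)
    case u: (Leaf l r)
    show ?thesis
    proof (cases v)
      case (Leaf l' r')
      with u show ?thesis by auto
    next
      case (Node v1 v2)
      with Node.IH(2) show ?thesis by fastforce
    qed
  next
    case (Node u1 u2)
    with Node.IH(1) show ?thesis by fastforce
  qed
qed simp

text \<open>Going up from \<open>s\<close> to the root, \<open>P\<close> is lost at some node
  \<open>u\<close>; \<open>q\<close> is its child on that way and \<open>z\<close> the sibling. Used
  with \<open>P\<close> saying that a subtree fits into a gap.\<close>

lemma climb:
  assumes "s \<in> subtrees t" "P s" "\<not> P t"
  shows "\<exists>u q z. u \<in> subtrees t \<and> (u = Node q z \<or> u = Node z q) \<and> P q \<and> \<not> P u"
  using assms
proof (induction t)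
  case (Node x y)
  then consider "s \<in> subtrees x" | "s \<in> subtrees y" by auto
  then show ?case
  proof cases
    case 1
    show ?thesis
    proof (cases "P x")
      case True
      with Node.prems show ?thesis by (intro exI[of _ "Node x y"] exI[of _ x] exI[of _ y]) auto
    next
      case False
      with Node.IH(1)[OF 1] Node.prems show ?thesis by auto
    qed
  next
    case 2
    show ?thesis
    proof (cases "P y")
      case True
      with Node.prems show ?thesis by (intro exI[of _ "Node x y"] exI[of _ y] exI[of _ x]) auto
    next
      case False
      with Node.IH(2)[OF 2] Node.prems show ?thesis by auto
    qed
  qed
qed auto

text \<open>\<open>G l r\<close> stands for the saving of a merge whose extreme terminals are
  \<open>l\<close> and \<open>r\<close>. Periodicity is what allows a subtree to be moved by full
  turns without changing its value.\<close>

locale cyclic_savings =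
  fixes n :: int and G :: "int \<Rightarrow> int \<Rightarrow> real"
  assumes n_pos: "0 < n"
    and G_nonneg: "0 \<le> G l r"
    and G_mono: "l' \<le> l \<Longrightarrow> r \<le> r' \<Longrightarrow> G l' r' \<le> G l r"
    and G_shift1: "G (l + n) (r + n) = G l r"
begin

text \<open>The greatest saving over merge trees on \<open>l..r\<close> that only join adjacent
  intervals. The recurrence is that of optimal binary search trees: the gain at a node depends on
  its end points only.\<close>

function F :: "int \<Rightarrow> int \<Rightarrow> real" where
  "F l r = (if l < r then G l r + Max ((\<lambda>m. F l m + F (m + 1) r) ` {l..<r}) else 0)"
  by auto
termination
  by (relation "Wellfounded.measure (\<lambda>(l, r). nat (r - l))") auto

declare F.simps [simp del]

lemma F_refl [simp]: "F l l = 0"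
  by (simp add: F.simps)

lemma F_split: "l \<le> m \<Longrightarrow> m < r \<Longrightarrow> F l m + F (m + 1) r + G l r \<le> F l r"
  by (subst (3) F.simps) (auto intro!: Max_ge)

lemma F_attained:
  assumes "l \<le> m" "m < r" and best: "\<And>m'. l \<le> m' \<Longrightarrow> m' < r \<Longrightarrow> F l m' + F (m' + 1) r \<le> F l m + F (m + 1) r"
  shows "F l r = F l m + F (m + 1) r + G l r"
proof -
  have "Max ((\<lambda>m. F l m + F (m + 1) r) ` {l..<r}) = F l m + F (m + 1) r"
    using assms by (intro Max_eqI) auto
  then show ?thesis using assms(1,2) by (subst F.simps) simp
qed

lemma F_nonneg: "0 \<le> F l r"
proof (induction l r rule: F.induct)
  case (1 l r)
  show ?case
  proof (cases "l < r")
    case True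
    have "0 \<le> F l l + F (l + 1) r" using 1 True by simp
    with F_split[of l l r] G_nonneg[of l r] True show ?thesis by simp
  qed (simp add: F.simps)
qed

lemma F_shift1: "F (l + n) (r + n) = F l r"
proof (induction l r rule: F.induct)
  case (1 l r)
  show ?case
  proof (cases "l < r")
    case True
    have "(\<lambda>m. F (l + n) m + F (m + 1) (r + n)) ` {l + n..<r + n}
        = (\<lambda>m. F (l + n) m + F (m + 1) (r + n)) ` ((\<lambda>m. m + n) ` {l..<r})"
      by simp
    also have "\<dots> = (\<lambda>m. F l m + F (m + 1) r) ` {l..<r}"
      unfolding image_image
    proof (rule image_cong[OF refl])
      fix m assume "m \<in> {l..<r}"
      with 1 True show "F (l + n) (m + n) + F (m + n + 1) (r + n) = F l m + F (m + 1) r"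
        by (metis add.commute add.left_commute)
    qed
    finally show ?thesis using True G_shift1[of l r]
      by (subst (1 2) F.simps) (simp del: image_add_atLeastLessThan)
  qed (simp add: F.simps)
qed

lemma periodic:
  fixes H :: "int \<Rightarrow> int \<Rightarrow> real"
  assumes H: "\<And>l r. H (l + n) (r + n) = H l r" and "n dvd d"
  shows "H (l + d) (r + d) = H l r"
proof -
  have up: "H (l + int k * n) (r + int k * n) = H l r" for k l r
  proof (induction k)
    case (Suc k)
    then show ?case using H[of "l + int k * n" "r + int k * n"] by (simp add: algebra_simps)
  qed simp
  obtain k where k: "d = n * k" using assms(2) by blast
  show ?thesis
  proof (cases "k \<ge> 0")
    case True
    with up[of l "nat k" r] k show ?thesis by (simp add: algebra_simps)
  next
    case False
    with up[of "l + d" "nat (- k)" "r + d"] k show ?thesis by (simp add: algebra_simps)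
  qed
qed

lemmas G_shift = periodic[of G, OF G_shift1]
lemmas F_shift = periodic[of F, OF F_shift1]

text \<open>A leaf counts as if its block had already been merged optimally, so that two adjacent
  sibling blocks can be fused without loss. In general the span of a node is the hull of its leaves,
  gaps included.\<close>

primrec val :: "ltree \<Rightarrow> real" where
  "val (Leaf l r) = F l r"
| "val (Node s t) = val s + val t + G (min (lft s) (lft t)) (max (rgt s) (rgt t))"

text \<open>A multiset, so that a count of at most 1 says that no terminal is used twice, even under
  two different lifts.\<close>

primrec res :: "ltree \<Rightarrow> int multiset" where
  "res (Leaf l r) = image_mset (\<lambda>x. x mod n) (mset_set {l..r})"
| "res (Node s t) = res s + res t"

lemma val_shift: "n dvd d \<Longrightarrow> val (shift d t) = val t"
proof (induction t)
  case (Node s t)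
  have "min (lft s + d) (lft t + d) = min (lft s) (lft t) + d"
    "max (rgt s + d) (rgt t + d) = max (rgt s) (rgt t) + d" by auto
  with Node G_shift show ?case by simp
qed (simp add: F_shift)

lemma res_shift:
  assumes "n dvd d" shows "res (shift d t) = res t"
proof (induction t)
  case (Leaf l r)
  have "mset_set {l + d..r + d} = image_mset (\<lambda>x. x + d) (mset_set {l..r})"
    by (subst image_mset_mset_set) (auto simp: inj_on_def)
  moreover have "(x + d) mod n = x mod n" for x
    using assms by (metis add.right_neutral dvd_imp_mod_0 mod_add_right_eq)
  ultimately show ?case by (simp add: multiset.map_comp comp_def)
qed simp

text \<open>As \<open>c'\<close> lies within the span of \<open>c\<close>, the spans of all
  ancestors can only shrink and, \<open>G\<close> being monotone, their savings can only grow. The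
  last clause records which other subtrees are certain to survive: all but those inside
  \<open>c\<close> and those containing it.\<close>

lemma replace:
  assumes "c \<in> subtrees t" "proper t" "proper c'" "lft c \<le> lft c'" "rgt c' \<le> rgt c"
  shows "\<exists>t'. proper t' \<and> lft t \<le> lft t' \<and> rgt t' \<le> rgt t \<and> val t - val c \<le> val t' - val c' \<and>
      res t' + res c = res t + res c' \<and> leaves t' + leaves c = leaves t + leaves c' \<and>
      c' \<in> subtrees t' \<and>
      (\<forall>k\<in>subtrees t. k \<in> subtrees c \<or> k \<in> subtrees t' \<or> c \<in> subtrees k)"
  using assms
proof (induction t)
  case (Leaf l r)
  then show ?case by (intro exI[of _ c']) auto
next
  case (Node x y)
  consider "c = Node x y" | "c \<in> subtrees x" | "c \<in> subtrees y" using Node.prems by auto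
  then show ?case
  proof cases
    case 1
    with Node.prems show ?thesis by (intro exI[of _ c']) auto
  next
    case 2
    with Node obtain x' where x': "proper x'" "lft x \<le> lft x'" "rgt x' \<le> rgt x"
      "val x - val c \<le> val x' - val c'" "res x' + res c = res x + res c'"
      "leaves x' + leaves c = leaves x + leaves c'" "c' \<in> subtrees x'"
      "\<forall>k\<in>subtrees x. k \<in> subtrees c \<or> k \<in> subtrees x' \<or> c \<in> subtrees k" by auto
    have "G (min (lft x) (lft y)) (max (rgt x) (rgt y)) \<le> G (min (lft x') (lft y)) (max (rgt x') (rgt y))"
      using x' by (intro G_mono) auto
    with x' Node.prems 2 show ?thesis
      by (intro exI[of _ "Node x' y"]) (auto simp: ac_simps)
  next
    case 3
    with Node obtain y' where y': "proper y'" "lft y \<le> lft y'" "rgt y' \<le> rgt y"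
      "val y - val c \<le> val y' - val c'" "res y' + res c = res y + res c'"
      "leaves y' + leaves c = leaves y + leaves c'" "c' \<in> subtrees y'"
      "\<forall>k\<in>subtrees y. k \<in> subtrees c \<or> k \<in> subtrees y' \<or> c \<in> subtrees k" by auto
    have "G (min (lft x) (lft y)) (max (rgt x) (rgt y)) \<le> G (min (lft x) (lft y')) (max (rgt x) (rgt y'))"
      using y' by (intro G_mono) auto
    with y' Node.prems 3 show ?thesis
      by (intro exI[of _ "Node x y'"]) (auto simp: ac_simps)
  qed
qed

lemma res_memE:
  assumes "z \<in># res t"
  obtains l r x where "Leaf l r \<in> subtrees t" "l \<le> x" "x \<le> r" "x mod n = z"
  using assms
proof (induction t arbitrary: thesis)
  case (Leaf l r)
  then show ?case by auto
next
  case (Node s t)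
  then show ?case by (metis UnI1 UnI2 insertI2 res.simps(2) subtrees.simps(2) union_iff)
qed

lemma res_memI: "Leaf l r \<in> subtrees t \<Longrightarrow> l \<le> x \<Longrightarrow> x \<le> r \<Longrightarrow> x mod n \<in># res t"
  by (induction t) auto

text \<open>A terminal occurs once, hence in one leaf and under one lift: equal residues force not
  only the same leaf but the same integer.\<close>

lemma leaf_unique:
  assumes "\<And>z. count (res t) z \<le> 1"
    and "Leaf l r \<in> subtrees t" "l \<le> x" "x \<le> r"
    and "Leaf l' r' \<in> subtrees t" "l' \<le> y" "y \<le> r'"
    and "x mod n = y mod n"
  shows "l = l' \<and> r = r' \<and> x = y"
  using assms
proof (induction t)
  case (Leaf u v)
  have "x = y"
  proof (rule ccontr)
    assume "x \<noteq> y"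
    \<comment> \<open>Two integers of one residue in the same block would make that residue count
      twice.\<close>
    have "{x, y} \<subseteq> {u..v}" using Leaf.prems by auto
    then have "mset_set {x, y} \<subseteq># mset_set {u..v}" by (simp add: subset_imp_msubset_mset_set)
    then have "image_mset (\<lambda>x. x mod n) (mset_set {x, y}) \<subseteq># res (Leaf u v)"
      by (simp add: image_mset_subseteq_mono)
    moreover have "count (image_mset (\<lambda>x. x mod n) (mset_set {x, y})) (x mod n) = 2"
      using \<open>x \<noteq> y\<close> Leaf.prems(8) by simp
    ultimately have "2 \<le> count (res (Leaf u v)) (x mod n)"
      by (metis mset_subset_eq_count)
    with Leaf.prems(1)[of "x mod n"] show False by simp
  qed
  with Leaf.prems show ?case by auto
next
  case (Node s t)
  have c: "count (res s) z + count (res t) z \<le> 1" for z using Node.prems(1)[of z] by simp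
  have cs: "count (res s) z \<le> 1" "count (res t) z \<le> 1" for z
    using c[of z] by auto
  have no: "\<not> (z \<in># res s \<and> z \<in># res t)" for z
    using c[of z] by (auto simp: Suc_le_eq simp flip: count_greater_zero_iff)
  have "Leaf l r \<in> subtrees s \<or> Leaf l r \<in> subtrees t" "Leaf l' r' \<in> subtrees s \<or> Leaf l' r' \<in> subtrees t"
    using Node.prems by auto
  moreover have "\<not> (Leaf l r \<in> subtrees s \<and> Leaf l' r' \<in> subtrees t)"
    "\<not> (Leaf l r \<in> subtrees t \<and> Leaf l' r' \<in> subtrees s)"
    using no res_memI Node.prems by metis+
  ultimately show ?case using Node.IH cs Node.prems by metis
qed

lemma dvd_small: "n dvd d \<Longrightarrow> 0 < d \<Longrightarrow> n \<le> d"
  by (rule zdvd_imp_le)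

definition complete :: "ltree \<Rightarrow> bool" where
  "complete t \<longleftrightarrow> proper t \<and> res t = mset_set {0..<n}"

lemma complete_count: "complete t \<Longrightarrow> count (res t) z \<le> 1"
  by (simp add: complete_def count_mset_set')

lemma res_subset: "c \<in> subtrees t \<Longrightarrow> res c \<subseteq># res t"
  by (induction t) (auto intro: subset_mset.order_trans)

text \<open>Overlapping blocks would share the integer \<open>max l1 l2\<close>, whose residue would
  then occur twice.\<close>

lemma cherry_order:
  assumes "complete t" and ch: "Node (Leaf l1 r1) (Leaf l2 r2) \<in> subtrees t"
  shows "l1 \<le> r1" "l2 \<le> r2" "r1 < l2 \<or> r2 < l1"
proof -
  show bd: "l1 \<le> r1" "l2 \<le> r2" using subtrees_proper[OF ch] assms(1) by (auto simp: complete_def)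
  show "r1 < l2 \<or> r2 < l1"
  proof (rule ccontr)
    assume "\<not> ?thesis"
    then have m: "l1 \<le> max l1 l2" "max l1 l2 \<le> r1" "l2 \<le> max l1 l2" "max l1 l2 \<le> r2" using bd by auto
    let ?m = "max l1 l2 mod n"
    have two: "z \<in># A \<Longrightarrow> z \<in># B \<Longrightarrow> 2 \<le> count (A + B) z" for z :: int and A B
      by (metis add_mono count_greater_eq_one_iff count_union one_add_one)
    have "2 \<le> count (res (Leaf l1 r1) + res (Leaf l2 r2)) ?m"
      using m by (intro two res_memI[of l1 r1] res_memI[of l2 r2]) auto
    with mset_subset_eq_count[OF res_subset[OF ch], of ?m] complete_count[OF assms(1), of ?m]
    show False by simp
  qed
qed

text \<open>A cherry consists of two sibling leaves. If they are adjacent, they become one block. Otherwise take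
  a largest subtree \<open>q\<close> that fits, after a shift, into the gap between them, and regraft it next to one of the
  two leaves. The sibling of \<open>q\<close> sticks out of the gap on one side; on that side the new saving is at least the
  one lost. The new tree has a cherry with a smaller gap.\<close>

lemma contract_cherry:
  assumes "complete t" "r1 < l2"
    and "k \<in> subtrees t"
    and "k = Node (Leaf l1 r1) (Leaf l2 r2) \<or> k = Node (Leaf l2 r2) (Leaf l1 r1)"
  shows "\<exists>t'. complete t' \<and> leaves t' < leaves t \<and> val t \<le> val t'"
  using assms
proof (induction "nat (l2 - r1)" arbitrary: t k l1 r1 l2 r2 rule: less_induct)
  case less
  note t = less.prems(1) and gap = less.prems(2) and k = less.prems(3) and kd = less.prems(4)
  have pt: "proper t" and rt: "res t = mset_set {0..<n}" using t by (auto simp: complete_def)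
  have pk: "l1 \<le> r1" "l2 \<le> r2" using subtrees_proper[OF k pt] kd by auto
  have hk: "lft k = l1" "rgt k = r2" using kd gap pk by auto
  have vk: "val k = F l1 r1 + F l2 r2 + G l1 r2" using kd gap pk by (auto simp: min_def max_def)
  have rk: "res k = res (Leaf l1 r1) + res (Leaf l2 r2)" using kd by (auto simp: ac_simps)
  have nk: "leaves k = 2" using kd by auto
  have lf1: "Leaf l1 r1 \<in> subtrees t" and lf2: "Leaf l2 r2 \<in> subtrees t"
    using subtrees_trans[OF k] kd by auto
  note uniq = leaf_unique[OF complete_count[OF t]]
  \<comment> \<open>The gap is compared with a full turn. In the case \<open>eq\<close> the integers
    \<open>r1\<close> and \<open>l2\<close> would have the same residue.\<close>
  consider (adj) "l2 = r1 + 1" | (far) "r1 + n < l2" | (eq) "l2 = r1 + n"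
    | (mid) "r1 + 1 < l2" "l2 < r1 + n" using gap by linarith
  then show ?case
  proof cases
    case adj
    obtain t' where t': "proper t'" "val t - val k \<le> val t' - val (Leaf l1 r2)"
      "res t' + res k = res t + res (Leaf l1 r2)" "leaves t' + leaves k = leaves t + leaves (Leaf l1 r2)"
      using replace[OF k pt, of "Leaf l1 r2"] hk pk gap by auto
    have "{l1..r2} = {l1..r1} \<union> {l2..r2}" "{l1..r1} \<inter> {l2..r2} = {}" using adj pk by auto
    then have "res k = res (Leaf l1 r2)" unfolding rk by (simp add: mset_set_Union)
    then have "res t' = res t" using t'(3) by simp
    moreover have "val k \<le> val (Leaf l1 r2)" unfolding vk using F_split[of l1 r1 r2] adj pk by simp
    ultimately show ?thesis using t' nk rt by (intro exI[of _ t']) (auto simp: complete_def)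
  next
    case far
    \<comment> \<open>More than a turn apart: the right block moves back by one turn and still lies
      to the right of \<open>r1\<close>. The span does not grow, and the gap drops by
      \<open>n\<close>, so the induction hypothesis contracts the new tree.\<close>
    let ?k = "Node (Leaf l1 r1) (Leaf (l2 - n) (r2 - n))"
    obtain t' where t': "proper t'" "val t - val k \<le> val t' - val ?k"
      "res t' + res k = res t + res ?k" "leaves t' + leaves k = leaves t + leaves ?k" "?k \<in> subtrees t'"
      using replace[OF k pt, of ?k] hk pk far n_pos by (auto simp: min_def max_def)
    have "res ?k = res k" unfolding rk using res_shift[of "- n" "Leaf l2 r2"] by simp
    then have "res t' = res t" using t'(3) by simp
    moreover have "val k \<le> val ?k" unfolding vk
      using F_shift[of "- n" l2 r2] G_mono[of l1 l1 "r2 - n" r2] pk far n_pos by (simp add: max_def min_def)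
    moreover have "leaves t' = leaves t" using t'(4) nk by simp
    moreover have "\<exists>t''. complete t'' \<and> leaves t'' < leaves t' \<and> val t' \<le> val t''"
      by (rule less.hyps[of "l2 - n" r1 t' ?k]) (use t' far n_pos rt \<open>res t' = res t\<close> in \<open>auto simp: complete_def\<close>)
    ultimately show ?thesis using t'(2) by fastforce
  next
    case eq
    then have "r1 mod n = l2 mod n" by simp
    with uniq[OF lf1 _ _ lf2, of r1 l2] pk gap show ?thesis by simp
  next
    case mid
    \<comment> \<open>The first position of the gap belongs to some leaf, possibly under another
      lift; \<open>d\<close> is the shift by full turns that brings this leaf onto
      \<open>r1 + 1\<close>.\<close>
    have "(r1 + 1) mod n \<in># res t" using rt n_pos by simp
    then obtain g1 g2 x where g: "Leaf g1 g2 \<in> subtrees t" "g1 \<le> x" "x \<le> g2" "x mod n = (r1 + 1) mod n"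
      by (rule res_memE)
    define d where "d = r1 + 1 - x"
    have d: "n dvd d" using g(4) unfolding d_def by (metis mod_eq_dvd_iff)
    have dm: "(y - d) mod n = y mod n" for y using d by (metis minus_mod_eq_mult_div dvd_imp_mod_0 mod_diff_right_eq diff_zero)
    have x: "x = r1 + 1 - d" by (simp add: d_def)
    \<comment> \<open>The shifted leaf stays in the gap. If it reached \<open>r1\<close> or
      \<open>l2\<close>, the unshifted leaf would contain an integer with the residue of that end,
      hence be the cherry's leaf at that end with \<open>d = 0\<close>, which does not contain
      \<open>r1 + 1\<close>.\<close>
    have P_leaf: "r1 < g1 + d \<and> g2 + d < l2"
    proof (rule conjI; rule ccontr)
      assume "\<not> r1 < g1 + d"
      then have "g1 \<le> r1 - d" "r1 - d \<le> g2" using g x by auto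
      from uniq[OF g(1) this lf1 pk(1) order_refl dm] g x show False by auto
    next
      assume "\<not> g2 + d < l2"
      then have "g1 \<le> l2 - d" "l2 - d \<le> g2" using g x gap by auto
      from uniq[OF g(1) this lf2 order_refl pk(2) dm] g x mid show False by auto
    qed
    define P where "P q \<longleftrightarrow> r1 < lft q + d \<and> rgt q + d < l2" for q
    have "\<not> P t" using subtrees_bounds[OF lf1] subtrees_bounds[OF lf2] pk unfolding P_def by auto
    moreover have "P (Leaf g1 g2)" using P_leaf by (simp add: P_def)
    ultimately obtain u q z where u: "u \<in> subtrees t" "u = Node q z \<or> u = Node z q" "P q" "\<not> P u"
      using climb[OF g(1), of P] by metis
    have pqz: "proper q" "proper z" using subtrees_proper[OF u(1) pt] u(2) by auto
    have sub: "q \<in> subtrees t" "z \<in> subtrees t" using subtrees_trans[OF u(1)] u(2) by auto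
    \<comment> \<open>\<open>q\<close> contains no leaf of the cherry: the shift moving such a leaf
      into the gap would be a nonzero multiple of \<open>n\<close>, and the gap is too short for
      that.\<close>
    have not1: "Leaf l1 r1 \<notin> subtrees q"
    proof
      assume "Leaf l1 r1 \<in> subtrees q"
      from subtrees_bounds[OF this] u(3) pk have "0 < d" "r1 + d < l2" by (auto simp: P_def)
      with dvd_small[OF d] mid show False by auto
    qed
    have not2: "Leaf l2 r2 \<notin> subtrees q"
    proof
      assume "Leaf l2 r2 \<in> subtrees q"
      from subtrees_bounds[OF this] u(3) pk have "0 < - d" "r1 < l2 + d" by (auto simp: P_def)
      with dvd_small[of "- d"] d mid show False by auto
    qed
    \<comment> \<open>\<open>q\<close> is cut out: its parent \<open>u\<close> collapses to the
      sibling \<open>z\<close>.\<close>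
    obtain t1 where t1: "proper t1" "val t - val u \<le> val t1 - val z" "res t1 + res u = res t + res z"
      "leaves t1 + leaves u = leaves t + leaves z"
      "\<forall>k\<in>subtrees t. k \<in> subtrees u \<or> k \<in> subtrees t1 \<or> u \<in> subtrees k" "z \<in> subtrees t1"
      using replace[OF u(1) pt pqz(2)] u(2) by auto
    \<comment> \<open>The cherry survives the cut. It is not inside \<open>q\<close>, and it
      contains \<open>u\<close> only if equal to it, in which case \<open>q\<close> would be one of
      its two leaves.\<close>
    have k1: "k \<in> subtrees t1"
    proof -
      have "k \<in> subtrees u \<Longrightarrow> k \<noteq> u \<Longrightarrow> k \<in> subtrees q \<or> k \<in> subtrees z" using u(2) by auto
      moreover have "k \<notin> subtrees q" using not1 subtrees_trans[of k q] kd by auto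
      moreover have "k \<noteq> u" using not1 not2 kd u(2) by auto
      moreover have "u \<in> subtrees k \<Longrightarrow> k = u" using kd u(2) by auto
      ultimately show ?thesis using t1(5,6) k subtrees_trans by metis
    qed
    define q' where "q' = shift d q"
    have q': "proper q'" "lft q' = lft q + d" "rgt q' = rgt q + d" "res q' = res q" "val q' = val q"
      "leaves q' = leaves q" using pqz res_shift[OF d] val_shift[OF d] by (auto simp: q'_def)
    have inside: "r1 < lft q'" "rgt q' < l2" "lft q' \<le> rgt q'" using u(3) q' lft_le_rgt[OF q'(1)] by (auto simp: P_def)
    \<comment> \<open>By periodicity the saving lost at \<open>u\<close> can be measured in the lift
      in which \<open>q\<close> has become \<open>q'\<close>.\<close>
    have Gu: "val u = val q + val z + G (lft u + d) (rgt u + d)"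
      using u(2) G_shift[OF d, of "lft u" "rgt u"] by (auto simp: min.commute max.commute)
    have hu: "lft u + d \<le> lft q'" "rgt q' \<le> rgt u + d" "lft u \<le> lft z" "rgt z \<le> rgt u" using u(2) q' by auto
    \<comment> \<open>The cut-out subtree is grafted inside the cherry. The span of the cherry stays
      the same and one new merge arises, whose saving has to make up for the one lost at
      \<open>u\<close>; the side depends on where \<open>z\<close> sticks out of the gap.\<close>
    have "\<exists>k'. proper k' \<and> lft k' = l1 \<and> rgt k' = r2 \<and> res k' = res k + res q \<and> leaves k' = leaves k + leaves q \<and>
       val k + val u - val z \<le> val k' \<and> q' \<in> subtrees k' \<and>
       (Node (Leaf l1 r1) q' \<in> subtrees k' \<or> Node q' (Leaf l2 r2) \<in> subtrees k')"
    proof (cases "lft z + d \<le> r1")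
      case True
      \<comment> \<open>Otherwise a leaf of \<open>z\<close> would start, after the shift, within
        \<open>l1..r1\<close> but after \<open>l1\<close>. Sharing a residue with that block, it
        would be the block itself, unshifted, and start at \<open>l1\<close>.\<close>
      have "lft z + d \<le> l1"
      proof (rule ccontr)
        assume "\<not> ?thesis"
        moreover obtain e where e: "Leaf (lft z) e \<in> subtrees z" using lft_leaf by blast
        moreover have "Leaf (lft z) e \<in> subtrees t" "lft z \<le> e"
          using e subtrees_trans[OF sub(2)] subtrees_proper[OF e pqz(2)] by auto
        moreover have "lft z mod n = (lft z + d) mod n" using dm[of "lft z + d"] by simp
        ultimately show False using uniq[of "lft z" e "lft z" l1 r1 "lft z + d"] lf1 True by auto
      qed
      then have "G (lft u + d) (rgt u + d) \<le> G l1 (rgt q')" using hu by (intro G_mono) auto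
      then show ?thesis using q' pk inside gap vk Gu rk nk
        by (intro exI[of _ "Node (Node (Leaf l1 r1) q') (Leaf l2 r2)"]) (auto simp: min_def max_def ac_simps)
    next
      case False
      then have zr: "l2 \<le> rgt z + d" using u(2,3,4) by (auto simp: P_def)
      have "r2 \<le> rgt z + d"
      proof (rule ccontr)
        assume "\<not> ?thesis"
        moreover obtain e where e: "Leaf e (rgt z) \<in> subtrees z" using rgt_leaf by blast
        moreover have "Leaf e (rgt z) \<in> subtrees t" "e \<le> rgt z"
          using e subtrees_trans[OF sub(2)] subtrees_proper[OF e pqz(2)] by auto
        moreover have "rgt z mod n = (rgt z + d) mod n" using dm[of "rgt z + d"] by simp
        ultimately show False using uniq[of e "rgt z" "rgt z" l2 r2 "rgt z + d"] lf2 zr by auto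
      qed
      then have "G (lft u + d) (rgt u + d) \<le> G (lft q') r2" using hu by (intro G_mono) auto
      then show ?thesis using q' pk inside gap vk Gu rk nk
        by (intro exI[of _ "Node (Leaf l1 r1) (Node q' (Leaf l2 r2))"]) (auto simp: min_def max_def ac_simps)
    qed
    then obtain k' where k': "proper k'" "lft k' = l1" "rgt k' = r2" "res k' = res k + res q"
      "leaves k' = leaves k + leaves q" "val k + val u - val z \<le> val k'" "q' \<in> subtrees k'"
      "Node (Leaf l1 r1) q' \<in> subtrees k' \<or> Node q' (Leaf l2 r2) \<in> subtrees k'" by metis
    obtain t2 where t2: "proper t2" "val t1 - val k \<le> val t2 - val k'" "res t2 + res k = res t1 + res k'"
      "leaves t2 + leaves k = leaves t1 + leaves k'" "k' \<in> subtrees t2"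
      using replace[OF k1 t1(1) k'(1)] k'(2,3) hk by auto
    have ru: "res u = res q + res z" "leaves u = leaves q + leaves z" using u(2) by auto
    have c2: "complete t2" "leaves t2 = leaves t" "val t \<le> val t2"
      using t2 t1 k' ru rt by (auto simp: complete_def)
    \<comment> \<open>If \<open>q'\<close> is a leaf, it now forms a cherry with the leaf it was
      grafted onto; otherwise any cherry inside \<open>q'\<close> will do. Either way the new gap is
      a proper part of the old one.\<close>
    have "\<exists>k2 a1 b1 a2 b2. k2 \<in> subtrees t2 \<and> b1 < a2 \<and> a2 - b1 < l2 - r1 \<and>
        (k2 = Node (Leaf a1 b1) (Leaf a2 b2) \<or> k2 = Node (Leaf a2 b2) (Leaf a1 b1))"
    proof (cases q')
      case (Leaf e1 e2)
      have "Node (Leaf l1 r1) q' \<in> subtrees t2 \<or> Node q' (Leaf l2 r2) \<in> subtrees t2"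
        using k'(8) subtrees_trans[OF t2(5)] by auto
      then show ?thesis using Leaf inside by (metis diff_strict_left_mono diff_strict_right_mono lft.simps(1) order_le_less_trans order_less_le_trans rgt.simps(1))
    next
      case (Node e1 e2)
      then obtain a1 b1 a2 b2 where ch: "Node (Leaf a1 b1) (Leaf a2 b2) \<in> subtrees q'" using ex_cherry by blast
      from subtrees_bounds[OF this] inside
      have bd: "r1 < a1" "r1 < a2" "b1 < l2" "b2 < l2" by auto
      have ch2: "Node (Leaf a1 b1) (Leaf a2 b2) \<in> subtrees t2"
        using ch subtrees_trans[OF t2(5)] subtrees_trans[OF k'(7)] by blast
      note cherry_order[OF c2(1) ch2]
      then show ?thesis using ch2 bd by (smt (verit))
    qed
    then obtain k2 a1 b1 a2 b2 where "k2 \<in> subtrees t2" "b1 < a2" "a2 - b1 < l2 - r1"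
        "k2 = Node (Leaf a1 b1) (Leaf a2 b2) \<or> k2 = Node (Leaf a2 b2) (Leaf a1 b1)" by blast
    from less.hyps[OF _ c2(1) this(2,1,4)] this(2,3) gap c2(2,3) show ?thesis by fastforce
  qed
qed

text \<open>Contraction ends with a single leaf, and \<open>n\<close> residues in one block make it
  a window of exactly \<open>n\<close> consecutive positions.\<close>

theorem val_le_window:
  assumes "complete t" shows "\<exists>i. val t \<le> F i (i + n - 1)"
  using assms
proof (induction "leaves t" arbitrary: t rule: less_induct)
  case less
  show ?case
  proof (cases t)
    case (Leaf l r)
    have "size (res t) = size (mset_set {0..<n})" using less.prems by (simp add: complete_def)
    then have "nat (r - l + 1) = nat n" using Leaf by simp
    with n_pos have "r = l + n - 1" by auto
    with Leaf show ?thesis by auto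
  next
    case (Node x y)
    then obtain l1 r1 l2 r2 where ch: "Node (Leaf l1 r1) (Leaf l2 r2) \<in> subtrees t" using ex_cherry by blast
    from cherry_order(3)[OF less.prems ch]
    obtain t' where t': "complete t'" "leaves t' < leaves t" "val t \<le> val t'"
      using contract_cherry[OF less.prems _ ch] by blast
    from less.hyps[OF t'(2,1)] t'(3) show ?thesis by (meson order_trans)
  qed
qed

end

section \<open>Spirals in logarithmic coordinates\<close>

text \<open>Reads the angle between a tangent \<open>z * w\<close> and the direction
  \<open>- w\<close> towards the root off the factor \<open>z\<close> alone.\<close>

lemma inner_mult_minus: "(z * w) \<bullet> (- w) = - Re z * (norm w)\<^sup>2" for z w :: complex
  unfolding inner_complex_def cmod_power2 by (simp add: power2_eq_square algebra_simps)

locale spirals =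
  fixes \<alpha> :: real and r :: complex
  assumes alpha: "0 < \<alpha>" "\<alpha> < pi / 2"
begin

text \<open>Recovers a point from its coordinates: \<open>u = (a + b) / 2\<close> and
  \<open>x = (b - a) / 2\<close> give radius \<open>exp (- u)\<close> and angle
  \<open>tan \<alpha> * x\<close>.\<close>

definition pt :: "real \<Rightarrow> real \<Rightarrow> complex" where
  "pt a b = r + exp (Complex (- (a + b) / 2) (tan \<alpha> * (b - a) / 2))"

text \<open>A full turn adds 2 pi to the angle, that is, \<open>period\<close> to \<open>x\<close>;
  so it takes \<open>period\<close> from \<open>a\<close> and adds it to \<open>b\<close>.\<close>

definition period :: real where
  "period = 2 * pi / tan \<alpha>"

text \<open>Equal to 1 / cos \<alpha>: the ratio of arc length to radial progress along a
  spiral.\<close>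

definition stretch :: real where
  "stretch = sqrt (1 + (tan \<alpha>)\<^sup>2)"

lemma tan_pos: "0 < tan \<alpha>"
  using alpha by (intro tan_gt_zero) auto

lemma period_pos: "0 < period"
  using tan_pos by (simp add: period_def)

lemma stretch_pos: "0 < stretch"
  by (auto simp: stretch_def intro: add_pos_nonneg)

lemma dist_pt: "norm (pt a b - r) = exp (- (a + b) / 2)"
  by (simp add: pt_def)

lemma pt_neq_root [simp]: "pt a b \<noteq> r" "r \<noteq> pt a b"
  by (auto simp: pt_def)

lemma pt_eq_iff: "pt a b = pt a' b' \<longleftrightarrow> (\<exists>k::int. a' = a - of_int k * period \<and> b' = b + of_int k * period)"
proof -
  have "pt a b = pt a' b' \<longleftrightarrow> exp (Complex (- (a' + b') / 2) (tan \<alpha> * (b' - a') / 2))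
      = exp (Complex (- (a + b) / 2) (tan \<alpha> * (b - a) / 2))"
    by (auto simp: pt_def)
  also have "\<dots> \<longleftrightarrow> (\<exists>k::int. a' + b' = a + b \<and> tan \<alpha> * (b' - a') / 2 = tan \<alpha> * (b - a) / 2 + 2 * of_int k * pi)"
    unfolding exp_eq by (intro ex_cong1) (auto simp: complex_eq_iff)
  also have "\<dots> \<longleftrightarrow> (\<exists>k::int. a' = a - of_int k * period \<and> b' = b + of_int k * period)"
  proof (intro ex_cong1)
    fix k :: int
    have "tan \<alpha> * period = 2 * pi" using tan_pos by (simp add: period_def)
    then have "tan \<alpha> * (2 * of_int k * period) = 2 * of_int k * (2 * pi)"
      by (metis mult.left_commute)
    then have "tan \<alpha> * (b - a) / 2 + 2 * of_int k * pi = tan \<alpha> * (b - a + 2 * of_int k * period) / 2"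
      unfolding distrib_left add_divide_distrib by (auto simp: mult.commute)
    then have "tan \<alpha> * (b' - a') / 2 = tan \<alpha> * (b - a) / 2 + 2 * of_int k * pi
        \<longleftrightarrow> b' - a' = b - a + 2 * of_int k * period"
      using tan_pos by simp
    then show "a' + b' = a + b \<and> tan \<alpha> * (b' - a') / 2 = tan \<alpha> * (b - a) / 2 + 2 * of_int k * pi
        \<longleftrightarrow> a' = a - of_int k * period \<and> b' = b + of_int k * period"
      by auto
  qed
  finally show ?thesis .
qed

lemma pt_surj:
  assumes "p \<noteq> r" obtains a b where "p = pt a b"
proof -
  define z where "z = Ln (p - r)"
  have "exp z = p - r" using assms by (simp add: z_def)
  moreover have "z = Complex (- (- Re z - Im z / tan \<alpha> + (- Re z + Im z / tan \<alpha>)) / 2)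
     (tan \<alpha> * ((- Re z + Im z / tan \<alpha>) - (- Re z - Im z / tan \<alpha>)) / 2)"
    using tan_pos by (simp add: complex_eq_iff field_simps)
  ultimately have "p = pt (- Re z - Im z / tan \<alpha>) (- Re z + Im z / tan \<alpha>)"
    unfolding pt_def by (metis add_diff_cancel_left' diff_add_cancel add.commute)
  then show ?thesis by (rule that)
qed

lemma spiral_exp:
  "spiral \<alpha> r d p t = r + (p - r) * exp (of_real t * Complex (- 1) (tan (turn_sign d * \<alpha>)))"
proof -
  have "of_real (exp (- t)) * cis (tan (turn_sign d * \<alpha>) * t)
      = exp (Complex (- t) (tan (turn_sign d * \<alpha>) * t))"
    by (simp add: exp_eq_polar)
  moreover have "Complex (- t) (tan (turn_sign d * \<alpha>) * t) = of_real t * Complex (- 1) (tan (turn_sign d * \<alpha>))"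
    by (simp add: complex_eq_iff)
  ultimately show ?thesis by (simp add: spiral_def mult.assoc)
qed

lemma spiral_right: "spiral \<alpha> r Right (pt a b) t = pt a (b + 2 * t)"
  unfolding spiral_exp pt_def
  by (simp add: exp_add [symmetric]) (simp add: complex_eq_iff field_simps Re_exp Im_exp)

lemma spiral_left: "spiral \<alpha> r Left (pt a b) t = pt (a + 2 * t) b"
  unfolding spiral_exp pt_def
  by (simp add: exp_add [symmetric]) (simp add: complex_eq_iff field_simps Re_exp Im_exp)

text \<open>The third hypothesis excludes a meeting one or more turns earlier
  (\<open>k \<ge> 1\<close>); meetings with \<open>k \<le> 0\<close> have a parameter no smaller
  than the one leading to the corner.\<close>

lemma first_meet_pt:
  assumes "a' \<le> a" "b \<le> b'" "(b' - a') - (b - a) < 2 * period"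
  shows "first_meet \<alpha> r (pt a b) (pt a' b') = pt a b'"
proof -
  let ?S = "{t. 0 \<le> t \<and> spiral \<alpha> r Right (pt a b) t \<in> spiral \<alpha> r Left (pt a' b') ` {0..}}"
  have half: "x + 2 * ((y - x) / 2) = y" for x y :: real by (simp add: field_simps)
  have "spiral \<alpha> r Right (pt a b) ((b' - b) / 2) = spiral \<alpha> r Left (pt a' b') ((a - a') / 2)"
    unfolding spiral_right spiral_left half ..
  then have "(b' - b) / 2 \<in> ?S" using assms by auto
  moreover have "(b' - b) / 2 \<le> t" if t: "t \<in> ?S" for t
  proof -
    obtain s where s: "0 \<le> s" "pt a (b + 2 * t) = pt (a' + 2 * s) b'" and "0 \<le> t"
      using t by (auto simp: spiral_right spiral_left)
    then obtain k :: int where k: "a' + 2 * s = a - of_int k * period" "b' = b + 2 * t + of_int k * period"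
      by (auto simp: pt_eq_iff)
    have "k \<le> 0"
    proof (rule ccontr)
      assume "\<not> k \<le> 0"
      then have "1 * period \<le> of_int k * period" using period_pos by (intro mult_right_mono) auto
      with k assms(3) s \<open>0 \<le> t\<close> show False by linarith
    qed
    then have "of_int k * period \<le> 0" using period_pos by (simp add: mult_nonpos_nonneg)
    then have "b' - b \<le> 2 * t" using k(2) by simp
    then show ?thesis by simp
  qed
  ultimately have "Inf ?S = (b' - b) / 2" by (intro cInf_eq_minimum) auto
  then show ?thesis unfolding first_meet_def by (simp only: spiral_right half)
qed

text \<open>The derivative is the radius vector times a constant complex number of modulus
  \<open>stretch\<close>.\<close>

lemma norm_spiral_speed:
  "norm (vector_derivative (spiral \<alpha> r d p) (at t)) = stretch * norm (p - r) * exp (- t)"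
proof -
  let ?z = "Complex (- 1) (tan (turn_sign d * \<alpha>))"
  have "(spiral \<alpha> r d p has_vector_derivative (p - r) * (?z * exp (of_real t * ?z))) (at t)"
  proof -
    have "((\<lambda>z. r + (p - r) * exp (z * ?z)) has_field_derivative (p - r) * (?z * exp (of_real t * ?z))) (at (of_real t))"
      by (auto intro!: derivative_eq_intros)
    from has_vector_derivative_real_field[OF this] show ?thesis
      by (simp add: spiral_exp[abs_def])
  qed
  then have "vector_derivative (spiral \<alpha> r d p) (at t) = (p - r) * (?z * exp (of_real t * ?z))"
    by (rule vector_derivative_at)
  moreover have "norm ?z = stretch"
    by (cases d) (simp_all add: stretch_def cmod_def)
  ultimately show ?thesis by (simp add: norm_mult)
qed

lemma arc_length_spiral:
  assumes "0 \<le> T"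
  shows "arc_length (spiral \<alpha> r d p) {0..T} = stretch * norm (p - r) * (1 - exp (- T))"
proof -
  have "((\<lambda>t. exp (- t)) has_integral (- exp (- T) - (- exp (- 0)))) {0..T}"
    using assms by (intro fundamental_theorem_of_calculus)
      (auto intro!: derivative_eq_intros simp flip: has_real_derivative_iff_has_vector_derivative)
  from has_integral_mult_right[OF this, of "stretch * norm (p - r)"] show ?thesis
    by (simp add: arc_length_def norm_spiral_speed integral_unique del: integral_mult_right)
qed

lemma arc_length_spiral_limit: "arc_length (spiral \<alpha> r d p) {0..} = stretch * norm (p - r)"
proof -
  have "((\<lambda>t. exp (- t)) has_integral (1 :: real)) {0..}"
    using has_integral_exp_minus_to_infinity[of 1 0] by simp
  from has_integral_mult_right[OF this, of "stretch * norm (p - r)"] show ?thesis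
    by (simp add: arc_length_def norm_spiral_speed integral_unique del: integral_mult_right)
qed

lemma norm_spiral: "norm (spiral \<alpha> r d p t - r) = norm (p - r) * exp (- t)"
  by (simp add: spiral_exp norm_mult)

lemma seg_length_eq:
  "seg_valid r p s \<Longrightarrow> seg_length \<alpha> r p s = stretch * (norm (p - r) - norm (seg_end \<alpha> r p s - r))"
  by (cases "(\<alpha>, r, p, s)" rule: seg_length.cases)
    (auto simp: arc_length_spiral arc_length_spiral_limit norm_spiral algebra_simps)

lemma seg_end_closer:
  "seg_valid r p s \<Longrightarrow> norm (seg_end \<alpha> r p s - r) < norm (p - r)"
  by (cases "(\<alpha>, r, p, s)" rule: seg_length.cases) (auto simp: norm_spiral)

lemma seg_end_cone:
  assumes "seg_valid r (pt a b) s" "seg_end \<alpha> r (pt a b) s \<noteq> r"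
  shows "\<exists>a'\<ge>a. \<exists>b'\<ge>b. seg_end \<alpha> r (pt a b) s = pt a' b'"
proof -
  obtain d T where s: "s = (d, Some T)" "T > 0" using assms by (cases s; cases "snd s") auto
  show ?thesis
  proof (cases d)
    case Right
    then show ?thesis using s by (intro exI[of _ a] conjI exI[of _ "b + 2 * T"]) (auto simp: spiral_right)
  next
    case Left
    then show ?thesis using s by (intro exI[of _ "a + 2 * T"] conjI exI[of _ b]) (auto simp: spiral_left)
  qed
qed

lemma path_length_eq:
  "path_valid \<alpha> r p ss \<Longrightarrow>
    path_length \<alpha> r p ss = stretch * (norm (p - r) - norm (last (p # path_points \<alpha> r p ss) - r))"
proof (induction ss arbitrary: p)
  case (Cons s ss)
  from Cons.IH[of "seg_end \<alpha> r p s"] Cons.prems show ?case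
    by (simp add: seg_length_eq algebra_simps)
qed simp

lemma path_end_le:
  "path_valid \<alpha> r p ss \<Longrightarrow> norm (last (p # path_points \<alpha> r p ss) - r) \<le> norm (p - r)"
proof (induction ss arbitrary: p)
  case (Cons s ss)
  from Cons.IH[of "seg_end \<alpha> r p s"] Cons.prems seg_end_closer[of p s] show ?case by simp
qed simp

lemma path_end_closer:
  assumes "path_valid \<alpha> r p ss" "ss \<noteq> []"
  shows "norm (last (path_points \<alpha> r p ss) - r) < norm (p - r)"
proof -
  obtain s ss' where ss: "ss = s # ss'" using assms(2) by (cases ss) auto
  from path_end_le[of "seg_end \<alpha> r p s" ss'] seg_end_closer[of p s] assms(1) show ?thesis by (simp add: ss)
qed

lemma path_end_cone:
  assumes "path_valid \<alpha> r (pt a b) ss" "last (pt a b # path_points \<alpha> r (pt a b) ss) \<noteq> r"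
  shows "\<exists>a'\<ge>a. \<exists>b'\<ge>b. last (pt a b # path_points \<alpha> r (pt a b) ss) = pt a' b'"
  using assms
proof (induction ss arbitrary: a b)
  case (Cons s ss)
  let ?e = "seg_end \<alpha> r (pt a b) s"
  \<comment> \<open>No segment starts in \<open>r\<close>, so a path that has reached
    \<open>r\<close> ends there, against the assumption on its end point.\<close>
  have "?e \<noteq> r"
  proof
    assume "?e = r"
    with Cons.prems show False by (cases ss; cases "hd ss"; cases "snd (hd ss)") auto
  qed
  with seg_end_cone[of a b s] Cons.prems obtain a1 b1 where e: "a \<le> a1" "b \<le> b1" "?e = pt a1 b1" by auto
  with Cons.IH[of a1 b1] Cons.prems obtain a2 b2 where "a1 \<le> a2" "b1 \<le> b2"
      "last (pt a1 b1 # path_points \<alpha> r (pt a1 b1) ss) = pt a2 b2" by auto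
  with e show ?case by (intro exI[of _ a2] conjI exI[of _ b2]) auto
qed auto

text \<open>The straight segment to the root makes angle 0 with the direction to the root. For
  terminals outside each other's regions, a terminal at the root is therefore the only one.\<close>

lemma root_in_region: "r \<in> spiral_region \<alpha> r p"
proof (cases "p = r")
  case True
  \<comment> \<open>The trivial path has no nonzero derivative, so its single parameter 0 is
    declared a corner.\<close>
  have "angle_restricted \<alpha> r 0 (\<lambda>_. p)" by (auto simp: angle_restricted_def intro!: exI[of _ "{0}"])
  with True show ?thesis by (auto simp: spiral_region_def)
next
  case False
  define \<gamma> where "\<gamma> t = p + of_real t * (r - p)" for t :: real
  have d: "(\<gamma> has_vector_derivative (r - p)) (at t within {0..1})" for t
    unfolding \<gamma>_def by (auto intro!: derivative_eq_intros)
  have "vec_angle (r - p) (r - \<gamma> t) \<le> \<alpha>" if "t \<in> {0..1}" "\<gamma> t \<noteq> r" for t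
  proof -
    have eq: "r - \<gamma> t = (1 - t) *\<^sub>R (r - p)" by (simp add: \<gamma>_def scaleR_conv_of_real algebra_simps)
    with that have "t < 1" by (cases "t = 1") (auto simp: \<gamma>_def)
    have "(r - p) \<bullet> ((1 - t) *\<^sub>R (r - p)) = (1 - t) * (norm (r - p))\<^sup>2"
      by (simp add: dot_square_norm)
    moreover have "norm ((1 - t) *\<^sub>R (r - p)) = (1 - t) * norm (r - p)"
      using \<open>t < 1\<close> by simp
    ultimately have "vec_angle (r - p) (r - \<gamma> t) = arccos 1"
      unfolding vec_angle_def eq using \<open>t < 1\<close> False by (simp add: power2_eq_square)
    with alpha show ?thesis by simp
  qed
  then have "angle_restricted \<alpha> r 1 \<gamma>"
    unfolding angle_restricted_def using d False
    by (auto intro!: exI[of _ "{}"] exI[of _ "r - p"] continuous_on_vector_derivative[of _ _ "\<lambda>_. r - p"])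
  then show ?thesis by (auto simp: spiral_region_def \<gamma>_def intro!: exI[of _ 1] exI[of _ \<gamma>])
qed

text \<open>The path is the straight segment in \<open>(a, b)\<close> coordinates. Its tangent is
  the constant \<open>z\<close> times the radius vector, and |x| is at most u because neither
  coordinate decreases; so |z| is at most u / cos \<alpha>, and the angle to the root is at most
  \<alpha>. This turns the hypothesis on the terminals into incomparability of their lifts.\<close>

lemma cone_in_region:
  assumes "a \<le> a'" "b \<le> b'" shows "pt a' b' \<in> spiral_region \<alpha> r (pt a b)"
proof (cases "a = a' \<and> b = b'")
  case True
  have "angle_restricted \<alpha> r 0 (\<lambda>_. pt a b)" by (auto simp: angle_restricted_def intro!: exI[of _ "{0}"])
  with True show ?thesis by (auto simp: spiral_region_def)
next
  case False
  define u where "u = ((a' - a) + (b' - b)) / 2"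
  define x where "x = ((b' - b) - (a' - a)) / 2"
  define z where "z = Complex (- u) (tan \<alpha> * x)"
  define \<gamma> where "\<gamma> t = pt (a + t * (a' - a)) (b + t * (b' - b))" for t
  have u: "0 < u" "\<bar>x\<bar> \<le> u" using assms False by (auto simp: u_def x_def)
  have z0: "z \<noteq> 0" using u by (auto simp: z_def complex_eq_iff)
  have \<gamma>: "\<gamma> t = r + exp (Complex (- (a + b) / 2) (tan \<alpha> * (b - a) / 2) + of_real t * z)" for t
    unfolding \<gamma>_def pt_def by (intro arg_cong[where f = "\<lambda>z. r + exp z"])
      (simp add: z_def u_def x_def complex_eq_iff field_simps)
  have d: "(\<gamma> has_vector_derivative (z * (\<gamma> t - r))) (at t within {0..1})" for t
  proof -
    let ?w = "Complex (- (a + b) / 2) (tan \<alpha> * (b - a) / 2)"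
    have "((\<lambda>s. r + exp (?w + s * z)) has_field_derivative z * (\<gamma> t - r)) (at (of_real t))"
      unfolding \<gamma> by (auto intro!: derivative_eq_intros)
    from has_vector_derivative_real_field[OF this] show ?thesis by (simp add: \<gamma>[abs_def])
  qed
  have "vec_angle (z * (\<gamma> t - r)) (r - \<gamma> t) \<le> \<alpha>" for t
  proof -
    let ?e = "\<gamma> t - r"
    have e: "?e \<noteq> 0" by (simp add: \<gamma>)
    have "(z * ?e) \<bullet> (r - \<gamma> t) = u * (norm ?e)\<^sup>2"
      using inner_mult_minus[of z ?e] unfolding minus_diff_eq z_def complex.sel minus_minus .
    moreover have "norm (z * ?e) * norm (r - \<gamma> t) = norm z * (norm ?e)\<^sup>2"
      by (simp add: norm_mult norm_minus_commute power2_eq_square)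
    ultimately have va: "vec_angle (z * ?e) (r - \<gamma> t) = arccos (u / norm z)"
      unfolding vec_angle_def using e by simp
    have "(norm z)\<^sup>2 = u\<^sup>2 + (tan \<alpha>)\<^sup>2 * x\<^sup>2" by (simp add: z_def cmod_power2 power_mult_distrib)
    also have "\<dots> \<le> u\<^sup>2 + (tan \<alpha>)\<^sup>2 * u\<^sup>2"
      using power_mono[OF u(2), of 2] by (intro add_left_mono mult_left_mono) auto
    also have "\<dots> = (u * stretch)\<^sup>2" by (simp add: stretch_def power_mult_distrib algebra_simps)
    finally have "norm z \<le> u * stretch"
      using u(1) stretch_pos power2_le_imp_le mult_nonneg_nonneg less_imp_le by metis
    have c0: "0 < cos \<alpha>" using alpha by (intro cos_gt_zero) auto
    have "stretch\<^sup>2 * (cos \<alpha>)\<^sup>2 = (cos \<alpha>)\<^sup>2 + (tan \<alpha> * cos \<alpha>)\<^sup>2"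
      by (simp add: stretch_def power_mult_distrib distrib_right)
    also have "\<dots> = 1" using c0 by (simp add: tan_def)
    finally have "stretch\<^sup>2 * (cos \<alpha>)\<^sup>2 = 1" .
    then have "stretch * cos \<alpha> = 1"
      using c0 stretch_pos by (intro power2_eq_imp_eq[of _ 1]) (simp_all add: power_mult_distrib)
    have "norm z * cos \<alpha> \<le> u * stretch * cos \<alpha>"
      using \<open>norm z \<le> _\<close> less_imp_le[OF c0] by (rule mult_right_mono)
    also have "\<dots> = u" using \<open>stretch * cos \<alpha> = 1\<close> by (simp add: mult.assoc)
    finally have "cos \<alpha> \<le> u / norm z" using z0 by (simp add: pos_le_divide_eq mult.commute)
    moreover have "Re z = - u" by (simp add: z_def)
    then have "u \<le> norm z" using abs_Re_le_cmod[of z] by linarith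
    then have "u / norm z \<le> 1" using z0 by (simp add: divide_le_eq_1_pos)
    moreover have "- 1 \<le> cos \<alpha>" by (rule cos_ge_minus_one)
    ultimately have "arccos (u / norm z) \<le> arccos (cos \<alpha>)"
      by (intro arccos_le_arccos)
    with va alpha show ?thesis by (simp add: arccos_cos)
  qed
  moreover have "z * (\<gamma> t - r) \<noteq> 0" for t using z0 by (simp add: \<gamma>)
  ultimately have "\<exists>D. (\<gamma> has_vector_derivative D) (at t within {0..1}) \<and> D \<noteq> 0 \<and> vec_angle D (r - \<gamma> t) \<le> \<alpha>" for t
    using d[of t] by (intro exI[of _ "z * (\<gamma> t - r)"] conjI)
  then have all: "\<forall>t\<in>{0..1} - {}. \<gamma> t \<noteq> r \<longrightarrow> (\<exists>D. (\<gamma> has_vector_derivative D) (at t within {0..1}) \<and> D \<noteq> 0 \<and> vec_angle D (r - \<gamma> t) \<le> \<alpha>)"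
    by simp
  have "continuous_on {0..1} \<gamma>"
    by (rule continuous_on_vector_derivative[OF d])
  with all have "angle_restricted \<alpha> r 1 \<gamma>"
    unfolding angle_restricted_def by (intro conjI exI[of _ "{}"] finite.emptyI)
  moreover have "\<gamma> 0 = pt a b" "\<gamma> 1 = pt a' b'" by (simp_all add: \<gamma>_def)
  ultimately show ?thesis
    unfolding spiral_region_def by (intro CollectI exI[of _ "1 :: real"] exI[of _ \<gamma>] conjI zero_le_one)
qed

end

section \<open>The lower bound\<close>

locale spiral_terminals = spirals +
  fixes n :: int and a b :: "int \<Rightarrow> real"
  assumes n_pos: "0 < n"
    and a_less: "k < l \<Longrightarrow> a l < a k"
    and b_less: "k < l \<Longrightarrow> b k < b l"
    and a_shift1: "a (k + n) = a k - period"
    and b_shift1: "b (k + n) = b k + period"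
begin

definition saving :: "int \<Rightarrow> int \<Rightarrow> real" where
  "saving l m = stretch * exp (- (a l + b m) / 2)"

abbreviation node :: "int \<Rightarrow> complex" where
  "node k \<equiv> pt (a k) (b k)"

lemma a_mono: "k \<le> l \<Longrightarrow> a l \<le> a k"
  using a_less[of k l] by (cases "k = l") auto

lemma b_mono: "k \<le> l \<Longrightarrow> b k \<le> b l"
  using b_less[of k l] by (cases "k = l") auto

sublocale cyclic_savings n saving
proof
  show "0 < n" by (rule n_pos)
  show "0 \<le> saving l m" for l m using stretch_pos by (simp add: saving_def)
  show "saving l' m' \<le> saving l m" if "l' \<le> l" "m \<le> m'" for l l' m m'
    using a_mono[OF that(1)] b_mono[OF that(2)] stretch_pos by (simp add: saving_def)
  show "saving (l + n) (m + n) = saving l m" for l m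
    by (simp add: saving_def a_shift1 b_shift1)
qed

lemma ab_shift:
  "a (k + j * n) = a k - of_int j * period" "b (k + j * n) = b k + of_int j * period"
proof -
  have up: "a (k + int i * n) = a k - of_int (int i) * period \<and> b (k + int i * n) = b k + of_int (int i) * period" for i k
  proof (induction i)
    case (Suc i)
    have "k + int (Suc i) * n = (k + int i * n) + n" by (simp add: algebra_simps)
    then have "a (k + int (Suc i) * n) = a (k + int i * n) - period"
      "b (k + int (Suc i) * n) = b (k + int i * n) + period"
      by (simp_all only: a_shift1 b_shift1)
    with Suc show ?case by (simp add: algebra_simps)
  qed simp
  have "a (k + j * n) = a k - of_int j * period \<and> b (k + j * n) = b k + of_int j * period"
  proof (cases "0 \<le> j")
    case True
    with up[of k "nat j"] show ?thesis by simp
  next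
    case False
    with up[of "k + j * n" "nat (- j)"] show ?thesis by (simp add: algebra_simps)
  qed
  then show "a (k + j * n) = a k - of_int j * period" "b (k + j * n) = b k + of_int j * period" by auto
qed

lemma a_inj: "a k = a l \<Longrightarrow> k = l"
  using a_less[of k l] a_less[of l k] by linarith

lemma b_inj: "b k = b l \<Longrightarrow> k = l"
  using b_less[of k l] b_less[of l k] by linarith

text \<open>\<open>pt\<close> determines coordinates only up to turns; strict monotonicity carries
  one and the same number of turns over to both indices.\<close>

lemma corner_eqD:
  assumes "pt (a l) (b m) = pt (a l') (b m')"
  shows "\<exists>j. l' = l + j * n \<and> m' = m + j * n"
proof -
  obtain j :: int where "a l' = a l - of_int j * period" "b m' = b m + of_int j * period"
    using assms by (auto simp: pt_eq_iff)
  then have "a l' = a (l + j * n)" "b m' = b (m + j * n)" by (simp_all add: ab_shift)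
  then show ?thesis using a_inj b_inj by blast
qed

lemma inj_node: "inj_on node {i..<i + n}"
proof (rule inj_onI)
  fix k l assume kl: "k \<in> {i..<i + n}" "l \<in> {i..<i + n}" "node k = node l"
  then obtain j where j: "l = k + j * n" using corner_eqD by blast
  then have "(l - i) mod n = (k - i) mod n" by (metis add.commute diff_add_eq mod_mult_self1)
  with kl show "k = l" by simp
qed

lemma node_image: "node ` {i..<i + n} = range node"
proof (intro equalityI subsetI; clarify)
  fix k
  have "i + (k - i) mod n = k + (- ((k - i) div n)) * n"
    using div_mult_mod_eq[of "k - i" n] by linarith
  then have "node (i + (k - i) mod n) = node (k + (- ((k - i) div n)) * n)" by (simp only:)
  also have "\<dots> = node k" unfolding pt_eq_iff ab_shift by (intro exI[of _ "(k - i) div n"]) simp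
  finally show "node k \<in> node ` {i..<i + n}" using n_pos by (intro image_eqI[of _ _ "i + (k - i) mod n"]) auto
qed auto

lemma first_meet_node:
  assumes "l \<le> m" "m < l + n"
  shows "first_meet \<alpha> r (node l) (node m) = pt (a l) (b m)"
proof (rule first_meet_pt)
  show "a m \<le> a l" "b l \<le> b m" using a_mono b_mono assms by auto
  have "a (l + n) < a m" "b m < b (l + n)" using a_less b_less assms by auto
  then show "b m - a m - (b l - a l) < 2 * period" by (simp add: a_shift1 b_shift1)
qed

text \<open>\<open>sits t p\<close>: after a choice of lift, \<open>p\<close> is reachable from all terminals of \<open>t\<close>, hence lies no
  farther out than the meeting point of the two extreme ones.\<close>

definition sits :: "ltree \<Rightarrow> complex \<Rightarrow> bool" where
  "sits t p \<longleftrightarrow> proper t \<and> (p \<noteq> r \<longrightarrow> (\<exists>A\<ge>a (lft t). \<exists>B\<ge>b (rgt t). p = pt A B))"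

text \<open>A potential: the savings collected so far plus the length of a spiral path that carries
  the token from \<open>p\<close> to the root. A node may hold no token.\<close>

definition token_value :: "ltree option \<Rightarrow> complex \<Rightarrow> real" where
  "token_value x p = (case x of None \<Rightarrow> 0 | Some t \<Rightarrow> val t + stretch * norm (p - r))"

definition token_res :: "ltree option \<Rightarrow> int multiset" where
  "token_res x = (case x of None \<Rightarrow> {#} | Some t \<Rightarrow> res t)"

text \<open>Along an arc the potential drops by the length of the arc. If two tokens meet in
  \<open>w\<close>, its distance, so far counted for both, is counted once; the loss is covered by
  the \<open>saving\<close> of the new merge, as \<open>w\<close> is reachable from the extreme
  terminals of both.\<close>

lemma push_token:
  assumes t: "sits t v" and "v \<noteq> r"
    and cone: "\<And>A B. v = pt A B \<Longrightarrow> w \<noteq> r \<Longrightarrow> \<exists>A'\<ge>A. \<exists>B'\<ge>B. w = pt A' B'"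
    and x: "\<And>t'. x = Some t' \<Longrightarrow> sits t' w"
  shows "\<exists>t1. sits t1 w \<and> res t1 = res t + token_res x \<and> val t + token_value x w \<le> val t1"
proof (cases "w = r")
  case True
  show ?thesis
  proof (cases x)
    case None
    with True t show ?thesis by (intro exI[of _ t]) (auto simp: sits_def token_res_def token_value_def)
  next
    case (Some t')
    with True t x[OF Some] show ?thesis
      by (intro exI[of _ "Node t t'"]) (auto simp: sits_def token_res_def token_value_def G_nonneg)
  qed
next
  case False
  obtain A B where AB: "a (lft t) \<le> A" "b (rgt t) \<le> B" "v = pt A B"
    using t \<open>v \<noteq> r\<close> by (auto simp: sits_def)
  obtain A' B' where w: "A \<le> A'" "B \<le> B'" "w = pt A' B'" using cone[OF AB(3) False] by blast
  show ?thesis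
  proof (cases x)
    case None
    have "a (lft t) \<le> A'" "b (rgt t) \<le> B'" using w AB by auto
    with w t None show ?thesis
      by (intro exI[of _ t]) (auto simp: sits_def token_res_def token_value_def)
  next
    case (Some t')
    obtain C D where CD: "a (lft t') \<le> C" "b (rgt t') \<le> D" "w = pt C D"
      using x[OF Some] False by (auto simp: sits_def)
    \<comment> \<open>Both tokens describe \<open>w\<close>, but in lifts that may differ by
      \<open>j\<close> turns; shifting one tree by \<open>j * n\<close> makes the lifts
      agree.\<close>
    then obtain j :: int where j: "C = A' - of_int j * period" "D = B' + of_int j * period"
      using w pt_eq_iff by metis
    let ?t = "Node (shift (j * n) t) t'"
    have "a (lft t + j * n) \<le> C" "b (rgt t + j * n) \<le> D" using AB w j by (auto simp: ab_shift)
    with CD have le: "a (lft ?t) \<le> C" "b (rgt ?t) \<le> D" by (auto simp: min_def max_def)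
    then have "norm (w - r) \<le> exp (- (a (lft ?t) + b (rgt ?t)) / 2)"
      unfolding CD(3) dist_pt by simp
    then have "stretch * norm (w - r) \<le> saving (lft ?t) (rgt ?t)"
      using stretch_pos by (simp add: saving_def)
    with le CD t x[OF Some] Some show ?thesis
      by (intro exI[of _ ?t]) (auto simp: sits_def token_res_def token_value_def val_shift res_shift)
  qed
qed

text \<open>A token is the tree of all merges made so far. Tokens are pushed to the root, from the outermost node inwards.\<close>

lemma push_tokens:
  assumes "finite V" "r \<notin> V"
    and "\<And>v. v \<in> V \<Longrightarrow> par v \<in> insert r V"
    and "\<And>v. v \<in> V \<Longrightarrow> norm (par v - r) < norm (v - r)"
    and "\<And>v A B. v \<in> V \<Longrightarrow> v = pt A B \<Longrightarrow> par v \<noteq> r \<Longrightarrow> \<exists>A'\<ge>A. \<exists>B'\<ge>B. par v = pt A' B'"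
    and "\<And>v t. v \<in> insert r V \<Longrightarrow> g v = Some t \<Longrightarrow> sits t v"
    and "\<exists>v\<in>insert r V. g v \<noteq> None"
  shows "\<exists>t. proper t \<and> res t = (\<Sum>v\<in>insert r V. token_res (g v)) \<and>
     (\<Sum>v\<in>insert r V. token_value (g v) v) - (\<Sum>v\<in>V. stretch * (norm (v - r) - norm (par v - r))) \<le> val t"
  using assms
proof (induction "card V" arbitrary: V g)
  case 0
  then obtain t where "V = {}" "g r = Some t" by auto
  with "0.prems"(6) show ?case by (intro exI[of _ t]) (auto simp: token_res_def token_value_def sits_def)
next
  case (Suc m)
  have "V \<noteq> {}" using Suc.hyps(2) by auto
  \<comment> \<open>The outermost node is the parent of no node, as arcs lead inwards; once its
    token has moved on, it can be removed.\<close>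
  have "Max ((\<lambda>v. norm (v - r)) ` V) \<in> (\<lambda>v. norm (v - r)) ` V" using Suc.prems(1) \<open>V \<noteq> {}\<close> by (intro Max_in) auto
  then obtain v where "v \<in> V" and v: "norm (v - r) = Max ((\<lambda>v. norm (v - r)) ` V)" by auto
  have vmax: "norm (u - r) \<le> norm (v - r)" if "u \<in> V" for u
    unfolding v using that Suc.prems(1) by auto
  let ?V = "V - {v}" and ?w = "par v"
  have w: "?w \<in> insert r ?V" using Suc.prems(3,4)[OF \<open>v \<in> V\<close>] by auto
  have vr: "v \<noteq> r" using \<open>v \<in> V\<close> Suc.prems(2) by auto
  have closed: "par u \<in> insert r ?V" if "u \<in> ?V" for u
    using Suc.prems(3,4)[of u] vmax[of u] that by force
  have IH: "\<exists>t. proper t \<and> res t = (\<Sum>v\<in>insert r ?V. token_res (h v)) \<and>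
     (\<Sum>v\<in>insert r ?V. token_value (h v) v) - (\<Sum>v\<in>?V. stretch * (norm (v - r) - norm (par v - r))) \<le> val t"
    if "\<And>u t. u \<in> insert r ?V \<Longrightarrow> h u = Some t \<Longrightarrow> sits t u" "\<exists>u\<in>insert r ?V. h u \<noteq> None" for h
    by (rule Suc.hyps(1)) (use Suc.hyps(2) Suc.prems(1,2,4,5) \<open>v \<in> V\<close> closed that in auto)
  have sumV: "(\<Sum>v\<in>V. stretch * (norm (v - r) - norm (par v - r)))
      = stretch * (norm (v - r) - norm (?w - r)) + (\<Sum>v\<in>?V. stretch * (norm (v - r) - norm (par v - r)))"
    using Suc.prems(1) \<open>v \<in> V\<close> by (simp add: sum.remove)
  have ins: "insert r V = insert v (insert r ?V)" using \<open>v \<in> V\<close> by auto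
  have nin: "v \<notin> insert r ?V" "finite (insert r ?V)" using vr Suc.prems(1) by auto
  show ?case
  proof (cases "g v")
    case None
    have "\<exists>u\<in>insert r ?V. g u \<noteq> None" using Suc.prems(7) None by auto
    from IH[OF Suc.prems(6) this] obtain t where t: "proper t" "res t = (\<Sum>v\<in>insert r ?V. token_res (g v))"
      "(\<Sum>v\<in>insert r ?V. token_value (g v) v) - (\<Sum>v\<in>?V. stretch * (norm (v - r) - norm (par v - r))) \<le> val t"
      by auto
    \<comment> \<open>An arc that carries no token only adds length, so it may be dropped.\<close>
    have "0 \<le> stretch * (norm (v - r) - norm (?w - r))"
      using stretch_pos Suc.prems(4)[OF \<open>v \<in> V\<close>] by simp
    with t show ?thesis unfolding ins sumV sum.insert[OF nin(2,1)] None
      by (intro exI[of _ t]) (auto simp: token_value_def token_res_def)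
  next
    case (Some t)
    have "sits t v" using Suc.prems(6)[of v t] \<open>v \<in> V\<close> Some by auto
    then obtain t1 where t1: "sits t1 ?w" "res t1 = res t + token_res (g ?w)"
        "val t + token_value (g ?w) ?w \<le> val t1"
      using push_token[of t v ?w "g ?w"] vr Suc.prems(5)[OF \<open>v \<in> V\<close>] Suc.prems(6)[of ?w] w by auto
    define h where "h = g(?w := Some t1)"
    have split: "(\<Sum>v\<in>insert r ?V. k v) = k ?w + (\<Sum>v\<in>insert r ?V - {?w}. k v)" for k :: "complex \<Rightarrow> 'b::comm_monoid_add"
      using w nin(2) by (rule sum.remove[rotated])
    have "sits t' u" if "u \<in> insert r ?V" "h u = Some t'" for u t'
      using that Suc.prems(6)[of u t'] t1(1) by (auto simp: h_def split: if_splits)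
    moreover have "\<exists>u\<in>insert r ?V. h u \<noteq> None" using w by (intro bexI[of _ ?w]) (auto simp: h_def)
    ultimately obtain t' where t': "proper t'" "res t' = (\<Sum>v\<in>insert r ?V. token_res (h v))"
      "(\<Sum>v\<in>insert r ?V. token_value (h v) v) - (\<Sum>v\<in>?V. stretch * (norm (v - r) - norm (par v - r))) \<le> val t'"
      using IH[of h] by auto
    have rest: "(\<Sum>v\<in>insert r ?V - {?w}. token_res (h v)) = (\<Sum>v\<in>insert r ?V - {?w}. token_res (g v))"
      "(\<Sum>v\<in>insert r ?V - {?w}. token_value (h v) v) = (\<Sum>v\<in>insert r ?V - {?w}. token_value (g v) v)"
      by (rule sum.cong; simp add: h_def)+
    have "res t' = (\<Sum>v\<in>insert r V. token_res (g v))"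
      unfolding t'(2) ins sum.insert[OF nin(2,1)] split rest Some
      using t1(2) by (simp add: h_def token_res_def)
    moreover have "(\<Sum>v\<in>insert r V. token_value (g v) v) - (\<Sum>v\<in>V. stretch * (norm (v - r) - norm (par v - r))) \<le> val t'"
      using t'(3) t1(3) unfolding ins sum.insert[OF nin(2,1)] split rest Some sumV
      by (simp add: h_def token_value_def algebra_simps)
    ultimately show ?thesis using t'(1) by blast
  qed
qed

text \<open>Every terminal starts with a token \<open>Leaf k k\<close>, so the initial potential is
  the sum of the distances. The token that arrives at the root has merged all terminals, each
  counted once, and \<open>val_le_window\<close> bounds its value.\<close>

theorem tree_length_lower_bound:
  assumes T: "spiral_tree \<alpha> r (node ` {0..<n}) T"
  shows "\<exists>i. (\<Sum>k\<in>{0..<n}. stretch * norm (node k - r)) - F i (i + n - 1) \<le> tree_length \<alpha> r T"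
proof -
  let ?V = "nodes T - {r}"
  define g where "g v = (if v \<in> node ` {0..<n} then Some (let k = inv_into {0..<n} node v in Leaf k k) else None)" for v
  have g_node: "g (node k) = Some (Leaf k k)" if "k \<in> {0..<n}" for k
    using that inv_into_f_f[OF inj_node[of 0]] by (simp add: g_def Let_def)
  have V: "finite ?V" "insert r ?V = nodes T" "node ` {0..<n} \<subseteq> nodes T" using T by (auto simp: spiral_tree_def)
  have arc: "parent T v \<in> nodes T" "out_arc T v \<noteq> []" "path_valid \<alpha> r v (out_arc T v)"
      "last (path_points \<alpha> r v (out_arc T v)) = parent T v" if "v \<in> ?V" for v
    using T that by (auto simp: spiral_tree_def)
  have last: "last (v # path_points \<alpha> r v (out_arc T v)) = parent T v" if "v \<in> ?V" for v
    using arc[OF that] by (cases "out_arc T v") auto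
  have len: "tree_length \<alpha> r T = (\<Sum>v\<in>?V. stretch * (norm (v - r) - norm (parent T v - r)))"
    unfolding tree_length_def using arc(3) last by (intro sum.cong) (auto simp: path_length_eq)
  have "\<exists>t. proper t \<and> res t = (\<Sum>v\<in>insert r ?V. token_res (g v)) \<and>
     (\<Sum>v\<in>insert r ?V. token_value (g v) v) - (\<Sum>v\<in>?V. stretch * (norm (v - r) - norm (parent T v - r))) \<le> val t"
  proof (rule push_tokens)
    show "norm (parent T v - r) < norm (v - r)" if "v \<in> ?V" for v
      using path_end_closer arc[OF that] by metis
    show "\<exists>A'\<ge>A. \<exists>B'\<ge>B. parent T v = pt A' B'" if "v \<in> ?V" "v = pt A B" "parent T v \<noteq> r" for v A B
      using path_end_cone[of A B "out_arc T v"] arc(3)[OF that(1)] last[OF that(1)] that(2,3) by simp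
    show "sits t v" if "v \<in> insert r ?V" "g v = Some t" for v t
    proof -
      have "v \<in> node ` {0..<n}" using that(2) by (auto simp: g_def split: if_splits)
      then obtain k where "k \<in> {0..<n}" "v = node k" by blast
      with that(2) g_node show ?thesis unfolding sits_def by (auto, metis order_refl)
    qed
    show "\<exists>v\<in>insert r ?V. g v \<noteq> None"
      using g_node[of 0] V(2,3) n_pos by (intro bexI[of _ "node 0"]) auto
  qed (use V arc(1) in auto)
  then obtain t where t: "proper t" "res t = (\<Sum>v\<in>nodes T. token_res (g v))"
     "(\<Sum>v\<in>nodes T. token_value (g v) v) - tree_length \<alpha> r T \<le> val t"
    unfolding len V(2) by blast
  have sums: "(\<Sum>v\<in>nodes T. f (g v) v) = (\<Sum>k\<in>{0..<n}. f (Some (Leaf k k)) (node k))"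
    if "\<And>v. f None v = 0" for f :: "ltree option \<Rightarrow> complex \<Rightarrow> 'c::comm_monoid_add"
  proof -
    have "(\<Sum>v\<in>nodes T. f (g v) v) = (\<Sum>v\<in>node ` {0..<n}. f (g v) v)"
      using V that T by (intro sum.mono_neutral_right) (auto simp: g_def spiral_tree_def)
    also have "\<dots> = (\<Sum>k\<in>{0..<n}. f (g (node k)) (node k))"
      using inj_node[of 0] by (simp add: sum.reindex)
    finally show ?thesis using g_node by simp
  qed
  have "res t = (\<Sum>k\<in>{0..<n}. {#k#})"
    unfolding t(2) using sums[of "\<lambda>x v. token_res x"] by (simp add: token_res_def)
  then have "complete t" using t(1) by (simp add: complete_def)
  then obtain i where "val t \<le> F i (i + n - 1)" using val_le_window by blast
  moreover have "(\<Sum>v\<in>nodes T. token_value (g v) v) = (\<Sum>k\<in>{0..<n}. stretch * norm (node k - r))"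
    using sums[of token_value] by (simp add: token_value_def)
  ultimately show ?thesis using t(3) by (intro exI[of _ i]) simp
qed

end

section \<open>Splitting intervals\<close>

lemma sum_pop: "k < (c::nat) \<Longrightarrow> sum f {k..<c} = f k + sum f {Suc k..<c}"
  by (simp add: sum.atLeast_Suc_lessThan)

context spiral_terminals
begin

definition interval_point :: "(nat \<Rightarrow> nat) \<Rightarrow> (nat \<Rightarrow> nat) \<Rightarrow> nat \<Rightarrow> complex" where
  "interval_point lo hi j = (if j = 0 then r else pt (a (int (lo j))) (b (int (hi j))))"

text \<open>The length still to be drawn outside the meeting point of \<open>l..h\<close>: the
  scaled distances of its terminals, minus that of the meeting point, minus the best savings
  inside.\<close>

definition remaining :: "nat \<Rightarrow> nat \<Rightarrow> real" where
  "remaining l h = (\<Sum>x\<in>{l..h}. stretch * norm (node (int x) - r)) - saving (int l) (int h) - F (int l) (int h)"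

definition splits :: "nat \<Rightarrow> (nat \<Rightarrow> nat \<Rightarrow> nat) \<Rightarrow> bool" where
  "splits i C \<longleftrightarrow> (\<forall>l h. i \<le> l \<longrightarrow> l < h \<longrightarrow> int h < int i + n \<longrightarrow>
     l \<le> C l h \<and> C l h < h \<and>
     F (int l) (int h) = F (int l) (int (C l h)) + F (int (Suc (C l h))) (int h) + saving (int l) (int h))"

text \<open>Entries \<open>1, \<dots>, c - 1\<close> are intervals of terminals, each standing for the meeting point of its ends;
  those from \<open>k\<close> on still have to be split. Entry 0 is the root.\<close>

definition worklist ::
  "nat \<Rightarrow> (nat \<Rightarrow> nat) \<Rightarrow> (nat \<Rightarrow> nat) \<Rightarrow> (nat \<Rightarrow> nat) \<Rightarrow> (nat \<Rightarrow> nat) \<Rightarrow> nat \<Rightarrow> nat \<Rightarrow> bool" where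
  "worklist i lo hi par turn k c \<longleftrightarrow>
     1 \<le> k \<and> k \<le> c \<and> 2 \<le> c \<and> int (c + (\<Sum>j\<in>{k..<c}. 2 * (hi j - lo j))) = 2 * n \<and>
     (\<forall>j\<in>{1..<c}. i \<le> lo j \<and> lo j \<le> hi j \<and> int (hi j) < int i + n) \<and>
     par 1 = 0 \<and> turn 1 = 0 \<and>
     (\<forall>j\<in>{2..<c}. 1 \<le> par j \<and> par j < j \<and>
        (turn j = 0 \<and> lo j = lo (par j) \<and> hi j < hi (par j) \<or>
         turn j = 1 \<and> hi j = hi (par j) \<and> lo (par j) < lo j)) \<and>
     (\<forall>j\<in>{k..<c}. \<forall>j'\<in>{1..<c}. j \<noteq> j' \<longrightarrow> hi j < lo j' \<or> hi j' < lo j \<or>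
        (lo j' \<le> lo j \<and> hi j \<le> hi j' \<and> hi j - lo j < hi j' - lo j')) \<and>
     (\<forall>j\<in>{1..<c}. \<forall>j'\<in>{1..<c}. j \<noteq> j' \<longrightarrow> lo j \<noteq> lo j' \<or> hi j \<noteq> hi j') \<and>
     (\<forall>x. i \<le> x \<longrightarrow> int x < int i + n \<longrightarrow> (\<exists>j\<in>{1..<c}. lo j \<le> x \<and> x \<le> hi j \<and> (k \<le> j \<or> lo j = hi j))) \<and>
     (\<Sum>j\<in>{1..<c}. stretch * (norm (interval_point lo hi j - r) - norm (interval_point lo hi (par j) - r)))
       + (\<Sum>j\<in>{k..<c}. remaining (lo j) (hi j))
     = (\<Sum>x\<in>{i..<i + nat n}. stretch * norm (node (int x) - r)) - F (int i) (int i + n - 1)"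

lemma worklistD:
  assumes "worklist i lo hi par turn k c"
  shows "1 \<le> k"
    "k \<le> c"
    "2 \<le> c"
    "int (c + (\<Sum>j\<in>{k..<c}. 2 * (hi j - lo j))) = 2 * n"
    "\<forall>j\<in>{1..<c}. i \<le> lo j \<and> lo j \<le> hi j \<and> int (hi j) < int i + n"
    "par 1 = 0"
    "turn 1 = 0"
    "\<forall>j\<in>{2..<c}. 1 \<le> par j \<and> par j < j \<and>
        (turn j = 0 \<and> lo j = lo (par j) \<and> hi j < hi (par j) \<or>
         turn j = 1 \<and> hi j = hi (par j) \<and> lo (par j) < lo j)"
    "\<forall>j\<in>{k..<c}. \<forall>j'\<in>{1..<c}. j \<noteq> j' \<longrightarrow> hi j < lo j' \<or> hi j' < lo j \<or>
        (lo j' \<le> lo j \<and> hi j \<le> hi j' \<and> hi j - lo j < hi j' - lo j')"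
    "\<forall>j\<in>{1..<c}. \<forall>j'\<in>{1..<c}. j \<noteq> j' \<longrightarrow> lo j \<noteq> lo j' \<or> hi j \<noteq> hi j'"
    "\<forall>x. i \<le> x \<longrightarrow> int x < int i + n \<longrightarrow> (\<exists>j\<in>{1..<c}. lo j \<le> x \<and> x \<le> hi j \<and> (k \<le> j \<or> lo j = hi j))"
    "(\<Sum>j\<in>{1..<c}. stretch * (norm (interval_point lo hi j - r) - norm (interval_point lo hi (par j) - r)))
       + (\<Sum>j\<in>{k..<c}. remaining (lo j) (hi j))
     = (\<Sum>x\<in>{i..<i + nat n}. stretch * norm (node (int x) - r)) - F (int i) (int i + n - 1)"
  using assms unfolding worklist_def by - (elim conjE, assumption)+

lemma worklistI:
  assumes "1 \<le> k"
    "k \<le> c"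
    "2 \<le> c"
    "int (c + (\<Sum>j\<in>{k..<c}. 2 * (hi j - lo j))) = 2 * n"
    "\<forall>j\<in>{1..<c}. i \<le> lo j \<and> lo j \<le> hi j \<and> int (hi j) < int i + n"
    "par 1 = 0"
    "turn 1 = 0"
    "\<forall>j\<in>{2..<c}. 1 \<le> par j \<and> par j < j \<and>
        (turn j = 0 \<and> lo j = lo (par j) \<and> hi j < hi (par j) \<or>
         turn j = 1 \<and> hi j = hi (par j) \<and> lo (par j) < lo j)"
    "\<forall>j\<in>{k..<c}. \<forall>j'\<in>{1..<c}. j \<noteq> j' \<longrightarrow> hi j < lo j' \<or> hi j' < lo j \<or>
        (lo j' \<le> lo j \<and> hi j \<le> hi j' \<and> hi j - lo j < hi j' - lo j')"
    "\<forall>j\<in>{1..<c}. \<forall>j'\<in>{1..<c}. j \<noteq> j' \<longrightarrow> lo j \<noteq> lo j' \<or> hi j \<noteq> hi j'"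
    "\<forall>x. i \<le> x \<longrightarrow> int x < int i + n \<longrightarrow> (\<exists>j\<in>{1..<c}. lo j \<le> x \<and> x \<le> hi j \<and> (k \<le> j \<or> lo j = hi j))"
    "(\<Sum>j\<in>{1..<c}. stretch * (norm (interval_point lo hi j - r) - norm (interval_point lo hi (par j) - r)))
       + (\<Sum>j\<in>{k..<c}. remaining (lo j) (hi j))
     = (\<Sum>x\<in>{i..<i + nat n}. stretch * norm (node (int x) - r)) - F (int i) (int i + n - 1)"
  shows "worklist i lo hi par turn k c"
  unfolding worklist_def using assms by (intro conjI)

lemma norm_interval_point:
  "0 < j \<Longrightarrow> stretch * norm (interval_point lo hi j - r) = saving (int (lo j)) (int (hi j))"
  by (simp add: interval_point_def dist_pt saving_def)

lemma remaining_refl: "remaining l l = 0"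
  by (simp add: remaining_def dist_pt saving_def)

lemma worklist_init:
  assumes "lo 1 = i" "int (hi 1) = int i + n - 1" "par 1 = 0" "turn 1 = 0"
  shows "worklist i lo hi par turn 1 2"
proof -
  have s: "{1..<2::nat} = {1}" "{2..<2::nat} = {}" by auto
  have w: "{i..<i + nat n} = {i..hi 1}" using assms(2) n_pos by auto
  have "stretch * norm (interval_point lo hi 0 - r) = 0" by (simp add: interval_point_def)
  moreover have "int (2 + 2 * (hi 1 - i)) = 2 * n" "i \<le> hi 1" using assms(2) n_pos by auto
  moreover have "int i + n - 1 = int (hi 1)" using assms(2) by simp
  ultimately show ?thesis
    unfolding worklist_def s w using assms n_pos norm_interval_point[of 1 lo hi]
    by (simp add: remaining_def right_diff_distrib)
qed

text \<open>A single terminal needs no further node and no further length; it stays covered through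
  the alternative \<open>lo j = hi j\<close>.\<close>

lemma worklist_leaf:
  assumes W: "worklist i lo hi par turn k c" and "k < c" "lo k = hi k"
  shows "worklist i lo hi par turn (Suc k) c"
proof (rule worklistI)
  show "1 \<le> Suc k" "Suc k \<le> c" using assms(2) by auto
  have "(\<Sum>j\<in>{k..<c}. 2 * (hi j - lo j)) = (\<Sum>j\<in>{Suc k..<c}. 2 * (hi j - lo j))"
    using sum_pop[OF assms(2), of "\<lambda>j. 2 * (hi j - lo j)"] assms(3) by simp
  then show "int (c + (\<Sum>j\<in>{Suc k..<c}. 2 * (hi j - lo j))) = 2 * n" using worklistD(4)[OF W] by (simp only:)
  have "(\<Sum>j\<in>{k..<c}. remaining (lo j) (hi j)) = (\<Sum>j\<in>{Suc k..<c}. remaining (lo j) (hi j))"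
    using sum_pop[OF assms(2), of "\<lambda>j. remaining (lo j) (hi j)"] assms(3) by (simp add: remaining_refl)
  then show "(\<Sum>j\<in>{1..<c}. stretch * (norm (interval_point lo hi j - r) - norm (interval_point lo hi (par j) - r)))
       + (\<Sum>j\<in>{Suc k..<c}. remaining (lo j) (hi j))
     = (\<Sum>x\<in>{i..<i + nat n}. stretch * norm (node (int x) - r)) - F (int i) (int i + n - 1)"
    using worklistD(12)[OF W] by (simp only:)
  show "\<forall>j\<in>{Suc k..<c}. \<forall>j'\<in>{1..<c}. j \<noteq> j' \<longrightarrow> hi j < lo j' \<or> hi j' < lo j \<or>
        (lo j' \<le> lo j \<and> hi j \<le> hi j' \<and> hi j - lo j < hi j' - lo j')"
  proof (rule ballI)
    fix j assume "j \<in> {Suc k..<c}"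
    then have "j \<in> {k..<c}" by auto
    then show "\<forall>j'\<in>{1..<c}. j \<noteq> j' \<longrightarrow> hi j < lo j' \<or> hi j' < lo j \<or>
        (lo j' \<le> lo j \<and> hi j \<le> hi j' \<and> hi j - lo j < hi j' - lo j')"
      by (rule worklistD(9)[OF W, THEN bspec])
  qed
  show "\<forall>x. i \<le> x \<longrightarrow> int x < int i + n \<longrightarrow> (\<exists>j\<in>{1..<c}. lo j \<le> x \<and> x \<le> hi j \<and> (Suc k \<le> j \<or> lo j = hi j))"
  proof (intro allI impI)
    fix x assume "i \<le> x" "int x < int i + n"
    then obtain j where "j \<in> {1..<c}" "lo j \<le> x" "x \<le> hi j" "k \<le> j \<or> lo j = hi j"
      using worklistD(11)[OF W] by metis
    with assms(3) show "\<exists>j\<in>{1..<c}. lo j \<le> x \<and> x \<le> hi j \<and> (Suc k \<le> j \<or> lo j = hi j)"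
      by (intro bexI[of _ j]) (cases "j = k"; auto)
  qed
qed (fact worklistD[OF W])+

text \<open>Interval \<open>k\<close> is replaced among the pending ones by two parts hung below it.
  Two balances are kept: s terminals need 2 (s - 1) further nodes, which is two plus the needs of
  the parts, and \<open>remaining\<close> is that of the parts plus the two arcs to their meeting
  point.\<close>

lemma worklist_split:
  assumes W: "worklist i lo hi par turn k c" and "k < c" "lo k < hi k"
    and C: "splits i C"
    and m: "m = C (lo k) (hi k)"
    and lo': "lo' = lo(c := lo k, Suc c := Suc m)" and hi': "hi' = hi(c := m, Suc c := hi k)"
    and par': "par' = par(c := k, Suc c := k)" and turn': "turn' = turn(c := 0, Suc c := 1)"
  shows "worklist i lo' hi' par' turn' (Suc k) (Suc (Suc c))"
proof -
  note W = worklistD[OF W]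
  have basic: "1 \<le> k" "2 \<le> c" "int (c + (\<Sum>j\<in>{k..<c}. 2 * (hi j - lo j))) = 2 * n"
    using W(1,3,4) .
  note bounds = bspec[OF W(5)] and parents = W(6) W(7) bspec[OF W(8)]
    and laminar = W(9)[THEN bspec, THEN bspec, THEN mp]
    and distinct = W(10)[THEN bspec, THEN bspec, THEN mp]
    and cover = W(11)[THEN spec, THEN mp, THEN mp] and cost = W(12)
  have kc: "k \<in> {1..<c}" using basic assms(2) by auto
  have mb: "lo k \<le> m" "m < hi k" and Fm: "F (int (lo k)) (int (hi k))
      = F (int (lo k)) (int m) + F (int (Suc m)) (int (hi k)) + saving (int (lo k)) (int (hi k))"
    using C bounds[OF kc] assms(3) unfolding splits_def m by blast+
  have old: "lo' j = lo j" "hi' j = hi j" "par' j = par j" "turn' j = turn j" if "j < c" for j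
    using that by (auto simp: lo' hi' par' turn')
  have new: "lo' c = lo k" "hi' c = m" "par' c = k" "turn' c = 0"
    "lo' (Suc c) = Suc m" "hi' (Suc c) = hi k" "par' (Suc c) = k" "turn' (Suc c) = 1"
    by (auto simp: lo' hi' par' turn')
  have range: "{1..<Suc (Suc c)} = insert (Suc c) (insert c {1..<c})"
    "{2..<Suc (Suc c)} = insert (Suc c) (insert c {2..<c})"
    "{Suc k..<Suc (Suc c)} = insert (Suc c) (insert c {Suc k..<c})"
    using basic assms(2) by auto
  have ipt: "interval_point lo' hi' j = interval_point lo hi j" if "j < c" for j
    using old[OF that] by (simp add: interval_point_def)
  have "1 \<le> Suc k" "Suc k \<le> Suc (Suc c)" "2 \<le> Suc (Suc c)" using assms(2) by auto
  moreover have "int (Suc (Suc c) + (\<Sum>j\<in>{Suc k..<Suc (Suc c)}. 2 * (hi' j - lo' j))) = 2 * n"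
  proof -
    have "(\<Sum>j\<in>{Suc k..<c}. 2 * (hi' j - lo' j)) = (\<Sum>j\<in>{Suc k..<c}. 2 * (hi j - lo j))"
      by (intro sum.cong) (auto simp: old)
    moreover have "(\<Sum>j\<in>{k..<c}. 2 * (hi j - lo j)) = 2 * (hi k - lo k) + (\<Sum>j\<in>{Suc k..<c}. 2 * (hi j - lo j))"
      using assms(2) by (rule sum_pop)
    ultimately show ?thesis using basic(3) mb unfolding range by (simp add: new)
  qed
  moreover have "\<forall>j\<in>{1..<Suc (Suc c)}. i \<le> lo' j \<and> lo' j \<le> hi' j \<and> int (hi' j) < int i + n"
    unfolding range using bounds bounds[OF kc] mb by (auto simp: old new)
  moreover have "par' 1 = 0" "turn' 1 = 0" using basic(2) parents(1,2) by (simp_all add: old)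
  moreover have "\<forall>j\<in>{2..<Suc (Suc c)}. 1 \<le> par' j \<and> par' j < j \<and>
        (turn' j = 0 \<and> lo' j = lo' (par' j) \<and> hi' j < hi' (par' j) \<or>
         turn' j = 1 \<and> hi' j = hi' (par' j) \<and> lo' (par' j) < lo' j)"
    unfolding range
  proof (intro ballI)
    fix j assume "j \<in> insert (Suc c) (insert c {2..<c})"
    then consider "j = Suc c" | "j = c" | "j \<in> {2..<c}" by auto
    then show "1 \<le> par' j \<and> par' j < j \<and>
        (turn' j = 0 \<and> lo' j = lo' (par' j) \<and> hi' j < hi' (par' j) \<or>
         turn' j = 1 \<and> hi' j = hi' (par' j) \<and> lo' (par' j) < lo' j)"
    proof cases
      case 3
      then have "par j < c" using parents(3)[OF 3] by auto
      with 3 parents(3)[OF 3] show ?thesis by (simp add: old)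
    qed (use mb kc in \<open>auto simp: old new\<close>)
  qed
  moreover have "\<forall>j\<in>{Suc k..<Suc (Suc c)}. \<forall>j'\<in>{1..<Suc (Suc c)}. j \<noteq> j' \<longrightarrow> hi' j < lo' j' \<or> hi' j' < lo' j \<or>
        (lo' j' \<le> lo' j \<and> hi' j \<le> hi' j' \<and> hi' j - lo' j < hi' j' - lo' j')"
  proof -
    have k_vs: "hi k < lo j \<or> hi j < lo k \<or> (lo j \<le> lo k \<and> hi k \<le> hi j \<and> hi k - lo k < hi j - lo j)"
      if "j \<in> {1..<c}" "j \<noteq> k" for j
      using laminar[of k j] that assms(2) by auto
    \<comment> \<open>Two pending intervals satisfy the alternative in both directions, and each
      cannot be strictly longer than the other; so they are disjoint.\<close>
    have pend: "hi k < lo j \<or> hi j < lo k" if "j \<in> {Suc k..<c}" for j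
      using laminar[of k j] laminar[of j k] that kc assms(2) by fastforce
    show ?thesis unfolding range
    proof (intro ballI impI)
      fix j j' assume j: "j \<in> insert (Suc c) (insert c {Suc k..<c})" and j': "j' \<in> insert (Suc c) (insert c {1..<c})"
        and "j \<noteq> j'"
      consider (oo) "j \<in> {Suc k..<c}" "j' \<in> {1..<c}" | (on) "j \<in> {Suc k..<c}" "j' \<ge> c"
        | (nk) "j \<ge> c" "j' = k" | (no) "j \<ge> c" "j' \<in> {1..<c}" "j' \<noteq> k" | (nn) "j \<ge> c" "j' \<ge> c"
        using j j' by fastforce
      then show "hi' j < lo' j' \<or> hi' j' < lo' j \<or>
        (lo' j' \<le> lo' j \<and> hi' j \<le> hi' j' \<and> hi' j - lo' j < hi' j' - lo' j')"
      proof cases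
        case oo
        with laminar[of j j'] \<open>j \<noteq> j'\<close> show ?thesis by (auto simp: old)
      next
        case on
        with pend[OF on(1)] mb j' show ?thesis by (auto simp: old new)
      next
        case nk
        with j mb kc show ?thesis by (auto simp: old new)
      next
        case no
        with j mb k_vs[OF no(2,3)] show ?thesis by (auto simp: old new)
      next
        case nn
        with j j' mb \<open>j \<noteq> j'\<close> show ?thesis by (auto simp: old new)
      qed
    qed
  qed
  moreover have "\<forall>j\<in>{1..<Suc (Suc c)}. \<forall>j'\<in>{1..<Suc (Suc c)}. j \<noteq> j' \<longrightarrow> lo' j \<noteq> lo' j' \<or> hi' j \<noteq> hi' j'"
  proof -
    have k_vs: "hi k < lo j \<or> hi j < lo k \<or> (lo j \<le> lo k \<and> hi k \<le> hi j)" if "j \<in> {1..<c}" for j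
      using laminar[of k j] that assms(2) by (cases "j = k") auto
    \<comment> \<open>Every older interval is disjoint from interval \<open>k\<close> or contains
      it, hence cannot equal a proper part of it.\<close>
    have n1: "lo' c \<noteq> lo' j \<or> hi' c \<noteq> hi' j" "lo' (Suc c) \<noteq> lo' j \<or> hi' (Suc c) \<noteq> hi' j" if "j \<in> {1..<c}" for j
      using k_vs[OF that] bounds[OF that] mb that by (auto simp: old new)
    have n2: "lo' c \<noteq> lo' (Suc c)" using mb by (simp add: new)
    show ?thesis unfolding range
    proof (intro ballI impI)
      fix j j' assume jj: "j \<in> insert (Suc c) (insert c {1..<c})" "j' \<in> insert (Suc c) (insert c {1..<c})" "j \<noteq> j'"
      consider "j \<in> {1..<c}" "j' \<in> {1..<c}" | "j \<in> {1..<c}" "j' = c" | "j \<in> {1..<c}" "j' = Suc c"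
        | "j = c" "j' \<in> {1..<c}" | "j = Suc c" "j' \<in> {1..<c}" | "j = c" "j' = Suc c" | "j = Suc c" "j' = c"
        using jj by blast
      then show "lo' j \<noteq> lo' j' \<or> hi' j \<noteq> hi' j'"
      proof cases
        case 1
        with distinct[of j j'] jj(3) show ?thesis by (simp add: old)
      qed (use n1[of j] n1[of j'] n2 in auto)
    qed
  qed
  moreover have "\<forall>x. i \<le> x \<longrightarrow> int x < int i + n \<longrightarrow>
      (\<exists>j\<in>{1..<Suc (Suc c)}. lo' j \<le> x \<and> x \<le> hi' j \<and> (Suc k \<le> j \<or> lo' j = hi' j))"
  proof (intro allI impI)
    fix x assume "i \<le> x" "int x < int i + n"
    then obtain j where j: "j \<in> {1..<c}" "lo j \<le> x" "x \<le> hi j" "k \<le> j \<or> lo j = hi j"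
      using cover by blast
    show "\<exists>j\<in>{1..<Suc (Suc c)}. lo' j \<le> x \<and> x \<le> hi' j \<and> (Suc k \<le> j \<or> lo' j = hi' j)"
    proof (cases "j = k")
      case True
      with j basic assms(2) show ?thesis
        by (cases "x \<le> m") (auto simp: new intro: bexI[of _ c] bexI[of _ "Suc c"])
    next
      case False
      with j show ?thesis by (intro bexI[of _ j]) (auto simp: old)
    qed
  qed
  moreover have "(\<Sum>j\<in>{1..<Suc (Suc c)}. stretch * (norm (interval_point lo' hi' j - r) - norm (interval_point lo' hi' (par' j) - r)))
       + (\<Sum>j\<in>{Suc k..<Suc (Suc c)}. remaining (lo' j) (hi' j))
     = (\<Sum>x\<in>{i..<i + nat n}. stretch * norm (node (int x) - r)) - F (int i) (int i + n - 1)"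
  proof -
    \<comment> \<open>Arcs drawn earlier end in older entries, which the updates at \<open>c\<close>
      and \<open>Suc c\<close> leave alone.\<close>
    have par_less: "par j < c" if "j \<in> {1..<c}" for j
      using parents(1) parents(3)[of j] that kc by (cases "j = 1") auto
    have s1: "(\<Sum>j\<in>{1..<c}. stretch * (norm (interval_point lo' hi' j - r) - norm (interval_point lo' hi' (par' j) - r)))
      = (\<Sum>j\<in>{1..<c}. stretch * (norm (interval_point lo hi j - r) - norm (interval_point lo hi (par j) - r)))"
      using par_less by (intro sum.cong) (auto simp: ipt old)
    have s2: "(\<Sum>j\<in>{Suc k..<c}. remaining (lo' j) (hi' j)) = (\<Sum>j\<in>{Suc k..<c}. remaining (lo j) (hi j))"
      by (intro sum.cong) (auto simp: old)
    have s3: "(\<Sum>j\<in>{k..<c}. remaining (lo j) (hi j)) = remaining (lo k) (hi k) + (\<Sum>j\<in>{Suc k..<c}. remaining (lo j) (hi j))"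
      using assms(2) by (rule sum_pop)
    have nn: "stretch * norm (interval_point lo' hi' c - r) = saving (int (lo k)) (int m)"
      "stretch * norm (interval_point lo' hi' (Suc c) - r) = saving (int (Suc m)) (int (hi k))"
      "stretch * norm (interval_point lo' hi' k - r) = saving (int (lo k)) (int (hi k))"
      using kc by (subst norm_interval_point; simp add: new old)+
    have "{lo k..hi k} = {lo k..m} \<union> {Suc m..hi k}" "{lo k..m} \<inter> {Suc m..hi k} = {}" using mb by auto
    then have "remaining (lo k) (hi k) = remaining (lo k) m + remaining (Suc m) (hi k)
        + (saving (int (lo k)) (int m) - saving (int (lo k)) (int (hi k)))
        + (saving (int (Suc m)) (int (hi k)) - saving (int (lo k)) (int (hi k)))"
      unfolding remaining_def using Fm by (simp add: sum.union_disjoint)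
    then show ?thesis unfolding cost[symmetric] range s3
      using s1 s2 nn by (simp add: new right_diff_distrib)
  qed
  ultimately show ?thesis by (rule worklistI)
qed

lemma worklist_count:
  assumes "worklist i lo hi par turn k c"
  shows "k \<le> c" "int (c + (\<Sum>j\<in>{k..<c}. 2 * (hi j - lo j))) = 2 * n"
  using worklistD(2,4)[OF assms] .

lemma worklist_pending:
  assumes "worklist i lo hi par turn k c" "int k < 2 * n"
  shows "k < c"
proof (rule ccontr)
  assume "\<not> k < c"
  with worklist_count[OF assms(1)] assms(2) show False by simp
qed

lemma worklist_finished:
  assumes "worklist i lo hi par turn k c" "int k = 2 * n"
  shows "c = k"
  using worklist_count[OF assms(1)] assms(2) by linarith

end

section \<open>From a finished list of intervals to an optimal tree\<close>

context spiral_terminals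
begin

text \<open>With 2n entries nothing is pending: the list is the root, n single terminals and n - 1
  merges. A child shares one end with its parent, so one segment joins their points: a right one if
  \<open>lo\<close> agrees (\<open>a\<close> is fixed), a left one if \<open>hi\<close>
  agrees.\<close>

theorem worklist_tree:
  assumes W: "worklist i lo hi par turn c c" and c: "int c = 2 * n"
  defines "p \<equiv> interval_point lo hi"
  shows "\<exists>T. spiral_tree \<alpha> r (range node) T \<and> nodes T = p ` {..<c} \<and> inj_on p {..<c} \<and>
    (\<forall>j\<in>{1..<c}. parent T (p j) = p (par j) \<and> par j < j \<and> (turn j = 0 \<or> turn j = 1) \<and>
       (\<exists>e. out_arc T (p j) = [(if turn j = 0 then Right else Left, e)]) \<and>
       path_points \<alpha> r (p j) (out_arc T (p j)) = [p (par j)]) \<and>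
    tree_length \<alpha> r T = (\<Sum>x\<in>{i..<i + nat n}. stretch * norm (node (int x) - r)) - F (int i) (int i + n - 1)"
proof -
  note W = worklistD[OF W]
  note bounds = bspec[OF W(5)]
  have p0: "p 0 = r" by (simp add: p_def interval_point_def)
  have p_pos: "p j = pt (a (int (lo j))) (b (int (hi j)))" if "0 < j" for j
    using that by (simp add: p_def interval_point_def)
  have p_neq: "p j \<noteq> r" if "0 < j" for j using p_pos[OF that] by simp
  have inj: "inj_on p {..<c}"
  proof (rule inj_onI)
    fix j j' assume jj: "j \<in> {..<c}" "j' \<in> {..<c}" "p j = p j'"
    show "j = j'"
    proof (cases "j = 0 \<or> j' = 0")
      case True
      with jj(3) p0 p_neq show ?thesis by (metis gr0I)
    next
      case False
      then have pos: "j \<in> {1..<c}" "j' \<in> {1..<c}" using jj by auto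
      have "pt (a (int (lo j))) (b (int (hi j))) = pt (a (int (lo j'))) (b (int (hi j')))"
        using jj(3) p_pos pos by simp
      then obtain q where q: "int (lo j') = int (lo j) + q * n" "int (hi j') = int (hi j) + q * n"
        using corner_eqD by blast
      \<comment> \<open>Both left ends lie in one window of length \<open>n\<close>, so the
        intervals cannot differ by a nonzero number of turns.\<close>
      have "int i \<le> int (lo j)" "int (lo j) < int i + n" "int i \<le> int (lo j')" "int (lo j') < int i + n"
        using bounds[OF pos(1)] bounds[OF pos(2)] by auto
      then have "\<bar>q * n\<bar> < n" using q(1) by linarith
      then have "q = 0" using n_pos by (simp add: abs_mult)
      with q have "lo j = lo j'" "hi j = hi j'" by auto
      with W(10) pos show ?thesis by metis
    qed
  qed
  define \<iota> where "\<iota> = inv_into {..<c} p"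
  have \<iota>: "\<iota> (p j) = j" if "j < c" for j using inv_into_f_f[OF inj] that by (simp add: \<iota>_def)
  define d where "d j = (if turn j = 0 then Right else Left)" for j
  \<comment> \<open>A spiral moves one coordinate by twice its parameter, hence the halves;
    \<open>None\<close> is for the arc from the whole window, entry 1, to the limit point.\<close>
  define e where "e j = (if j = 1 then None else Some (if turn j = 0 then (b (int (hi (par j))) - b (int (hi j))) / 2
     else (a (int (lo (par j))) - a (int (lo j))) / 2))" for j
  define T where "T = \<lparr>nodes = p ` {..<c}, parent = (\<lambda>v. p (par (\<iota> v))), out_arc = (\<lambda>v. [(d (\<iota> v), e (\<iota> v))])\<rparr>"
  have par: "par j < j" "turn j = 0 \<or> turn j = 1" if "j \<in> {1..<c}" for j
    using W(6,7) bspec[OF W(8), of j] that by (cases "j = 1"; force)+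
  have half: "x + 2 * ((y - x) / 2) = y" for x y :: real by (simp add: field_simps)
  have seg: "seg_valid r (p j) (d j, e j) \<and> seg_end \<alpha> r (p j) (d j, e j) = p (par j)" if j: "j \<in> {1..<c}" for j
  proof (cases "j = 1")
    case True
    with p_neq[of 1] p0 W(6) show ?thesis by (simp add: e_def)
  next
    case False
    then have pj: "1 \<le> par j" "(turn j = 0 \<and> lo j = lo (par j) \<and> hi j < hi (par j) \<or>
         turn j = 1 \<and> hi j = hi (par j) \<and> lo (par j) < lo j)"
      using bspec[OF W(8), of j] j by auto
    from pj(2) show ?thesis
    proof (elim disjE conjE)
      assume t: "turn j = 0" "lo j = lo (par j)" "hi j < hi (par j)"
      have "b (int (hi j)) < b (int (hi (par j)))" using t(3) by (intro b_less) simp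
      then show ?thesis using False t pj(1) j p_neq[of j]
        by (simp add: d_def e_def p_pos spiral_right half del: times_divide_eq_right)
    next
      assume t: "turn j = 1" "hi j = hi (par j)" "lo (par j) < lo j"
      have "a (int (lo j)) < a (int (lo (par j)))" using t(3) by (intro a_less) simp
      then show ?thesis using False t pj(1) j p_neq[of j]
        by (simp add: d_def e_def p_pos spiral_left half del: times_divide_eq_right)
    qed
  qed
  have root: "\<exists>q. (parent T ^^ q) (p j) = r" if "j < c" for j
    using that
  proof (induction j rule: less_induct)
    case (less j)
    show ?case
    proof (cases "j = 0")
      case True
      then show ?thesis using p0 by (intro exI[of _ 0]) simp
    next
      case False
      then have "par j < j" using par(1)[of j] less.prems by simp
      with less obtain q where "(parent T ^^ q) (p (par j)) = r" by force
      moreover have "parent T (p j) = p (par j)" using \<iota>[OF less.prems] by (simp add: T_def)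
      ultimately have "(parent T ^^ Suc q) (p j) = r" by (simp add: funpow_Suc_right del: funpow.simps)
      then show ?thesis by blast
    qed
  qed
  have cpos: "2 \<le> c" by (rule W(3))
  have nodes_minus: "nodes T - {r} = p ` {1..<c}"
  proof -
    have "{..<c} = insert 0 {1..<c}" using cpos by auto
    then have "p ` {..<c} = insert (p 0) (p ` {1..<c})" by (metis image_insert)
    then have "nodes T = insert r (p ` {1..<c})" unfolding p0 by (simp add: T_def)
    moreover have "r \<notin> p ` {1..<c}"
    proof
      assume "r \<in> p ` {1..<c}"
      then obtain j where "j \<in> {1..<c}" "r = p j" by blast
      with p_neq[of j] show False by simp
    qed
    ultimately show ?thesis by simp
  qed
  have arcs: "parent T (p j) = p (par j)" "out_arc T (p j) = [(d j, e j)]" if "j < c" for j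
    using \<iota>[OF that] by (simp_all add: T_def)
  have range: "range node = node ` {int i..<int i + n}" by (rule node_image[symmetric])
  have "range node \<subseteq> nodes T"
  proof
    fix v assume "v \<in> range node"
    then obtain x where x: "x \<in> {int i..<int i + n}" "v = node x" unfolding range by blast
    then have "i \<le> nat x" "int (nat x) < int i + n" "int (nat x) = x" by auto
    \<comment> \<open>No entry is pending any more, so the covering entry is a single
      terminal.\<close>
    then obtain j where j: "j \<in> {1..<c}" "lo j \<le> nat x" "nat x \<le> hi j" "lo j = hi j"
      using W(11) by (metis atLeastLessThan_iff leD)
    then have "p j = v" using p_pos[of j] x \<open>int (nat x) = x\<close> by simp
    with j show "v \<in> nodes T" by (auto simp: T_def)
  qed
  moreover have "r \<in> nodes T" using p0 cpos by (auto simp: T_def image_iff intro!: bexI[of _ 0])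
  moreover have "parent T v \<in> nodes T \<and> out_arc T v \<noteq> [] \<and> path_valid \<alpha> r v (out_arc T v) \<and>
        last (path_points \<alpha> r v (out_arc T v)) = parent T v \<and> (\<exists>q. (parent T ^^ q) v = r)"
    if v: "v \<in> nodes T - {r}" for v
  proof -
    obtain j where j: "j \<in> {1..<c}" "v = p j" using v unfolding nodes_minus by blast
    then have "par j < c" using par(1)[OF j(1)] by simp
    with j arcs[of j] seg[OF j(1)] root[of j] show ?thesis by (auto simp: T_def)
  qed
  moreover have "finite (nodes T)" by (simp add: T_def)
  ultimately have tree: "spiral_tree \<alpha> r (range node) T" unfolding spiral_tree_def by blast
  have "tree_length \<alpha> r T = (\<Sum>j\<in>{1..<c}. path_length \<alpha> r (p j) (out_arc T (p j)))"
    unfolding tree_length_def nodes_minus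
    by (rule sum.reindex[unfolded comp_def]) (use inj in \<open>auto intro: inj_on_subset\<close>)
  also have "\<dots> = (\<Sum>j\<in>{1..<c}. stretch * (norm (p j - r) - norm (p (par j) - r)))"
    using arcs(2) seg by (intro sum.cong) (auto simp: seg_length_eq)
  also have "\<dots> = (\<Sum>x\<in>{i..<i + nat n}. stretch * norm (node (int x) - r)) - F (int i) (int i + n - 1)"
    using W(12) by (simp add: p_def)
  finally have len: "tree_length \<alpha> r T
      = (\<Sum>x\<in>{i..<i + nat n}. stretch * norm (node (int x) - r)) - F (int i) (int i + n - 1)" .
  show ?thesis
    using tree inj len par arcs seg by (intro exI[of _ T]) (auto simp: T_def d_def)
qed

lemma sum_window:
  "(\<Sum>x\<in>{i..<i + nat n}. f (node (int x))) = (\<Sum>k\<in>{0..<n}. f (node k))" for f :: "complex \<Rightarrow> real"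
proof -
  have "int ` {i..<i + nat n} = {int i..<int i + n}"
    using n_pos by (simp add: image_int_atLeastLessThan)
  then have "(\<Sum>x\<in>{i..<i + nat n}. f (node (int x))) = (\<Sum>k\<in>{int i..<int i + n}. f (node k))"
    by (metis (no_types, lifting) inj_of_nat sum.reindex_cong inj_on_subset subset_UNIV)
  also have "\<dots> = (\<Sum>v\<in>range node. f v)"
    unfolding node_image[of "int i", symmetric] using inj_node[of "int i"] by (simp add: sum.reindex)
  also have "\<dots> = (\<Sum>k\<in>{0..<n}. f (node k))"
    using node_image[of 0] inj_node[of 0] by (simp add: sum.reindex flip: node_image[of 0])
  finally show ?thesis .
qed

text \<open>Every window is a shift by full turns of one starting in \<open>0..<n\<close>, so
  comparing n windows is enough.\<close>

lemma F_window_mod: "F i (i + n - 1) = F (i mod n) (i mod n + n - 1)"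
proof -
  have "F (i mod n + n * (i div n)) (i mod n + n - 1 + n * (i div n)) = F (i mod n) (i mod n + n - 1)"
    by (rule F_shift) simp
  moreover have "i mod n + n * (i div n) = i" "i mod n + n - 1 + n * (i div n) = i + n - 1"
    using mod_mult_div_eq[of i n] by linarith+
  ultimately show ?thesis by simp
qed

lemma optimal_if_best_window:
  assumes T: "spiral_tree \<alpha> r (range node) T"
    and len: "tree_length \<alpha> r T = (\<Sum>x\<in>{i..<i + nat n}. stretch * norm (node (int x) - r)) - F (int i) (int i + n - 1)"
    and best: "\<And>j. 0 \<le> j \<Longrightarrow> j < n \<Longrightarrow> F j (j + n - 1) \<le> F (int i) (int i + n - 1)"
  shows "optimal_spiral_tree \<alpha> r (range node) T"
  unfolding optimal_spiral_tree_def
proof (intro conjI allI impI)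
  fix T' assume "spiral_tree \<alpha> r (range node) T'"
  then have "spiral_tree \<alpha> r (node ` {0..<n}) T'" using node_image[of 0] by simp
  then obtain j where "(\<Sum>k\<in>{0..<n}. stretch * norm (node k - r)) - F j (j + n - 1) \<le> tree_length \<alpha> r T'"
    using tree_length_lower_bound by blast
  moreover have "F j (j + n - 1) \<le> F (int i) (int i + n - 1)"
    using best[of "j mod n"] n_pos F_window_mod[of j] by simp
  ultimately show "tree_length \<alpha> r T \<le> tree_length \<alpha> r T'"
    unfolding len sum_window[of "\<lambda>v. stretch * norm (v - r)"] by linarith
qed (rule T)

end

section \<open>Timed execution\<close>

text \<open>Total correctness with a budget: \<open>t\<close> is only an upper bound for the number
  of steps, so budgets can be rounded up freely.\<close>

definition run :: "real \<Rightarrow> com \<Rightarrow> store \<Rightarrow> nat \<Rightarrow> (store \<Rightarrow> bool) \<Rightarrow> bool" where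
  "run \<alpha> c s t Q \<longleftrightarrow> (\<exists>k s'. exec \<alpha> c s k s' \<and> k \<le> t \<and> Q s')"

definition set_idx :: "string \<Rightarrow> nat \<Rightarrow> nat \<Rightarrow> store \<Rightarrow> store" where
  "set_idx a i x s = s\<lparr>idx := (idx s)(a := (idx s a)(i := x))\<rparr>"

definition set_dat :: "string \<Rightarrow> nat \<Rightarrow> real \<Rightarrow> store \<Rightarrow> store" where
  "set_dat a i x s = s\<lparr>dat := (dat s)(a := (dat s a)(i := x))\<rparr>"

lemma idx_set_idx [simp]: "idx (set_idx a i x s) b = (if b = a then (idx s a)(i := x) else idx s b)"
  by (simp add: set_idx_def)

lemma dat_set_idx [simp]: "dat (set_idx a i x s) = dat s"
  by (simp add: set_idx_def)

lemma dat_set_dat [simp]: "dat (set_dat a i x s) b = (if b = a then (dat s a)(i := x) else dat s b)"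
  by (simp add: set_dat_def)

lemma idx_set_dat [simp]: "idx (set_dat a i x s) = idx s"
  by (simp add: set_dat_def)

lemma run_mono: "run \<alpha> c s t Q \<Longrightarrow> t \<le> t' \<Longrightarrow> (\<And>s'. Q s' \<Longrightarrow> Q' s') \<Longrightarrow> run \<alpha> c s t' Q'"
  unfolding run_def by (meson order_trans)

lemma run_Skip: "1 \<le> t \<Longrightarrow> Q s \<Longrightarrow> run \<alpha> Skip s t Q"
  unfolding run_def using exec_Skip by blast

lemma run_ISet:
  "1 + icost i + icost e \<le> t \<Longrightarrow> Q (set_idx a (ival i s) (ival e s) s) \<Longrightarrow> run \<alpha> (ISet a i e) s t Q"
  unfolding run_def set_idx_def using exec_ISet by blast

lemma run_RSet:
  "1 + icost i + rcost e \<le> t \<Longrightarrow> Q (set_dat a (ival i s) (rval \<alpha> e s) s) \<Longrightarrow> run \<alpha> (RSet a i e) s t Q"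
  unfolding run_def set_dat_def using exec_RSet by blast

lemma run_Seq:
  assumes "run \<alpha> c s t1 (\<lambda>s'. run \<alpha> d s' t2 Q)" "t1 + t2 \<le> t"
  shows "run \<alpha> (Seq c d) s t Q"
proof -
  obtain k1 s1 k2 s2 where "exec \<alpha> c s k1 s1" "k1 \<le> t1" "exec \<alpha> d s1 k2 s2" "k2 \<le> t2" "Q s2"
    using assms(1) unfolding run_def by blast
  then show ?thesis using exec_Seq[of \<alpha> c s k1 s1 d k2 s2] assms(2) unfolding run_def
    by (meson add_mono order_trans)
qed

lemma run_Seq_ISet:
  "1 + icost i + icost e \<le> t \<Longrightarrow> run \<alpha> d (set_idx a (ival i s) (ival e s) s) (t - (1 + icost i + icost e)) Q \<Longrightarrow>
    run \<alpha> (Seq (ISet a i e) d) s t Q"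
  by (rule run_Seq[where ?t1.0 = "1 + icost i + icost e"], rule run_ISet) auto

lemma run_Seq_RSet:
  "1 + icost i + rcost e \<le> t \<Longrightarrow> run \<alpha> d (set_dat a (ival i s) (rval \<alpha> e s) s) (t - (1 + icost i + rcost e)) Q \<Longrightarrow>
    run \<alpha> (Seq (RSet a i e) d) s t Q"
  by (rule run_Seq[where ?t1.0 = "1 + icost i + rcost e"], rule run_RSet) auto

lemma run_Cond:
  assumes "1 + bcost b \<le> t"
    and "bval \<alpha> b s \<Longrightarrow> run \<alpha> c s (t - (1 + bcost b)) Q"
    and "\<not> bval \<alpha> b s \<Longrightarrow> run \<alpha> d s (t - (1 + bcost b)) Q"
  shows "run \<alpha> (Cond b c d) s t Q"
proof (cases "bval \<alpha> b s")
  case True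
  then obtain k s' where "exec \<alpha> c s k s'" "k \<le> t - (1 + bcost b)" "Q s'"
    using assms(2) unfolding run_def by blast
  with True show ?thesis using exec_IfTrue[of \<alpha> b s c k s' d] assms(1) unfolding run_def
    by (intro exI[of _ "1 + bcost b + k"] exI[of _ s']) auto
next
  case False
  then obtain k s' where "exec \<alpha> d s k s'" "k \<le> t - (1 + bcost b)" "Q s'"
    using assms(3) unfolding run_def by blast
  with False show ?thesis using exec_IfFalse[of \<alpha> b s d k s' c] assms(1) unfolding run_def
    by (intro exI[of _ "1 + bcost b + k"] exI[of _ s']) auto
qed

abbreviation var :: "string \<Rightarrow> iexp" where
  "var v \<equiv> IGet v (IConst 0)"

text \<open>The bound \<open>hi\<close> is evaluated anew at every test; the rules below therefore
  ask the invariant to fix its value.\<close>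

definition for_loop :: "string \<Rightarrow> iexp \<Rightarrow> iexp \<Rightarrow> com \<Rightarrow> com" where
  "for_loop v lo hi body = Seq (ISet v (IConst 0) lo)
     (While (ILess (var v) hi) (Seq body (ISet v (IConst 0) (IAdd (var v) (IConst 1)))))"

text \<open>In each round the test costs \<open>icost hi + 4\<close> and the increment 6; the final,
  failing test is the summand outside the product.\<close>

lemma run_while_up:
  assumes inv: "\<And>k s. I k s \<Longrightarrow> idx s v 0 = k \<and> ival hi s = H"
    and body: "\<And>k s. I k s \<Longrightarrow> k < H \<Longrightarrow>
      run \<alpha> body s tb (\<lambda>s'. idx s' v 0 = k \<and> I (Suc k) (set_idx v 0 (Suc k) s'))"
    and "I k s" "k \<le> H"
  shows "run \<alpha> (While (ILess (var v) hi) (Seq body (ISet v (IConst 0) (IAdd (var v) (IConst 1))))) s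
    ((H - k) * (tb + icost hi + 10) + icost hi + 4) (I H)"
  using \<open>I k s\<close> \<open>k \<le> H\<close>
proof (induction "H - k" arbitrary: k s)
  case 0
  then have "k = H" by simp
  with inv[OF "0.prems"(1)] have "\<not> bval \<alpha> (ILess (var v) hi) s" by simp
  from exec_WhileFalse[OF this] \<open>k = H\<close> "0.prems" show ?case
    unfolding run_def by (intro exI[of _ "1 + bcost (ILess (var v) hi)"] exI[of _ s]) auto
next
  case (Suc m)
  then have "k < H" by simp
  have b: "bval \<alpha> (ILess (var v) hi) s" using inv[OF Suc.prems(1)] \<open>k < H\<close> by simp
  obtain k1 s1 where s1: "exec \<alpha> body s k1 s1" "k1 \<le> tb" "idx s1 v 0 = k" "I (Suc k) (set_idx v 0 (Suc k) s1)"
    using body[OF Suc.prems(1) \<open>k < H\<close>] unfolding run_def by blast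
  have inc: "exec \<alpha> (ISet v (IConst 0) (IAdd (var v) (IConst 1))) s1 6 (set_idx v 0 (Suc k) s1)"
    using exec_ISet[of \<alpha> v "IConst 0" "IAdd (var v) (IConst 1)" s1] s1(3) by (simp add: set_idx_def numeral_eq_Suc)
  have "run \<alpha> (While (ILess (var v) hi) (Seq body (ISet v (IConst 0) (IAdd (var v) (IConst 1))))) (set_idx v 0 (Suc k) s1)
    ((H - Suc k) * (tb + icost hi + 10) + icost hi + 4) (I H)"
    using Suc.hyps(2) by (intro Suc.hyps(1) s1(4)) (use \<open>k < H\<close> in auto)
  then obtain k2 s2 where s2: "exec \<alpha> (While (ILess (var v) hi) (Seq body (ISet v (IConst 0) (IAdd (var v) (IConst 1)))))
      (set_idx v 0 (Suc k) s1) k2 s2" "k2 \<le> (H - Suc k) * (tb + icost hi + 10) + icost hi + 4" "I H s2"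
    unfolding run_def by blast
  note step = exec_WhileTrue[OF b exec_Seq[OF s1(1) inc] s2(1)]
  have "H - k = Suc (H - Suc k)" using \<open>k < H\<close> by simp
  then have "1 + bcost (ILess (var v) hi) + (k1 + 6) + k2 \<le> (H - k) * (tb + icost hi + 10) + icost hi + 4"
    using s1(2) s2(2) by simp
  with step s2(3) show ?case unfolding run_def by blast
qed

lemma run_for:
  assumes "\<And>k s. I k s \<Longrightarrow> idx s v 0 = k \<and> ival hi s = H"
    and "\<And>k s. I k s \<Longrightarrow> k < H \<Longrightarrow>
      run \<alpha> body s tb (\<lambda>s'. idx s' v 0 = k \<and> I (Suc k) (set_idx v 0 (Suc k) s'))"
    and "I (ival lo s) (set_idx v 0 (ival lo s) s)" "ival lo s \<le> H"
    and "(H - ival lo s) * (tb + icost hi + 10) + icost lo + icost hi + 6 \<le> t"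
    and "\<And>s. I H s \<Longrightarrow> Q s"
  shows "run \<alpha> (for_loop v lo hi body) s t Q"
  unfolding for_loop_def
proof (rule run_Seq_ISet)
  have loop: "run \<alpha> (While (ILess (var v) hi) (Seq body (ISet v (IConst 0) (IAdd (var v) (IConst 1)))))
      (set_idx v 0 (ival lo s) s) ((H - ival lo s) * (tb + icost hi + 10) + icost hi + 4) (I H)"
    by (rule run_while_up[where I = I, OF assms(1,2,3,4)]) auto
  have "(H - ival lo s) * (tb + icost hi + 10) + icost hi + 4 \<le> t - (1 + icost (IConst 0) + icost lo)"
    using assms(5) by simp
  from run_mono[OF loop this assms(6)]
  show "run \<alpha> (While (ILess (var v) hi) (Seq body (ISet v (IConst 0) (IAdd (var v) (IConst 1)))))
      (set_idx v (ival (IConst 0) s) (ival lo s) s) (t - (1 + icost (IConst 0) + icost lo)) Q"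
    by simp
qed (use assms(5) in auto)

definition frame :: "string set \<Rightarrow> string set \<Rightarrow> store \<Rightarrow> store \<Rightarrow> bool" where
  "frame A B s s' \<longleftrightarrow> (\<forall>v. v \<notin> A \<longrightarrow> idx s' v = idx s v) \<and> (\<forall>v. v \<notin> B \<longrightarrow> dat s' v = dat s v)"

lemma frame_refl [simp]: "frame A B s s"
  by (simp add: frame_def)

lemma frame_set_idx: "frame A B s s' \<Longrightarrow> v \<in> A \<Longrightarrow> frame A B s (set_idx v i x s')"
  by (auto simp: frame_def)

lemma frame_set_dat: "frame A B s s' \<Longrightarrow> v \<in> B \<Longrightarrow> frame A B s (set_dat v i x s')"
  by (auto simp: frame_def)

lemma frame_idx: "frame A B s s' \<Longrightarrow> v \<notin> A \<Longrightarrow> idx s' v = idx s v"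
  by (simp add: frame_def)

section \<open>The program\<close>

abbreviation root_exp :: pexp where
  "root_exp \<equiv> Point (RGet ''rx'' (IConst 0)) (RGet ''ry'' (IConst 0))"

abbreviation terminal_exp :: "iexp \<Rightarrow> pexp" where
  "terminal_exp e \<equiv> Point (RGet ''x'' e) (RGet ''y'' e)"

abbreviation site_exp :: "iexp \<Rightarrow> pexp" where
  "site_exp e \<equiv> Point (RGet ''px'' e) (RGet ''py'' e)"

abbreviation twice_exp :: iexp where
  "twice_exp \<equiv> IMul (IConst 2) (var ''n'')"

abbreviation key_exp :: "iexp \<Rightarrow> rexp" where
  "key_exp e \<equiv> SpiralLength root_exp (Meet root_exp (terminal_exp (IConst 0)) (terminal_exp e))"

abbreviation root_of :: "store \<Rightarrow> complex" where
  "root_of s \<equiv> Complex (dat s ''rx'' 0) (dat s ''ry'' 0)"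

definition meet_length :: "real \<Rightarrow> complex \<Rightarrow> complex \<Rightarrow> complex \<Rightarrow> real" where
  "meet_length \<alpha> r p q = seg_length \<alpha> r (first_meet \<alpha> r p q) (Right, None)"

text \<open>The meeting point of the right spiral of terminal 0 with the left spiral of another terminal moves inwards as
  the latter advances counterclockwise. Its distance from the root thus sorts the terminals.\<close>

definition key :: "real \<Rightarrow> store \<Rightarrow> nat \<Rightarrow> real" where
  "key \<alpha> s j = meet_length \<alpha> (root_of s) (Complex (dat s ''x'' 0) (dat s ''y'' 0)) (Complex (dat s ''x'' j) (dat s ''y'' j))"

text \<open>Sorting by counting takes O(n^2) comparisons, which the time bound permits; for distinct
  keys the counts form a permutation.\<close>

definition key_rank :: "(nat \<Rightarrow> real) \<Rightarrow> nat \<Rightarrow> nat \<Rightarrow> nat" where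
  "key_rank f N i = card {j. j < N \<and> f i < f j}"

text \<open>Each terminal is stored at its rank and again n places later, so that every circular
  interval of the sorted terminals becomes an ordinary interval of \<open>px\<close> and
  \<open>py\<close>.\<close>

definition rank_com :: com where
  "rank_com = for_loop ''i'' (IConst 0) (var ''n'')
    (Seq (ISet ''rank'' (IConst 0) (IConst 0))
    (Seq (for_loop ''j'' (IConst 0) (var ''n'')
      (Cond (RLess (key_exp (var ''i'')) (key_exp (var ''j'')))
        (ISet ''rank'' (IConst 0) (IAdd (var ''rank'') (IConst 1))) Skip))
    (Seq (RSet ''px'' (var ''rank'') (RGet ''x'' (var ''i'')))
    (Seq (RSet ''py'' (var ''rank'') (RGet ''y'' (var ''i'')))
    (Seq (RSet ''px'' (IAdd (var ''rank'') (var ''n'')) (RGet ''x'' (var ''i'')))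
    (RSet ''py'' (IAdd (var ''rank'') (var ''n'')) (RGet ''y'' (var ''i''))))))))"

lemma rval_key_exp: "rval \<alpha> (key_exp e) s = key \<alpha> s (ival e s)"
  by (simp add: key_def meet_length_def)

lemma key_frame: "frame A B s s' \<Longrightarrow> B \<inter> {''x'', ''y'', ''rx'', ''ry''} = {} \<Longrightarrow> key \<alpha> s' = key \<alpha> s"
  by (auto simp: key_def frame_def fun_eq_iff)

lemma card_less_Suc_Collect:
  "card {j. j < Suc k \<and> P j} = card {j. j < k \<and> P j} + (if P k then 1 else 0)"
proof -
  have "{j. j < Suc k \<and> P j} = (if P k then insert k {j. j < k \<and> P j} else {j. j < k \<and> P j})"
    by (auto simp: less_Suc_eq)
  then show ?thesis by simp
qed

lemma run_rank_loop:
  assumes "idx s ''n'' 0 = N" "idx s ''i'' 0 = i" "idx s ''rank'' 0 = 0"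
  shows "run \<alpha> (for_loop ''j'' (IConst 0) (var ''n'')
      (Cond (RLess (key_exp (var ''i'')) (key_exp (var ''j'')))
        (ISet ''rank'' (IConst 0) (IAdd (var ''rank'') (IConst 1))) Skip)) s (N * 100 + 20)
      (\<lambda>s'. frame {''j'', ''rank''} {} s s' \<and> idx s' ''rank'' 0 = key_rank (key \<alpha> s) N i)"
proof (rule run_for[where H = N and tb = 80 and
    I = "\<lambda>k s'. frame {''j'', ''rank''} {} s s' \<and> idx s' ''j'' 0 = k \<and> idx s' ''rank'' 0 = card {j. j < k \<and> key \<alpha> s i < key \<alpha> s j}"])
  fix k s' assume I: "frame {''j'', ''rank''} {} s s' \<and> idx s' ''j'' 0 = k \<and>
    idx s' ''rank'' 0 = card {j. j < k \<and> key \<alpha> s i < key \<alpha> s j}"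
  then have f: "idx s' ''n'' 0 = N" "idx s' ''i'' 0 = i" "key \<alpha> s' = key \<alpha> s"
    using assms key_frame[of "{''j'', ''rank''}" "{}" s s'] by (auto simp: frame_def)
  then show "idx s' ''j'' 0 = k \<and> ival (var ''n'') s' = N" using I by simp
  assume "k < N"
  show "run \<alpha> (Cond (RLess (key_exp (var ''i'')) (key_exp (var ''j'')))
        (ISet ''rank'' (IConst 0) (IAdd (var ''rank'') (IConst 1))) Skip) s' 80
     (\<lambda>s'. idx s' ''j'' 0 = k \<and> frame {''j'', ''rank''} {} s (set_idx ''j'' 0 (Suc k) s') \<and>
        idx (set_idx ''j'' 0 (Suc k) s') ''j'' 0 = Suc k \<and>
        idx (set_idx ''j'' 0 (Suc k) s') ''rank'' 0 = card {j. j < Suc k \<and> key \<alpha> s i < key \<alpha> s j})"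
    by (rule run_Cond; (rule run_ISet run_Skip)?)
      (use I f in \<open>auto simp: rval_key_exp card_less_Suc_Collect frame_set_idx simp del: rval.simps\<close>)
qed (use assms in \<open>auto simp: key_rank_def frame_set_idx\<close>)

lemma run_rank:
  assumes n: "idx s ''n'' 0 = N" and inj: "inj_on (key_rank (key \<alpha> s) N) {..<N}"
    and bound: "\<And>i. i < N \<Longrightarrow> key_rank (key \<alpha> s) N i < N"
  shows "run \<alpha> rank_com s (N * (N * 100 + 100) + 20)
    (\<lambda>s'. frame {''i'', ''j'', ''rank''} {''px'', ''py''} s s' \<and>
      (\<forall>i<N. \<forall>p\<in>{key_rank (key \<alpha> s) N i, key_rank (key \<alpha> s) N i + N}.
        dat s' ''px'' p = dat s ''x'' i \<and> dat s' ''py'' p = dat s ''y'' i))"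
  unfolding rank_com_def
proof (rule run_for[where H = N and tb = "N * 100 + 80" and
    I = "\<lambda>k s'. frame {''i'', ''j'', ''rank''} {''px'', ''py''} s s' \<and> idx s' ''i'' 0 = k \<and>
      (\<forall>i<k. \<forall>p\<in>{key_rank (key \<alpha> s) N i, key_rank (key \<alpha> s) N i + N}.
        dat s' ''px'' p = dat s ''x'' i \<and> dat s' ''py'' p = dat s ''y'' i)"])
  fix k s' assume I: "frame {''i'', ''j'', ''rank''} {''px'', ''py''} s s' \<and> idx s' ''i'' 0 = k \<and>
      (\<forall>i<k. \<forall>p\<in>{key_rank (key \<alpha> s) N i, key_rank (key \<alpha> s) N i + N}.
        dat s' ''px'' p = dat s ''x'' i \<and> dat s' ''py'' p = dat s ''y'' i)"
  have f: "idx s' ''n'' 0 = N" "dat s' ''x'' = dat s ''x''" "dat s' ''y'' = dat s ''y''" "key \<alpha> s' = key \<alpha> s"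
    using I n key_frame[of "{''i'', ''j'', ''rank''}" "{''px'', ''py''}" s s'] by (auto simp: frame_def)
  then show "idx s' ''i'' 0 = k \<and> ival (var ''n'') s' = N" using I by simp
  assume "k < N"
  define s1 where "s1 = set_idx ''rank'' 0 0 s'"
  have k1: "key \<alpha> s1 = key \<alpha> s" using f by (simp add: key_def s1_def fun_eq_iff)
  let ?Q = "\<lambda>s'. idx s' ''i'' 0 = k \<and> frame {''i'', ''j'', ''rank''} {''px'', ''py''} s (set_idx ''i'' 0 (Suc k) s') \<and>
        idx (set_idx ''i'' 0 (Suc k) s') ''i'' 0 = Suc k \<and>
      (\<forall>i<Suc k. \<forall>p\<in>{key_rank (key \<alpha> s) N i, key_rank (key \<alpha> s) N i + N}.
        dat (set_idx ''i'' 0 (Suc k) s') ''px'' p = dat s ''x'' i \<and> dat (set_idx ''i'' 0 (Suc k) s') ''py'' p = dat s ''y'' i)"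
  have stores: "run \<alpha> (Seq (RSet ''px'' (var ''rank'') (RGet ''x'' (var ''i'')))
    (Seq (RSet ''py'' (var ''rank'') (RGet ''y'' (var ''i'')))
    (Seq (RSet ''px'' (IAdd (var ''rank'') (var ''n'')) (RGet ''x'' (var ''i'')))
    (RSet ''py'' (IAdd (var ''rank'') (var ''n'')) (RGet ''y'' (var ''i'')))))) s2 40 ?Q"
    if s2: "frame {''j'', ''rank''} {} s1 s2" "idx s2 ''rank'' 0 = key_rank (key \<alpha> s) N k" for s2
  proof -
    have g: "idx s2 ''i'' 0 = k" "idx s2 ''n'' 0 = N" "dat s2 = dat s'"
      using s2 I f by (auto simp: frame_def s1_def)
    have fr: "frame {''i'', ''j'', ''rank''} {''px'', ''py''} s s2"
      using s2(1) I by (auto simp: frame_def s1_def)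
    \<comment> \<open>Distinct ranks protect the entries of earlier terminals, and ranks below
      \<open>N\<close> keep the two copies apart.\<close>
    have ne: "key_rank (key \<alpha> s) N i \<noteq> key_rank (key \<alpha> s) N k" if "i < k" for i
      using inj_onD[OF inj, of i k] that \<open>k < N\<close> by auto
    have ne2: "key_rank (key \<alpha> s) N i \<noteq> key_rank (key \<alpha> s) N j + N" if "i \<le> k" for i j
      using bound[of i] that \<open>k < N\<close> by auto
    show ?thesis
      apply (rule run_Seq_RSet, simp)+
      apply (rule run_RSet, simp)
      using g s2(2) I ne ne2 ne2[symmetric] f fr
      by (auto simp: frame_set_idx frame_set_dat less_Suc_eq)
  qed
  show "run \<alpha> (Seq (ISet ''rank'' (IConst 0) (IConst 0))
    (Seq (for_loop ''j'' (IConst 0) (var ''n'')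
      (Cond (RLess (key_exp (var ''i'')) (key_exp (var ''j'')))
        (ISet ''rank'' (IConst 0) (IAdd (var ''rank'') (IConst 1))) Skip))
    (Seq (RSet ''px'' (var ''rank'') (RGet ''x'' (var ''i'')))
    (Seq (RSet ''py'' (var ''rank'') (RGet ''y'' (var ''i'')))
    (Seq (RSet ''px'' (IAdd (var ''rank'') (var ''n'')) (RGet ''x'' (var ''i'')))
    (RSet ''py'' (IAdd (var ''rank'') (var ''n'')) (RGet ''y'' (var ''i''))))))))
     s' (N * 100 + 80) ?Q"
    apply (rule run_Seq_ISet, simp)
    apply (rule run_Seq[where ?t1.0 = "N * 100 + 20" and ?t2.0 = 40])
     apply (rule run_mono[OF run_rank_loop[of _ N k] order_refl])
        apply (use I f in simp)
       apply (use I in simp)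
      apply simp
     apply (rule stores)
      apply (simp add: s1_def)
     apply (use k1 in \<open>simp add: s1_def\<close>)
    apply simp
    done
qed (use n in \<open>auto simp: frame_set_idx algebra_simps\<close>)

section \<open>The table of intervals\<close>

abbreviation cell_exp :: "iexp \<Rightarrow> iexp \<Rightarrow> iexp" where
  "cell_exp l h \<equiv> IAdd (IMul l twice_exp) h"

definition cell :: "nat \<Rightarrow> nat \<Rightarrow> nat \<Rightarrow> nat" where
  "cell N l h = l * (2 * N) + h"

lemma cell_eq_iff: "h < 2 * N \<Longrightarrow> h' < 2 * N \<Longrightarrow> cell N l h = cell N l' h' \<longleftrightarrow> l = l' \<and> h = h'"
proof
  assume h: "h < 2 * N" "h' < 2 * N" and "cell N l h = cell N l' h'"
  then have "(l * (2 * N) + h) div (2 * N) = (l' * (2 * N) + h') div (2 * N)"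
    "(l * (2 * N) + h) mod (2 * N) = (l' * (2 * N) + h') mod (2 * N)" by (simp_all only: cell_def)
  with h show "l = l' \<and> h = h'" by simp
qed simp

abbreviation candidate_exp :: rexp where
  "candidate_exp \<equiv> RAdd (RGet ''S'' (cell_exp (var ''l'') (var ''m'')))
     (RGet ''S'' (cell_exp (IAdd (var ''m'') (IConst 1)) (IAdd (var ''l'') (var ''d''))))"

abbreviation target_exp :: iexp where
  "target_exp \<equiv> cell_exp (var ''l'') (IAdd (var ''l'') (var ''d''))"

text \<open>The target cell itself holds the running maximum, starting from the 0 of the fresh
  store. A candidate is skipped only if strictly smaller; so the first one is always taken, even if
  it is 0, and \<open>C\<close> gets a value.\<close>

definition max_com :: com where
  "max_com = for_loop ''m'' (var ''l'') (IAdd (var ''l'') (var ''d''))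
     (Cond (RLess candidate_exp (RGet ''S'' target_exp)) Skip
       (Seq (RSet ''S'' target_exp candidate_exp) (ISet ''C'' target_exp (var ''m''))))"

text \<open>Cells are filled in order of increasing \<open>d\<close>. A window has n terminals, so
  \<open>d\<close> stays below n, while the left end runs through both copies.\<close>

definition table_com :: com where
  "table_com = for_loop ''d'' (IConst 1) (var ''n'') (for_loop ''l'' (IConst 0) (ISub twice_exp (var ''d''))
     (Seq max_com (RSet ''S'' target_exp (RAdd (RGet ''S'' target_exp)
       (SpiralLength root_exp (Meet root_exp (site_exp (var ''l'')) (site_exp (IAdd (var ''l'') (var ''d'')))))))))"

definition best_com :: com where
  "best_com = for_loop ''i'' (IConst 0) (var ''n'')
     (Cond (RLess (RGet ''S'' (cell_exp (var ''best'') (ISub (IAdd (var ''best'') (var ''n'')) (IConst 1))))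
                  (RGet ''S'' (cell_exp (var ''i'') (ISub (IAdd (var ''i'') (var ''n'')) (IConst 1)))))
       (ISet ''best'' (IConst 0) (var ''i'')) Skip)"

definition max_upto :: "(nat \<Rightarrow> nat \<Rightarrow> real) \<Rightarrow> nat \<Rightarrow> store \<Rightarrow> nat \<Rightarrow> nat \<Rightarrow> nat \<Rightarrow> store \<Rightarrow> bool" where
  "max_upto \<phi> N s l h k s' \<longleftrightarrow> (\<exists>v c. frame {''m'', ''C''} {''S''} s s' \<and>
    dat s' ''S'' = (dat s ''S'')(cell N l h := v) \<and> idx s' ''C'' = (idx s ''C'')(cell N l h := c) \<and>
    (\<forall>m\<in>{l..<k}. \<phi> l m + \<phi> (Suc m) h \<le> v) \<and>
    (if l < k then c \<in> {l..<k} \<and> v = \<phi> l c + \<phi> (Suc c) h else v = 0))"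

lemma run_max:
  assumes N: "idx s ''n'' 0 = N" "idx s ''l'' 0 = l" "idx s ''d'' 0 = d" and d: "0 < d" "l + d < 2 * N"
    and S: "\<And>m. l \<le> m \<Longrightarrow> m < l + d \<Longrightarrow> dat s ''S'' (cell N l m) = \<phi> l m"
      "\<And>m. l \<le> m \<Longrightarrow> m < l + d \<Longrightarrow> dat s ''S'' (cell N (Suc m) (l + d)) = \<phi> (Suc m) (l + d)"
    and zero: "dat s ''S'' (cell N l (l + d)) = 0" and pos: "\<And>l h. 0 \<le> \<phi> l h"
  shows "run \<alpha> max_com s (d * 150 + 60) (max_upto \<phi> N s l (l + d) (l + d))"
  unfolding max_com_def
proof (rule run_for[where H = "l + d" and tb = 110 and
    I = "\<lambda>k s'. idx s' ''m'' 0 = k \<and> l \<le> k \<and> max_upto \<phi> N s l (l + d) k s'"])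
  fix k s' assume I: "idx s' ''m'' 0 = k \<and> l \<le> k \<and> max_upto \<phi> N s l (l + d) k s'"
  then obtain v c where vc: "frame {''m'', ''C''} {''S''} s s'"
    "dat s' ''S'' = (dat s ''S'')(cell N l (l + d) := v)" "idx s' ''C'' = (idx s ''C'')(cell N l (l + d) := c)"
    "\<forall>m\<in>{l..<k}. \<phi> l m + \<phi> (Suc m) (l + d) \<le> v"
    "if l < k then c \<in> {l..<k} \<and> v = \<phi> l c + \<phi> (Suc c) (l + d) else v = 0"
    unfolding max_upto_def by blast
  have g: "idx s' ''n'' 0 = N" "idx s' ''l'' 0 = l" "idx s' ''d'' 0 = d"
    using N frame_idx[OF vc(1)] by auto
  then show "idx s' ''m'' 0 = k \<and> ival (IAdd (var ''l'') (var ''d'')) s' = l + d" using I by simp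
  assume k: "k < l + d"
  have tgt: "ival target_exp s' = cell N l (l + d)" by (simp add: g cell_def)
  have "dat s' ''S'' (cell N l k) = \<phi> l k" "dat s' ''S'' (cell N (Suc k) (l + d)) = \<phi> (Suc k) (l + d)"
    using S[of k] I k d vc(2) by (simp_all add: cell_eq_iff)
  then have cand: "rval \<alpha> candidate_exp s' = \<phi> l k + \<phi> (Suc k) (l + d)"
    using I by (simp add: g cell_def)
  have test: "bval \<alpha> (RLess candidate_exp (RGet ''S'' target_exp)) s' \<longleftrightarrow> \<phi> l k + \<phi> (Suc k) (l + d) < v"
    unfolding bval.simps cand rval.simps(2) tgt using vc(2) by simp
  let ?Q = "\<lambda>s'. idx s' ''m'' 0 = k \<and> (idx (set_idx ''m'' 0 (Suc k) s') ''m'' 0 = Suc k \<and> l \<le> Suc k \<and>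
     max_upto \<phi> N s l (l + d) (Suc k) (set_idx ''m'' 0 (Suc k) s'))"
  have range: "{l..<Suc k} = insert k {l..<k}" using I by auto
  show "run \<alpha> (Cond (RLess candidate_exp (RGet ''S'' target_exp)) Skip
       (Seq (RSet ''S'' target_exp candidate_exp) (ISet ''C'' target_exp (var ''m'')))) s' 110 ?Q"
  proof (rule run_Cond)
    assume "bval \<alpha> (RLess candidate_exp (RGet ''S'' target_exp)) s'"
    then have less: "\<phi> l k + \<phi> (Suc k) (l + d) < v" unfolding test .
    \<comment> \<open>Before the first candidate \<open>v\<close> is 0, and a nonnegative candidate
      cannot fall below it.\<close>
    have "l < k"
    proof (rule ccontr)
      assume "\<not> l < k"
      with vc(5) less pos[of l k] pos[of "Suc k" "l + d"] show False by simp
    qed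
    then have "max_upto \<phi> N s l (l + d) (Suc k) (set_idx ''m'' 0 (Suc k) s')"
      unfolding max_upto_def range using vc less
      by (intro exI[of _ v] exI[of _ c]) (auto simp: frame_set_idx)
    with I show "run \<alpha> Skip s' (110 - (1 + bcost (RLess candidate_exp (RGet ''S'' target_exp)))) ?Q"
      by (intro run_Skip) auto
  next
    assume "\<not> bval \<alpha> (RLess candidate_exp (RGet ''S'' target_exp)) s'"
    then have le: "v \<le> \<phi> l k + \<phi> (Suc k) (l + d)" unfolding test by simp
    let ?s2 = "set_idx ''C'' (cell N l (l + d)) k (set_dat ''S'' (cell N l (l + d)) (\<phi> l k + \<phi> (Suc k) (l + d)) s')"
    have "\<phi> l m + \<phi> (Suc m) (l + d) \<le> \<phi> l k + \<phi> (Suc k) (l + d)" if "m \<in> {l..<k}" for m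
      using vc(4) that le by fastforce
    then have "max_upto \<phi> N s l (l + d) (Suc k) (set_idx ''m'' 0 (Suc k) ?s2)"
      unfolding max_upto_def range using vc I
      by (intro exI[of _ "\<phi> l k + \<phi> (Suc k) (l + d)"] exI[of _ k]) (auto simp: frame_set_idx frame_set_dat)
    with I have post: "?Q ?s2" by simp
    have tgt2: "ival target_exp (set_dat a i x s') = cell N l (l + d)" "ival (var ''m'') (set_dat a i x s') = k" for a i x
      using tgt I by simp_all
    show "run \<alpha> (Seq (RSet ''S'' target_exp candidate_exp) (ISet ''C'' target_exp (var ''m''))) s'
        (110 - (1 + bcost (RLess candidate_exp (RGet ''S'' target_exp)))) ?Q"
      apply (rule run_Seq_RSet, simp, rule run_ISet, simp)
      unfolding tgt cand tgt2 by (rule post)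
  qed simp
next
  show "idx (set_idx ''m'' 0 (ival (var ''l'') s) s) ''m'' 0 = ival (var ''l'') s \<and> l \<le> ival (var ''l'') s \<and>
     max_upto \<phi> N s l (l + d) (ival (var ''l'') s) (set_idx ''m'' 0 (ival (var ''l'') s) s)"
    using N zero unfolding max_upto_def
    by (simp add: frame_set_idx) (metis fun_upd_triv)
qed (use N d in auto)

text \<open>\<open>D\<close> selects the cells already computed. The others are required to hold 0,
  since the maximum is accumulated in them.\<close>

definition filled :: "(nat \<Rightarrow> nat \<Rightarrow> real) \<Rightarrow> (nat \<Rightarrow> nat \<Rightarrow> real) \<Rightarrow> nat \<Rightarrow> (nat \<Rightarrow> nat \<Rightarrow> bool) \<Rightarrow> store \<Rightarrow> bool" where
  "filled \<phi> \<sigma> N D s \<longleftrightarrow> (\<forall>l h. l \<le> h \<longrightarrow> h < 2 * N \<longrightarrow>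
     (if D l h then dat s ''S'' (cell N l h) = \<phi> l h \<and>
        (l < h \<longrightarrow> (let c = idx s ''C'' (cell N l h) in l \<le> c \<and> c < h \<and> \<phi> l h = \<phi> l c + \<phi> (Suc c) h + \<sigma> l h))
      else dat s ''S'' (cell N l h) = 0))"

lemma filled_cong:
  assumes "\<And>l h. l \<le> h \<Longrightarrow> h < 2 * N \<Longrightarrow> D l h = D' l h" "dat s ''S'' = dat s' ''S''" "idx s ''C'' = idx s' ''C''"
  shows "filled \<phi> \<sigma> N D s = filled \<phi> \<sigma> N D' s'"
  unfolding filled_def assms(2,3) using assms(1) by (intro iff_allI) simp

text \<open>Isolates what the table needs from the spirals, with natural numbers as indices:
  \<open>\<phi>\<close> stands for \<open>F\<close> and \<open>\<sigma>\<close> for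
  \<open>saving\<close>. The last assumption asks for spans below a full turn, where the extremes
  first meet at the corner.\<close>

locale table_values =
  fixes \<alpha> :: real and N :: nat and \<phi> \<sigma> :: "nat \<Rightarrow> nat \<Rightarrow> real"
    and root :: complex and site :: "nat \<Rightarrow> complex"
  assumes N_pos: "0 < N"
    and \<phi>_refl: "\<phi> l l = 0"
    and \<phi>_nonneg: "0 \<le> \<phi> l h"
    and \<phi>_attained: "l \<le> c \<Longrightarrow> c < h \<Longrightarrow> (\<And>m. l \<le> m \<Longrightarrow> m < h \<Longrightarrow> \<phi> l m + \<phi> (Suc m) h \<le> \<phi> l c + \<phi> (Suc c) h) \<Longrightarrow>
      \<phi> l h = \<phi> l c + \<phi> (Suc c) h + \<sigma> l h"
    and \<sigma>_meet: "l < h \<Longrightarrow> h < l + N \<Longrightarrow> h < 2 * N \<Longrightarrow> meet_length \<alpha> root (site l) (site h) = \<sigma> l h"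
begin

definition loaded :: "store \<Rightarrow> bool" where
  "loaded s \<longleftrightarrow> idx s ''n'' 0 = N \<and> root_of s = root \<and>
     (\<forall>l<2 * N. Complex (dat s ''px'' l) (dat s ''py'' l) = site l)"

lemma loaded_frame:
  "loaded s \<Longrightarrow> frame A B s s' \<Longrightarrow> ''n'' \<notin> A \<Longrightarrow> B \<inter> {''rx'', ''ry'', ''px'', ''py''} = {} \<Longrightarrow> loaded s'"
  by (auto simp: loaded_def frame_def)

lemma run_fill_cell:
  assumes s: "loaded s" "idx s ''l'' 0 = l" "idx s ''d'' 0 = d" and d: "0 < d" "d < N" "l + d < 2 * N"
    and fill: "filled \<phi> \<sigma> N (\<lambda>l' h'. h' < l' + d \<or> h' = l' + d \<and> l' < l) s"
  shows "run \<alpha> (Seq max_com (RSet ''S'' target_exp (RAdd (RGet ''S'' target_exp)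
       (SpiralLength root_exp (Meet root_exp (site_exp (var ''l'')) (site_exp (IAdd (var ''l'') (var ''d''))))))))
     s (N * 150 + 140) (\<lambda>s'. frame {''m'', ''C''} {''S''} s s' \<and>
        filled \<phi> \<sigma> N (\<lambda>l' h'. h' < l' + d \<or> h' = l' + d \<and> l' < Suc l) s')"
proof (rule run_Seq[where ?t1.0 = "d * 150 + 60" and ?t2.0 = 80])
  have n: "idx s ''n'' 0 = N" using s(1) by (simp add: loaded_def)
  have fillD: "dat s ''S'' (cell N l' h') = \<phi> l' h'" if "l' \<le> h'" "h' < 2 * N" "h' < l' + d" for l' h'
    using fill that unfolding filled_def by simp
  have zero: "dat s ''S'' (cell N l (l + d)) = 0"
    using fill d unfolding filled_def by simp
  have final: "run \<alpha> (RSet ''S'' target_exp (RAdd (RGet ''S'' target_exp)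
       (SpiralLength root_exp (Meet root_exp (site_exp (var ''l'')) (site_exp (IAdd (var ''l'') (var ''d'')))))))
     s' 80 (\<lambda>s'. frame {''m'', ''C''} {''S''} s s' \<and>
        filled \<phi> \<sigma> N (\<lambda>l' h'. h' < l' + d \<or> h' = l' + d \<and> l' < Suc l) s')"
    if "max_upto \<phi> N s l (l + d) (l + d) s'" for s'
  proof -
    obtain v c where vc: "frame {''m'', ''C''} {''S''} s s'"
      "dat s' ''S'' = (dat s ''S'')(cell N l (l + d) := v)" "idx s' ''C'' = (idx s ''C'')(cell N l (l + d) := c)"
      "\<forall>m\<in>{l..<l + d}. \<phi> l m + \<phi> (Suc m) (l + d) \<le> v" "c \<in> {l..<l + d}" "v = \<phi> l c + \<phi> (Suc c) (l + d)"
      using \<open>max_upto \<phi> N s l (l + d) (l + d) s'\<close> d(1) unfolding max_upto_def by auto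
    have g: "idx s' ''n'' 0 = N" "idx s' ''l'' 0 = l" "idx s' ''d'' 0 = d"
      using s n frame_idx[OF vc(1)] by auto
    have "loaded s'" using loaded_frame[OF s(1) vc(1)] by simp
    then have sav: "rval \<alpha> (SpiralLength root_exp (Meet root_exp (site_exp (var ''l'')) (site_exp (IAdd (var ''l'') (var ''d''))))) s' = \<sigma> l (l + d)"
      using \<sigma>_meet[of l "l + d"] d g by (simp add: loaded_def meet_length_def)
    have tgt: "ival target_exp s' = cell N l (l + d)" by (simp add: g cell_def)
    have Fv: "\<phi> l (l + d) = v + \<sigma> l (l + d)" using \<phi>_attained[of l c "l + d"] vc(4-6) by auto
    have filled': "filled \<phi> \<sigma> N (\<lambda>l' h'. h' < l' + d \<or> h' = l' + d \<and> l' < Suc l)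
        (set_dat ''S'' (cell N l (l + d)) (\<phi> l (l + d)) s')"
      unfolding filled_def
    proof (intro allI impI)
      fix l' h' assume lh: "l' \<le> h'" "h' < 2 * N"
      let ?s = "set_dat ''S'' (cell N l (l + d)) (\<phi> l (l + d)) s'"
      show "if h' < l' + d \<or> h' = l' + d \<and> l' < Suc l then dat ?s ''S'' (cell N l' h') = \<phi> l' h' \<and>
        (l' < h' \<longrightarrow> (let c = idx ?s ''C'' (cell N l' h') in l' \<le> c \<and> c < h' \<and> \<phi> l' h' = \<phi> l' c + \<phi> (Suc c) h' + \<sigma> l' h'))
      else dat ?s ''S'' (cell N l' h') = 0"
      proof (cases "l' = l \<and> h' = l + d")
        case True
        with vc(3,5,6) Fv show ?thesis by simp
      next
        case False
        then have ne: "cell N l' h' \<noteq> cell N l (l + d)" using lh d by (auto simp: cell_eq_iff)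
        have "(h' < l' + d \<or> h' = l' + d \<and> l' < Suc l) = (h' < l' + d \<or> h' = l' + d \<and> l' < l)"
          using False by (auto simp: less_Suc_eq)
        with fill lh ne show ?thesis unfolding filled_def by (simp add: vc(2,3))
      qed
    qed
    have val: "rval \<alpha> (RAdd (RGet ''S'' target_exp)
       (SpiralLength root_exp (Meet root_exp (site_exp (var ''l'')) (site_exp (IAdd (var ''l'') (var ''d'')))))) s' = \<phi> l (l + d)"
      unfolding rval.simps(3) sav rval.simps(2) tgt using vc(2) Fv by simp
    have "frame {''m'', ''C''} {''S''} s (set_dat ''S'' (cell N l (l + d)) (\<phi> l (l + d)) s')"
      using vc(1) by (simp add: frame_set_dat)
    with filled' show ?thesis
      by (intro run_RSet) (simp, unfold tgt val, simp)
  qed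
  show "run \<alpha> max_com s (d * 150 + 60) (\<lambda>s'. run \<alpha> (RSet ''S'' target_exp (RAdd (RGet ''S'' target_exp)
       (SpiralLength root_exp (Meet root_exp (site_exp (var ''l'')) (site_exp (IAdd (var ''l'') (var ''d'')))))))
     s' 80 (\<lambda>s'. frame {''m'', ''C''} {''S''} s s' \<and>
        filled \<phi> \<sigma> N (\<lambda>l' h'. h' < l' + d \<or> h' = l' + d \<and> l' < Suc l) s'))"
    by (rule run_mono[OF run_max[OF n s(2,3) d(1,3) fillD fillD zero \<phi>_nonneg] order_refl final]) (use d in auto)
qed (use d in simp)

text \<open>At most \<open>N\<close> lengths, \<open>2 * N\<close> left ends and \<open>N\<close>
  splits: this loop nest is the cubic part of the program.\<close>

lemma run_table:
  assumes s: "loaded s" and zero: "\<And>i. dat s ''S'' i = 0"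
  shows "run \<alpha> table_com s (N * (2 * N * (N * 150 + 170) + 40) + 20)
    (\<lambda>s'. frame {''d'', ''l'', ''m'', ''C''} {''S''} s s' \<and> filled \<phi> \<sigma> N (\<lambda>l h. h < l + N) s')"
  unfolding table_com_def
proof (rule run_for[where H = N and tb = "2 * N * (N * 150 + 170) + 25" and
    I = "\<lambda>d s'. frame {''d'', ''l'', ''m'', ''C''} {''S''} s s' \<and> idx s' ''d'' 0 = d \<and> 0 < d \<and>
      filled \<phi> \<sigma> N (\<lambda>l h. h < l + d) s'"])
  fix d s1 assume I: "frame {''d'', ''l'', ''m'', ''C''} {''S''} s s1 \<and> idx s1 ''d'' 0 = d \<and> 0 < d \<and>
      filled \<phi> \<sigma> N (\<lambda>l h. h < l + d) s1"
  have n: "idx s1 ''n'' 0 = N" using I s frame_idx[of _ _ s s1 "''n''"] by (auto simp: loaded_def)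
  then show "idx s1 ''d'' 0 = d \<and> ival (var ''n'') s1 = N" using I by simp
  assume "d < N"
  show "run \<alpha> (for_loop ''l'' (IConst 0) (ISub twice_exp (var ''d''))
     (Seq max_com (RSet ''S'' target_exp (RAdd (RGet ''S'' target_exp)
       (SpiralLength root_exp (Meet root_exp (site_exp (var ''l'')) (site_exp (IAdd (var ''l'') (var ''d'')))))))))
     s1 (2 * N * (N * 150 + 170) + 25)
     (\<lambda>s'. idx s' ''d'' 0 = d \<and> frame {''d'', ''l'', ''m'', ''C''} {''S''} s (set_idx ''d'' 0 (Suc d) s') \<and>
        idx (set_idx ''d'' 0 (Suc d) s') ''d'' 0 = Suc d \<and> 0 < Suc d \<and>
        filled \<phi> \<sigma> N (\<lambda>l h. h < l + Suc d) (set_idx ''d'' 0 (Suc d) s'))"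
  proof (rule run_for[where H = "2 * N - d" and tb = "N * 150 + 140" and
      I = "\<lambda>l s'. frame {''d'', ''l'', ''m'', ''C''} {''S''} s s' \<and> idx s' ''d'' 0 = d \<and> idx s' ''l'' 0 = l \<and>
        filled \<phi> \<sigma> N (\<lambda>l' h'. h' < l' + d \<or> h' = l' + d \<and> l' < l) s'"])
    fix l s2 assume J: "frame {''d'', ''l'', ''m'', ''C''} {''S''} s s2 \<and> idx s2 ''d'' 0 = d \<and> idx s2 ''l'' 0 = l \<and>
        filled \<phi> \<sigma> N (\<lambda>l' h'. h' < l' + d \<or> h' = l' + d \<and> l' < l) s2"
    then have ld: "loaded s2" using loaded_frame[OF s, of _ _ s2] by auto
    then show "idx s2 ''l'' 0 = l \<and> ival (ISub twice_exp (var ''d'')) s2 = 2 * N - d" using J by (simp add: loaded_def)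
    assume l: "l < 2 * N - d"
    have upd: "filled \<phi> \<sigma> N D (set_idx ''l'' 0 (Suc l) s') = filled \<phi> \<sigma> N D s'" for D s'
      by (rule filled_cong) simp_all
    show "run \<alpha> (Seq max_com (RSet ''S'' target_exp (RAdd (RGet ''S'' target_exp)
       (SpiralLength root_exp (Meet root_exp (site_exp (var ''l'')) (site_exp (IAdd (var ''l'') (var ''d''))))))))
      s2 (N * 150 + 140) (\<lambda>s'. idx s' ''l'' 0 = l \<and> frame {''d'', ''l'', ''m'', ''C''} {''S''} s (set_idx ''l'' 0 (Suc l) s') \<and>
         idx (set_idx ''l'' 0 (Suc l) s') ''d'' 0 = d \<and> idx (set_idx ''l'' 0 (Suc l) s') ''l'' 0 = Suc l \<and>
         filled \<phi> \<sigma> N (\<lambda>l' h'. h' < l' + d \<or> h' = l' + d \<and> l' < Suc l) (set_idx ''l'' 0 (Suc l) s'))"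
    proof (rule run_mono[OF run_fill_cell order_refl])
      fix s3 assume "frame {''m'', ''C''} {''S''} s2 s3 \<and>
        filled \<phi> \<sigma> N (\<lambda>l' h'. h' < l' + d \<or> h' = l' + d \<and> l' < Suc l) s3"
      moreover from this J have "frame {''d'', ''l'', ''m'', ''C''} {''S''} s s3"
        by (auto simp: frame_def)
      ultimately show "idx s3 ''l'' 0 = l \<and> frame {''d'', ''l'', ''m'', ''C''} {''S''} s (set_idx ''l'' 0 (Suc l) s3) \<and>
         idx (set_idx ''l'' 0 (Suc l) s3) ''d'' 0 = d \<and> idx (set_idx ''l'' 0 (Suc l) s3) ''l'' 0 = Suc l \<and>
         filled \<phi> \<sigma> N (\<lambda>l' h'. h' < l' + d \<or> h' = l' + d \<and> l' < Suc l) (set_idx ''l'' 0 (Suc l) s3)"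
        unfolding upd using J frame_idx[of "{''m'', ''C''}" "{''S''}" s2 s3] by (auto simp: frame_set_idx)
    qed (use ld J I \<open>d < N\<close> l in auto)
  next
    have "filled \<phi> \<sigma> N (\<lambda>l' h'. h' < l' + d \<or> h' = l' + d \<and> l' < 0) (set_idx ''l'' 0 0 s1) = filled \<phi> \<sigma> N (\<lambda>l h. h < l + d) s1"
      by (rule filled_cong) simp_all
    with I show "frame {''d'', ''l'', ''m'', ''C''} {''S''} s (set_idx ''l'' 0 (ival (IConst 0) s1) s1) \<and>
        idx (set_idx ''l'' 0 (ival (IConst 0) s1) s1) ''d'' 0 = d \<and>
        idx (set_idx ''l'' 0 (ival (IConst 0) s1) s1) ''l'' 0 = ival (IConst 0) s1 \<and>
        filled \<phi> \<sigma> N (\<lambda>l' h'. h' < l' + d \<or> h' = l' + d \<and> l' < ival (IConst 0) s1) (set_idx ''l'' 0 (ival (IConst 0) s1) s1)"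
      by (simp add: frame_set_idx)
  next
    have "(2 * N - d) * (157 + N * 150) \<le> 2 * N * (N * 150 + 170)" by (intro mult_le_mono) auto
    then show "(2 * N - d - ival (IConst 0) s1) * (N * 150 + 140 + icost (ISub twice_exp (var ''d'')) + 10)
        + icost (IConst 0) + icost (ISub twice_exp (var ''d'')) + 6 \<le> 2 * N * (N * 150 + 170) + 25" by simp
  next
    fix s2 assume J: "frame {''d'', ''l'', ''m'', ''C''} {''S''} s s2 \<and> idx s2 ''d'' 0 = d \<and> idx s2 ''l'' 0 = 2 * N - d \<and>
        filled \<phi> \<sigma> N (\<lambda>l' h'. h' < l' + d \<or> h' = l' + d \<and> l' < 2 * N - d) s2"
    have "filled \<phi> \<sigma> N (\<lambda>l' h'. h' < l' + d \<or> h' = l' + d \<and> l' < 2 * N - d) s2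
        = filled \<phi> \<sigma> N (\<lambda>l h. h < l + Suc d) (set_idx ''d'' 0 (Suc d) s2)"
      by (rule filled_cong) auto
    with J show "idx s2 ''d'' 0 = d \<and> frame {''d'', ''l'', ''m'', ''C''} {''S''} s (set_idx ''d'' 0 (Suc d) s2) \<and>
        idx (set_idx ''d'' 0 (Suc d) s2) ''d'' 0 = Suc d \<and> 0 < Suc d \<and>
        filled \<phi> \<sigma> N (\<lambda>l h. h < l + Suc d) (set_idx ''d'' 0 (Suc d) s2)"
      by (simp add: frame_set_idx)
  qed simp
next
  \<comment> \<open>For \<open>d = 1\<close> the computed cells are those with \<open>l = h\<close>,
    whose value 0 is already in the fresh store.\<close>
  have "filled \<phi> \<sigma> N (\<lambda>l h. h < l + 1) (set_idx ''d'' 0 1 s)"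
    unfolding filled_def using zero \<phi>_refl by (auto simp: less_Suc_eq_le)
  then show "frame {''d'', ''l'', ''m'', ''C''} {''S''} s (set_idx ''d'' 0 (ival (IConst 1) s) s) \<and>
     idx (set_idx ''d'' 0 (ival (IConst 1) s) s) ''d'' 0 = ival (IConst 1) s \<and> 0 < ival (IConst 1) s \<and>
     filled \<phi> \<sigma> N (\<lambda>l h. h < l + ival (IConst 1) s) (set_idx ''d'' 0 (ival (IConst 1) s) s)"
    by (simp add: frame_set_idx)
next
  have "(N - 1) * (2 * N * (N * 150 + 170) + 40) \<le> N * (2 * N * (N * 150 + 170) + 40)" by (intro mult_right_mono) auto
  then show "(N - ival (IConst 1) s) * (2 * N * (N * 150 + 170) + 25 + icost (var ''n'') + 10)
      + icost (IConst 1) + icost (var ''n'') + 6 \<le> N * (2 * N * (N * 150 + 170) + 40) + 20"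
    by (simp add: add.commute add_mult_distrib2)
qed (use N_pos in auto)

lemma run_best:
  assumes s: "loaded s" "filled \<phi> \<sigma> N (\<lambda>l h. h < l + N) s" "idx s ''best'' 0 = 0"
  shows "run \<alpha> best_com s (N * 70 + 20) (\<lambda>s'. frame {''i'', ''best''} {} s s' \<and> idx s' ''best'' 0 < N \<and>
     (\<forall>i<N. \<phi> i (i + N - 1) \<le> \<phi> (idx s' ''best'' 0) (idx s' ''best'' 0 + N - 1)))"
  unfolding best_com_def
proof (rule run_for[where H = N and tb = 50 and
    I = "\<lambda>k s'. frame {''i'', ''best''} {} s s' \<and> idx s' ''i'' 0 = k \<and> idx s' ''best'' 0 < N \<and>
     (\<forall>i<k. \<phi> i (i + N - 1) \<le> \<phi> (idx s' ''best'' 0) (idx s' ''best'' 0 + N - 1))"])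
  fix k s' assume I: "frame {''i'', ''best''} {} s s' \<and> idx s' ''i'' 0 = k \<and> idx s' ''best'' 0 < N \<and>
     (\<forall>i<k. \<phi> i (i + N - 1) \<le> \<phi> (idx s' ''best'' 0) (idx s' ''best'' 0 + N - 1))"
  then have f: "idx s' ''n'' 0 = N" "dat s' = dat s"
    using s(1) by (auto simp: frame_def loaded_def)
  then show "idx s' ''i'' 0 = k \<and> ival (var ''n'') s' = N" using I by simp
  assume "k < N"
  have win: "dat s ''S'' (i * (2 * N) + (i + N - 1)) = \<phi> i (i + N - 1)" if "i < N" for i
    using s(2)[unfolded filled_def, rule_format, of i "i + N - 1"] that by (simp add: cell_def)
  have "\<phi> i (i + N - 1) \<le> \<phi> k (k + N - 1)"
    if "\<phi> (idx s' ''best'' 0) (idx s' ''best'' 0 + N - 1) < \<phi> k (k + N - 1)" "i < k" for i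
    using I that by (meson less_imp_le order_trans)
  then show "run \<alpha> (Cond (RLess (RGet ''S'' (cell_exp (var ''best'') (ISub (IAdd (var ''best'') (var ''n'')) (IConst 1))))
                  (RGet ''S'' (cell_exp (var ''i'') (ISub (IAdd (var ''i'') (var ''n'')) (IConst 1)))))
       (ISet ''best'' (IConst 0) (var ''i'')) Skip) s' 50
     (\<lambda>s'. idx s' ''i'' 0 = k \<and> frame {''i'', ''best''} {} s (set_idx ''i'' 0 (Suc k) s') \<and>
        idx (set_idx ''i'' 0 (Suc k) s') ''i'' 0 = Suc k \<and> idx (set_idx ''i'' 0 (Suc k) s') ''best'' 0 < N \<and>
        (\<forall>i<Suc k. \<phi> i (i + N - 1) \<le> \<phi> (idx (set_idx ''i'' 0 (Suc k) s') ''best'' 0)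
           (idx (set_idx ''i'' 0 (Suc k) s') ''best'' 0 + N - 1)))"
    by (intro run_Cond run_ISet run_Skip)
      (use I f win[of k] win[of "idx s' ''best'' 0"] \<open>k < N\<close> in \<open>auto simp: frame_set_idx less_Suc_eq\<close>)
qed (use s N_pos in \<open>auto simp: frame_set_idx loaded_def\<close>)

end

text \<open>For \<open>lo = hi\<close> the meeting point is the terminal itself.\<close>

abbreviation meet_exp :: pexp where
  "meet_exp \<equiv> Meet root_exp (site_exp (IGet ''lo'' (var ''k''))) (site_exp (IGet ''hi'' (var ''k'')))"

section \<open>Writing the tree\<close>

definition split_com :: com where
  "split_com =
    Seq (ISet ''lo'' (var ''nodes'') (IGet ''lo'' (var ''k'')))
   (Seq (ISet ''hi'' (var ''nodes'') (IGet ''C'' (cell_exp (IGet ''lo'' (var ''k'')) (IGet ''hi'' (var ''k'')))))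
   (Seq (ISet ''parent'' (var ''nodes'') (var ''k''))
   (Seq (ISet ''turn'' (var ''nodes'') (IConst 0))
   (Seq (ISet ''lo'' (IAdd (var ''nodes'') (IConst 1)) (IAdd (IGet ''hi'' (var ''nodes'')) (IConst 1)))
   (Seq (ISet ''hi'' (IAdd (var ''nodes'') (IConst 1)) (IGet ''hi'' (var ''k'')))
   (Seq (ISet ''parent'' (IAdd (var ''nodes'') (IConst 1)) (var ''k''))
   (Seq (ISet ''turn'' (IAdd (var ''nodes'') (IConst 1)) (IConst 1))
   (ISet ''nodes'' (IConst 0) (IAdd (var ''nodes'') (IConst 2))))))))))"

text \<open>Every node other than the root has one segment, numbered like the node and ending in its
  parent; the parent has a smaller index, so its coordinates are already in place.\<close>

definition emit_com :: "com \<Rightarrow> com" where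
  "emit_com c =
    Seq (RSet ''X'' (var ''k'') (XCoord meet_exp))
   (Seq (RSet ''Y'' (var ''k'') (YCoord meet_exp))
   (Seq (RSet ''SX'' (var ''k'') (RGet ''X'' (IGet ''parent'' (var ''k''))))
   (Seq (RSet ''SY'' (var ''k'') (RGet ''Y'' (IGet ''parent'' (var ''k''))))
   (Seq (ISet ''start'' (var ''k'') (var ''k''))
   (Seq (ISet ''stop'' (var ''k'') (IAdd (var ''k'') (IConst 1))) c)))))"

text \<open>The list grows while it is processed, but its final length 2n is known beforehand and
  serves as the loop bound.\<close>

definition output_com :: com where
  "output_com =
    Seq (ISet ''lo'' (IConst 1) (var ''best''))
   (Seq (ISet ''hi'' (IConst 1) (ISub (IAdd (var ''best'') (var ''n'')) (IConst 1)))
   (Seq (ISet ''nodes'' (IConst 0) (IConst 2))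
   (for_loop ''k'' (IConst 1) twice_exp
     (emit_com (Cond (ILess (IGet ''lo'' (var ''k'')) (IGet ''hi'' (var ''k''))) split_com Skip)))))"

lemma run_emit:
  assumes "idx s ''k'' 0 = k" and "idx s ''parent'' k \<noteq> k"
    and "pval \<alpha> meet_exp s = p" and "Complex (dat s ''X'' (idx s ''parent'' k)) (dat s ''Y'' (idx s ''parent'' k)) = q"
    and "run \<alpha> c (set_idx ''stop'' k (Suc k) (set_idx ''start'' k k (set_dat ''SY'' k (Im q) (set_dat ''SX'' k (Re q)
      (set_dat ''Y'' k (Im p) (set_dat ''X'' k (Re p) s)))))) t Q"
  shows "run \<alpha> (emit_com c) s (t + 100) Q"
proof -
  have p: "Re p = Re (first_meet \<alpha> (root_of s) (Complex (dat s ''px'' (idx s ''lo'' k)) (dat s ''py'' (idx s ''lo'' k)))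
       (Complex (dat s ''px'' (idx s ''hi'' k)) (dat s ''py'' (idx s ''hi'' k))))"
    "Im p = Im (first_meet \<alpha> (root_of s) (Complex (dat s ''px'' (idx s ''lo'' k)) (dat s ''py'' (idx s ''lo'' k)))
       (Complex (dat s ''px'' (idx s ''hi'' k)) (dat s ''py'' (idx s ''hi'' k))))"
    using assms(1,3) by auto
  have q: "Re q = dat s ''X'' (idx s ''parent'' k)" "Im q = dat s ''Y'' (idx s ''parent'' k)"
    using assms(4) by auto
  have "run \<alpha> c (set_idx ''stop'' k (Suc k) (set_idx ''start'' k k (set_dat ''SY'' k (Im q) (set_dat ''SX'' k (Re q)
      (set_dat ''Y'' k (Im p) (set_dat ''X'' k (Re p) s)))))) (18 + t) Q"
    by (rule run_mono[OF assms(5)]) auto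
  then show ?thesis
    unfolding emit_com_def
    by (intro run_Seq_RSet run_Seq_ISet) (simp_all add: assms(1,2) flip: p q)
qed

lemma run_split:
  assumes k: "idx s ''k'' 0 = k" and c: "idx s ''nodes'' 0 = c" "k < c"
    and m: "idx s ''C'' (cell N (idx s ''lo'' k) (idx s ''hi'' k)) = m" and N: "idx s ''n'' 0 = N"
    and Q: "\<And>s'. frame {''lo'', ''hi'', ''parent'', ''turn'', ''nodes''} {} s s' \<Longrightarrow>
      idx s' ''lo'' = (idx s ''lo'')(c := idx s ''lo'' k, Suc c := Suc m) \<Longrightarrow>
      idx s' ''hi'' = (idx s ''hi'')(c := m, Suc c := idx s ''hi'' k) \<Longrightarrow>
      idx s' ''parent'' = (idx s ''parent'')(c := k, Suc c := k) \<Longrightarrow>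
      idx s' ''turn'' = (idx s ''turn'')(c := 0, Suc c := 1) \<Longrightarrow>
      idx s' ''nodes'' 0 = Suc (Suc c) \<Longrightarrow> Q s'"
  shows "run \<alpha> split_com s 100 Q"
  unfolding split_com_def
  using k c m N
  apply -
  apply (rule run_Seq_ISet, simp, simp add: cell_def del: One_nat_def)+
  apply (rule run_ISet, simp)
  apply (rule Q)
  by (simp_all add: frame_set_idx)

context spiral_terminals
begin

definition emitted :: "store \<Rightarrow> nat \<Rightarrow> bool" where
  "emitted s k \<longleftrightarrow>
     (\<forall>j<k. Complex (dat s ''X'' j) (dat s ''Y'' j) = interval_point (idx s ''lo'') (idx s ''hi'') j) \<and>
     (\<forall>j\<in>{1..<k}. Complex (dat s ''SX'' j) (dat s ''SY'' j) = interval_point (idx s ''lo'') (idx s ''hi'') (idx s ''parent'' j) \<and>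
        idx s ''start'' j = j \<and> idx s ''stop'' j = Suc j)"

text \<open>The step may also append list entries, but only from \<open>c\<close> on; the points and
  parents below \<open>c\<close>, and so everything written before, stay valid.\<close>

lemma emitted_step:
  assumes "emitted s k" "0 < k" "k < c" "\<And>j. j \<in> {1..k} \<Longrightarrow> idx s ''parent'' j < c" "idx s ''parent'' k < k"
    and fr: "\<And>a. a \<in> {''lo'', ''hi'', ''parent''} \<Longrightarrow> \<forall>j<c. idx s' a j = idx s a j"
    and out: "idx s' ''start'' = (idx s ''start'')(k := k)" "idx s' ''stop'' = (idx s ''stop'')(k := Suc k)"
      "dat s' ''X'' = (dat s ''X'')(k := Re (interval_point (idx s ''lo'') (idx s ''hi'') k))"
      "dat s' ''Y'' = (dat s ''Y'')(k := Im (interval_point (idx s ''lo'') (idx s ''hi'') k))"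
      "dat s' ''SX'' = (dat s ''SX'')(k := Re (interval_point (idx s ''lo'') (idx s ''hi'') (idx s ''parent'' k)))"
      "dat s' ''SY'' = (dat s ''SY'')(k := Im (interval_point (idx s ''lo'') (idx s ''hi'') (idx s ''parent'' k)))"
  shows "emitted s' (Suc k)"
proof -
  have ip: "interval_point (idx s' ''lo'') (idx s' ''hi'') j = interval_point (idx s ''lo'') (idx s ''hi'') j" if "j < c" for j
    using fr[of "''lo''"] fr[of "''hi''"] that by (simp add: interval_point_def)
  have par: "idx s' ''parent'' j = idx s ''parent'' j" if "j < c" for j using fr[of "''parent''"] that by simp
  have ipp: "interval_point (idx s' ''lo'') (idx s' ''hi'') (idx s' ''parent'' j)
      = interval_point (idx s ''lo'') (idx s ''hi'') (idx s ''parent'' j)" if "j \<in> {1..k}" for j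
    using par[of j] ip[of "idx s ''parent'' j"] assms(3,4) that by simp
  show ?thesis
    unfolding emitted_def
  proof (intro conjI allI ballI impI)
    fix j assume "j < Suc k"
    then show "Complex (dat s' ''X'' j) (dat s' ''Y'' j) = interval_point (idx s' ''lo'') (idx s' ''hi'') j"
      using assms(1,3) ip[of j] out by (cases "j = k") (auto simp: emitted_def)
  next
    fix j assume "j \<in> {1..<Suc k}"
    then show "Complex (dat s' ''SX'' j) (dat s' ''SY'' j) = interval_point (idx s' ''lo'') (idx s' ''hi'') (idx s' ''parent'' j)"
      "idx s' ''start'' j = j" "idx s' ''stop'' j = Suc j"
      using assms(1) ipp[of j] out by (cases "j = k"; auto simp: emitted_def)+
  qed
qed

lemma worklist_parent:
  assumes W: "worklist i lo hi par turn k c" and "j \<in> {1..<c}"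
  shows "par j < j"
proof (cases "j = 1")
  case True
  with worklistD(6)[OF W] show ?thesis by simp
next
  case False
  with bspec[OF worklistD(8)[OF W], of j] assms(2) show ?thesis by simp
qed

lemma run_output_step:
  assumes N: "n = int N" "idx s ''n'' 0 = N" "root_of s = r"
    and sites: "\<And>l. l < 2 * N \<Longrightarrow> Complex (dat s ''px'' l) (dat s ''py'' l) = node (int l)"
    and i: "i < N" and C: "splits i (\<lambda>l h. idx s ''C'' (cell N l h))"
    and W: "worklist i (idx s ''lo'') (idx s ''hi'') (idx s ''parent'') (idx s ''turn'') k (idx s ''nodes'' 0)"
    and k: "idx s ''k'' 0 = k" "k < 2 * N" and E: "emitted s k"
  shows "run \<alpha> (emit_com (Cond (ILess (IGet ''lo'' (var ''k'')) (IGet ''hi'' (var ''k''))) split_com Skip)) s 250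
    (\<lambda>s'. frame {''lo'', ''hi'', ''parent'', ''turn'', ''nodes'', ''start'', ''stop''} {''X'', ''Y'', ''SX'', ''SY''} s s' \<and>
      worklist i (idx s' ''lo'') (idx s' ''hi'') (idx s' ''parent'') (idx s' ''turn'') (Suc k) (idx s' ''nodes'' 0) \<and>
      emitted s' (Suc k))"
proof -
  let ?c = "idx s ''nodes'' 0" and ?p = "interval_point (idx s ''lo'') (idx s ''hi'')" and ?q = "idx s ''parent'' k"
  have kc: "k < ?c" using worklist_pending[OF W] k(2) N(1) by simp
  have k1: "1 \<le> k" by (rule worklistD(1)[OF W])
  have par: "idx s ''parent'' j < j" if "j \<in> {1..k}" for j using worklist_parent[OF W, of j] that kc by simp
  have par_k: "?q < k" using par[of k] k1 by simp
  have bd: "i \<le> idx s ''lo'' k" "idx s ''lo'' k \<le> idx s ''hi'' k" "int (idx s ''hi'' k) < int i + n"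
    using bspec[OF worklistD(5)[OF W], of k] k1 kc by auto
  have meet: "pval \<alpha> meet_exp s = ?p k"
  proof -
    have "idx s ''lo'' k < 2 * N" "idx s ''hi'' k < 2 * N" using bd i N(1) by auto
    moreover have "first_meet \<alpha> r (node (int (idx s ''lo'' k))) (node (int (idx s ''hi'' k)))
        = pt (a (int (idx s ''lo'' k))) (b (int (idx s ''hi'' k)))"
      using bd by (intro first_meet_node) auto
    ultimately show ?thesis using sites N(3) k(1) k1 by (simp add: interval_point_def)
  qed
  have old: "Complex (dat s ''X'' ?q) (dat s ''Y'' ?q) = ?p ?q" using E par_k by (simp add: emitted_def)
  define s1 where "s1 = set_idx ''stop'' k (Suc k) (set_idx ''start'' k k (set_dat ''SY'' k (Im (?p ?q)) (set_dat ''SX'' k (Re (?p ?q))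
      (set_dat ''Y'' k (Im (?p k)) (set_dat ''X'' k (Re (?p k)) s)))))"
  have s1: "idx s1 ''lo'' = idx s ''lo''" "idx s1 ''hi'' = idx s ''hi''" "idx s1 ''parent'' = idx s ''parent''"
    "idx s1 ''turn'' = idx s ''turn''" "idx s1 ''nodes'' = idx s ''nodes''" "idx s1 ''C'' = idx s ''C''"
    "idx s1 ''n'' = idx s ''n''" "idx s1 ''k'' = idx s ''k''"
    "frame {''start'', ''stop''} {''X'', ''Y'', ''SX'', ''SY''} s s1"
    by (simp_all add: s1_def frame_set_idx frame_set_dat)
  let ?Q = "\<lambda>s'. frame {''lo'', ''hi'', ''parent'', ''turn'', ''nodes'', ''start'', ''stop''} {''X'', ''Y'', ''SX'', ''SY''} s s' \<and>
      worklist i (idx s' ''lo'') (idx s' ''hi'') (idx s' ''parent'') (idx s' ''turn'') (Suc k) (idx s' ''nodes'' 0) \<and>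
      emitted s' (Suc k)"
  have par_c: "idx s ''parent'' j < ?c" if "j \<in> {1..k}" for j using par[OF that] that kc by simp
  have step: "emitted s' (Suc k)"
    if "frame {''lo'', ''hi'', ''parent'', ''turn'', ''nodes''} {} s1 s'"
      "\<And>a. a \<in> {''lo'', ''hi'', ''parent''} \<Longrightarrow> \<forall>j<?c. idx s' a j = idx s a j" for s'
  proof (rule emitted_step[OF E _ kc par_c par_k that(2)])
    show "0 < k" using k1 by simp
    show "idx s' ''start'' = (idx s ''start'')(k := k)" "idx s' ''stop'' = (idx s ''stop'')(k := Suc k)"
      "dat s' ''X'' = (dat s ''X'')(k := Re (?p k))" "dat s' ''Y'' = (dat s ''Y'')(k := Im (?p k))"
      "dat s' ''SX'' = (dat s ''SX'')(k := Re (?p ?q))" "dat s' ''SY'' = (dat s ''SY'')(k := Im (?p ?q))"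
      using that(1) by (simp_all add: frame_def s1_def)
  qed
  have "run \<alpha> (Cond (ILess (IGet ''lo'' (var ''k'')) (IGet ''hi'' (var ''k''))) split_com Skip) s1 150 ?Q"
  proof (rule run_Cond)
    assume "bval \<alpha> (ILess (IGet ''lo'' (var ''k'')) (IGet ''hi'' (var ''k''))) s1"
    then have lt: "idx s ''lo'' k < idx s ''hi'' k" using k(1) by (simp add: s1)
    have "run \<alpha> split_com s1 100 ?Q"
    proof (rule run_split[where k = k and c = ?c and N = N, OF _ _ kc refl])
      fix s' assume fr: "frame {''lo'', ''hi'', ''parent'', ''turn'', ''nodes''} {} s1 s'"
        and upd: "idx s' ''lo'' = (idx s1 ''lo'')(?c := idx s1 ''lo'' k, Suc ?c := Suc (idx s1 ''C'' (cell N (idx s1 ''lo'' k) (idx s1 ''hi'' k))))"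
        "idx s' ''hi'' = (idx s1 ''hi'')(?c := idx s1 ''C'' (cell N (idx s1 ''lo'' k) (idx s1 ''hi'' k)), Suc ?c := idx s1 ''hi'' k)"
        "idx s' ''parent'' = (idx s1 ''parent'')(?c := k, Suc ?c := k)"
        "idx s' ''turn'' = (idx s1 ''turn'')(?c := 0, Suc ?c := 1)"
        "idx s' ''nodes'' 0 = Suc (Suc ?c)"
      have "worklist i (idx s' ''lo'') (idx s' ''hi'') (idx s' ''parent'') (idx s' ''turn'') (Suc k) (idx s' ''nodes'' 0)"
        unfolding upd(5) by (rule worklist_split[OF W kc lt C refl]) (simp_all only: upd s1)
      moreover have "emitted s' (Suc k)" by (rule step[OF fr]) (auto simp: upd s1)
      moreover have "frame {''lo'', ''hi'', ''parent'', ''turn'', ''nodes'', ''start'', ''stop''} {''X'', ''Y'', ''SX'', ''SY''} s s'"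
        using fr s1(9) by (auto simp: frame_def)
      ultimately show "?Q s'" by blast
    qed (use k N in \<open>simp_all add: s1\<close>)
    then show "run \<alpha> split_com s1 (150 - (1 + bcost (ILess (IGet ''lo'' (var ''k'')) (IGet ''hi'' (var ''k''))))) ?Q"
      by (rule run_mono) auto
  next
    assume "\<not> bval \<alpha> (ILess (IGet ''lo'' (var ''k'')) (IGet ''hi'' (var ''k''))) s1"
    then have eq: "idx s ''lo'' k = idx s ''hi'' k" using k(1) bd(2) by (simp add: s1)
    have "worklist i (idx s1 ''lo'') (idx s1 ''hi'') (idx s1 ''parent'') (idx s1 ''turn'') (Suc k) (idx s1 ''nodes'' 0)"
      unfolding s1 by (rule worklist_leaf[OF W kc eq])
    moreover have "emitted s1 (Suc k)" by (rule step) (auto simp: s1)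
    moreover have "frame {''lo'', ''hi'', ''parent'', ''turn'', ''nodes'', ''start'', ''stop''} {''X'', ''Y'', ''SX'', ''SY''} s s1"
      using s1(9) by (auto simp: frame_def)
    ultimately show "run \<alpha> Skip s1 (150 - (1 + bcost (ILess (IGet ''lo'' (var ''k'')) (IGet ''hi'' (var ''k''))))) ?Q"
      by (intro run_Skip) auto
  qed simp
  then have "run \<alpha> (emit_com (Cond (ILess (IGet ''lo'' (var ''k'')) (IGet ''hi'' (var ''k''))) split_com Skip)) s (150 + 100) ?Q"
    by (intro run_emit[OF k(1) _ meet old]) (use par_k in \<open>simp_all add: s1_def\<close>)
  then show ?thesis by (rule run_mono) auto
qed

lemma run_output:
  assumes N: "n = int N" "idx s ''n'' 0 = N" "root_of s = r"
    and sites: "\<And>l. l < 2 * N \<Longrightarrow> Complex (dat s ''px'' l) (dat s ''py'' l) = node (int l)"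
    and i: "idx s ''best'' 0 = i" "i < N" and C: "splits i (\<lambda>l h. idx s ''C'' (cell N l h))"
    and init: "idx s ''parent'' 1 = 0" "idx s ''turn'' 1 = 0" "Complex (dat s ''X'' 0) (dat s ''Y'' 0) = r"
  shows "run \<alpha> output_com s (2 * N * 300 + 100) (\<lambda>s'.
      worklist i (idx s' ''lo'') (idx s' ''hi'') (idx s' ''parent'') (idx s' ''turn'') (2 * N) (2 * N) \<and>
      idx s' ''nodes'' 0 = 2 * N \<and> emitted s' (2 * N))"
proof -
  define s1 where "s1 = set_idx ''nodes'' 0 2 (set_idx ''hi'' 1 (i + N - 1) (set_idx ''lo'' 1 i s))"
  let ?A = "{''k'', ''lo'', ''hi'', ''parent'', ''turn'', ''nodes'', ''start'', ''stop''}"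
  let ?B = "{''X'', ''Y'', ''SX'', ''SY''}"
  have "run \<alpha> (for_loop ''k'' (IConst 1) twice_exp
     (emit_com (Cond (ILess (IGet ''lo'' (var ''k'')) (IGet ''hi'' (var ''k''))) split_com Skip))) s1 (2 * N * 300 + 50) (\<lambda>s'.
      worklist i (idx s' ''lo'') (idx s' ''hi'') (idx s' ''parent'') (idx s' ''turn'') (2 * N) (2 * N) \<and>
      idx s' ''nodes'' 0 = 2 * N \<and> emitted s' (2 * N))"
  proof (rule run_for[where H = "2 * N" and tb = 250 and I = "\<lambda>k s'. frame ?A ?B s s' \<and> idx s' ''k'' 0 = k \<and>
      worklist i (idx s' ''lo'') (idx s' ''hi'') (idx s' ''parent'') (idx s' ''turn'') k (idx s' ''nodes'' 0) \<and> emitted s' k"])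
    fix k s' assume I: "frame ?A ?B s s' \<and> idx s' ''k'' 0 = k \<and>
      worklist i (idx s' ''lo'') (idx s' ''hi'') (idx s' ''parent'') (idx s' ''turn'') k (idx s' ''nodes'' 0) \<and> emitted s' k"
    have fr: "idx s' ''n'' = idx s ''n''" "idx s' ''C'' = idx s ''C''" "dat s' ''rx'' = dat s ''rx''"
      "dat s' ''ry'' = dat s ''ry''" "dat s' ''px'' = dat s ''px''" "dat s' ''py'' = dat s ''py''"
      using I by (auto simp: frame_def)
    show "idx s' ''k'' 0 = k \<and> ival twice_exp s' = 2 * N" using I N by (simp add: fr)
    assume k: "k < 2 * N"
    show "run \<alpha> (emit_com (Cond (ILess (IGet ''lo'' (var ''k'')) (IGet ''hi'' (var ''k''))) split_com Skip)) s' 250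
      (\<lambda>s''. idx s'' ''k'' 0 = k \<and> frame ?A ?B s (set_idx ''k'' 0 (Suc k) s'') \<and>
         idx (set_idx ''k'' 0 (Suc k) s'') ''k'' 0 = Suc k \<and>
         worklist i (idx (set_idx ''k'' 0 (Suc k) s'') ''lo'') (idx (set_idx ''k'' 0 (Suc k) s'') ''hi'')
          (idx (set_idx ''k'' 0 (Suc k) s'') ''parent'') (idx (set_idx ''k'' 0 (Suc k) s'') ''turn'') (Suc k)
          (idx (set_idx ''k'' 0 (Suc k) s'') ''nodes'' 0) \<and> emitted (set_idx ''k'' 0 (Suc k) s'') (Suc k))"
    proof (rule run_mono[OF run_output_step[OF N(1)] order_refl])
      fix s'' assume post: "frame {''lo'', ''hi'', ''parent'', ''turn'', ''nodes'', ''start'', ''stop''} ?B s' s'' \<and>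
        worklist i (idx s'' ''lo'') (idx s'' ''hi'') (idx s'' ''parent'') (idx s'' ''turn'') (Suc k) (idx s'' ''nodes'' 0) \<and>
        emitted s'' (Suc k)"
      have "frame ?A ?B s (set_idx ''k'' 0 (Suc k) s'')" using I post by (auto simp: frame_def)
      moreover have "emitted (set_idx ''k'' 0 (Suc k) s'') (Suc k)" using post by (simp add: emitted_def)
      moreover have "idx s'' ''k'' 0 = k" using I post by (simp add: frame_def)
      ultimately show "idx s'' ''k'' 0 = k \<and> frame ?A ?B s (set_idx ''k'' 0 (Suc k) s'') \<and>
         idx (set_idx ''k'' 0 (Suc k) s'') ''k'' 0 = Suc k \<and>
         worklist i (idx (set_idx ''k'' 0 (Suc k) s'') ''lo'') (idx (set_idx ''k'' 0 (Suc k) s'') ''hi'')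
          (idx (set_idx ''k'' 0 (Suc k) s'') ''parent'') (idx (set_idx ''k'' 0 (Suc k) s'') ''turn'') (Suc k)
          (idx (set_idx ''k'' 0 (Suc k) s'') ''nodes'' 0) \<and> emitted (set_idx ''k'' 0 (Suc k) s'') (Suc k)"
        using post by simp
    qed (use I N sites i(2) C k in \<open>simp_all add: fr\<close>)
  next
    have "worklist i (idx s1 ''lo'') (idx s1 ''hi'') (idx s1 ''parent'') (idx s1 ''turn'') 1 2"
      by (rule worklist_init) (use init i N in \<open>auto simp: s1_def\<close>)
    moreover have "emitted (set_idx ''k'' 0 1 s1) 1"
      using init(3) by (simp add: emitted_def s1_def interval_point_def)
    ultimately show "frame ?A ?B s (set_idx ''k'' 0 (ival (IConst 1) s1) s1) \<and>
      idx (set_idx ''k'' 0 (ival (IConst 1) s1) s1) ''k'' 0 = ival (IConst 1) s1 \<and>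
      worklist i (idx (set_idx ''k'' 0 (ival (IConst 1) s1) s1) ''lo'') (idx (set_idx ''k'' 0 (ival (IConst 1) s1) s1) ''hi'')
        (idx (set_idx ''k'' 0 (ival (IConst 1) s1) s1) ''parent'') (idx (set_idx ''k'' 0 (ival (IConst 1) s1) s1) ''turn'')
        (ival (IConst 1) s1) (idx (set_idx ''k'' 0 (ival (IConst 1) s1) s1) ''nodes'' 0) \<and>
      emitted (set_idx ''k'' 0 (ival (IConst 1) s1) s1) (ival (IConst 1) s1)"
      by (simp add: s1_def frame_set_idx)
  next
    fix s' assume "frame ?A ?B s s' \<and> idx s' ''k'' 0 = 2 * N \<and>
      worklist i (idx s' ''lo'') (idx s' ''hi'') (idx s' ''parent'') (idx s' ''turn'') (2 * N) (idx s' ''nodes'' 0) \<and> emitted s' (2 * N)"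
    \<comment> \<open>Once \<open>k\<close> equals 2n, the node count leaves no room for pending
      intervals.\<close>
    moreover from this have "idx s' ''nodes'' 0 = 2 * N" using worklist_finished N(1) by fastforce
    ultimately show "worklist i (idx s' ''lo'') (idx s' ''hi'') (idx s' ''parent'') (idx s' ''turn'') (2 * N) (2 * N) \<and>
      idx s' ''nodes'' 0 = 2 * N \<and> emitted s' (2 * N)" by simp
  qed (use i in \<open>auto simp: algebra_simps\<close>)
  then show ?thesis
    unfolding output_com_def
    by (intro run_Seq_ISet) (use i N in \<open>auto simp: s1_def intro: run_mono\<close>)
qed

end

section \<open>From the input to a cyclic order\<close>

lemma rank_less: "i < N \<Longrightarrow> key_rank f N i < N"
proof -
  assume "i < N"
  then have "{j. j < N \<and> f i < f j} \<subset> {..<N}" by auto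
  from psubset_card_mono[OF _ this] show ?thesis by (simp add: key_rank_def)
qed

lemma rank_strict_antimono:
  assumes "f i < f j" "j < N" shows "key_rank f N j < key_rank f N i"
proof -
  have "{k. k < N \<and> f j < f k} \<subset> {k. k < N \<and> f i < f k}" using assms by auto
  from psubset_card_mono[OF _ this] show ?thesis by (simp add: key_rank_def)
qed

lemma rank_inj:
  assumes "inj_on f {..<N}" shows "inj_on (key_rank f N) {..<N}"
proof (rule inj_onI)
  fix i j assume ij: "i \<in> {..<N}" "j \<in> {..<N}" "key_rank f N i = key_rank f N j"
  then have "\<not> f i < f j" "\<not> f j < f i" using rank_strict_antimono[of f i j N] rank_strict_antimono[of f j i N] by auto
  then show "i = j" using assms ij by (auto dest: inj_onD)
qed

lemma rank_cong: "(\<And>j. j < N \<Longrightarrow> f j = g j) \<Longrightarrow> i < N \<Longrightarrow> key_rank f N i = key_rank g N i"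
  unfolding key_rank_def by (intro arg_cong[where f = card]) auto

lemma tree_length_nonneg:
  assumes "0 < \<alpha>" "\<alpha> < pi / 2" and T: "spiral_tree \<alpha> r P T"
  shows "0 \<le> tree_length \<alpha> r T"
proof -
  interpret spirals \<alpha> r by unfold_locales (use assms in auto)
  show ?thesis
    unfolding tree_length_def
  proof (intro sum_nonneg)
    fix v assume "v \<in> nodes T - {r}"
    then have "path_valid \<alpha> r v (out_arc T v)" using T by (auto simp: spiral_tree_def)
    then show "0 \<le> path_length \<alpha> r v (out_arc T v)"
      using path_end_le[of v "out_arc T v"] stretch_pos by (simp add: path_length_eq)
  qed
qed

context spirals
begin

lemma meet_length_pt:
  assumes "a' \<le> a" "b \<le> b'" "(b' - a') - (b - a) < 2 * period"
  shows "meet_length \<alpha> r (pt a b) (pt a' b') = stretch * exp (- (a + b') / 2)"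
  unfolding meet_length_def first_meet_pt[OF assms]
  using seg_length_eq[of "pt a b'" "(Right, None)"] by (simp add: dist_pt)

text \<open>A full turn changes \<open>b - a\<close> by \<open>2 * period\<close>; rounding down
  chooses the turn that brings it into the half-open interval starting at \<open>x\<close>.\<close>

lemma lift_near:
  assumes "p \<noteq> r" obtains a b where "p = pt a b" "x \<le> b - a" "b - a < x + 2 * period"
proof -
  obtain a b where ab: "p = pt a b" using pt_surj[OF assms] .
  define k where "k = - \<lfloor>(b - a - x) / (2 * period)\<rfloor>"
  have "of_int (- k) \<le> (b - a - x) / (2 * period)" "(b - a - x) / (2 * period) < of_int (- k) + 1"
    unfolding k_def by linarith+
  then have "of_int (- k) * (2 * period) \<le> b - a - x" "b - a - x < (of_int (- k) + 1) * (2 * period)"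
    using period_pos by (simp_all add: pos_le_divide_eq pos_divide_less_eq)
  then have "x \<le> (b + of_int k * period) - (a - of_int k * period)"
    "(b + of_int k * period) - (a - of_int k * period) < x + 2 * period"
    by (simp_all add: algebra_simps)
  moreover have "p = pt (a - of_int k * period) (b + of_int k * period)"
    unfolding ab pt_eq_iff by blast
  ultimately show ?thesis by (rule that[rotated])
qed

text \<open>Terminal 0 is fixed in two consecutive lifts, and every other terminal is lifted so that
  its \<open>b - a\<close> lies between theirs. Being incomparable to both, it falls into the box
  that they span; incomparability of the others orders \<open>a\<close> against
  \<open>b\<close>.\<close>

lemma lift_terminals:
  assumes N: "0 < N" and nr: "\<And>j. j < N \<Longrightarrow> ts ! j \<noteq> r"
    and apart: "\<And>i j. i < N \<Longrightarrow> j < N \<Longrightarrow> i \<noteq> j \<Longrightarrow> ts ! i \<notin> spiral_region \<alpha> r (ts ! j)"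
  shows "\<exists>a b. (\<forall>j<N. ts ! j = pt (a j) (b j)) \<and>
    (\<forall>j<N. a 0 - period < a j \<and> a j \<le> a 0 \<and> b 0 \<le> b j \<and> b j < b 0 + period) \<and>
    (\<forall>i<N. \<forall>j<N. b i < b j \<longrightarrow> a j < a i) \<and> inj_on b {..<N}"
proof -
  have cone: "\<not> (A \<le> A' \<and> B \<le> B')" if "i < N" "j < N" "i \<noteq> j" "ts ! i = pt A B" "ts ! j = pt A' B'"
    for i j A B A' B'
    using apart[of j i] cone_in_region[of A A' B B'] that by auto
  obtain A0 B0 where AB0: "ts ! 0 = pt A0 B0" using pt_surj[OF nr[OF N]] .
  have "\<exists>A B. ts ! j = pt A B \<and> B0 - A0 \<le> B - A \<and> B - A < B0 - A0 + 2 * period \<and> (j = 0 \<longrightarrow> A = A0 \<and> B = B0)"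
    if j: "j < N" for j
  proof (cases "j = 0")
    case True
    with AB0 period_pos show ?thesis by (intro exI[of _ A0] exI[of _ B0]) auto
  next
    case False
    obtain A B where "ts ! j = pt A B" "B0 - A0 \<le> B - A" "B - A < B0 - A0 + 2 * period"
      using lift_near[OF nr[OF j]] .
    with False show ?thesis by blast
  qed
  then obtain a b where ab: "\<And>j. j < N \<Longrightarrow> ts ! j = pt (a j) (b j) \<and> B0 - A0 \<le> b j - a j \<and>
      b j - a j < B0 - A0 + 2 * period \<and> (j = 0 \<longrightarrow> a j = A0 \<and> b j = B0)" by metis
  have a0: "a 0 = A0" "b 0 = B0" using ab[OF N] by auto
  have AB0': "ts ! 0 = pt (A0 - period) (B0 + period)"
    unfolding AB0 pt_eq_iff by (intro exI[of _ 1]) simp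
  have "a 0 - period < a j \<and> a j \<le> a 0 \<and> b 0 \<le> b j \<and> b j < b 0 + period" if j: "j < N" for j
  proof (cases "j = 0")
    case True
    with period_pos show ?thesis by simp
  next
    case False
    \<comment> \<open>1 and 2 exclude comparability with the first lift of terminal 0, 3 and 4 with
      the next. Leaving the box on any side contradicts one of them or the range of
      \<open>b - a\<close>.\<close>
    note 1 = cone[OF N j _ AB0, of "a j" "b j"] and 2 = cone[OF j N False _ AB0, of "a j" "b j"]
      and 3 = cone[OF N j _ AB0', of "a j" "b j"] and 4 = cone[OF j N False _ AB0', of "a j" "b j"]
    from 1 2 3 4 ab[OF j] False show ?thesis unfolding a0 by linarith
  qed
  moreover have "a j < a i" if "i < N" "j < N" "b i < b j" for i j
    using cone[of i j "a i" "b i" "a j" "b j"] ab[of i] ab[of j] that by (cases "i = j") auto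
  moreover have "inj_on b {..<N}"
  proof (rule inj_onI, rule ccontr)
    fix i j assume ij: "i \<in> {..<N}" "j \<in> {..<N}" "b i = b j" "i \<noteq> j"
    then show False
      using cone[of i j "a i" "b i" "a j" "b j"] cone[of j i "a j" "b j" "a i" "b i"] ab[of i] ab[of j] by auto
  qed
  ultimately show ?thesis using ab by blast
qed

text \<open>The lifts within one turn of terminal 0 are ordered by \<open>b\<close>; repeating them
  turn after turn gives the bi-infinite sequence. The rank computed by the program recovers this
  order because the key decreases with \<open>b\<close>.\<close>

lemma ex_spiral_terminals:
  assumes N: "N = length ts" "0 < N" and nr: "\<And>j. j < N \<Longrightarrow> ts ! j \<noteq> r"
    and apart: "\<And>i j. i < N \<Longrightarrow> j < N \<Longrightarrow> i \<noteq> j \<Longrightarrow> ts ! i \<notin> spiral_region \<alpha> r (ts ! j)"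
  defines "\<rho> \<equiv> key_rank (\<lambda>j. meet_length \<alpha> r (ts ! 0) (ts ! j)) N"
  shows "\<exists>a b. spiral_terminals \<alpha> (int N) a b \<and> inj_on \<rho> {..<N} \<and>
    range (\<lambda>k. pt (a k) (b k)) = set ts \<and>
    (\<forall>i<N. pt (a (int (\<rho> i))) (b (int (\<rho> i))) = ts ! i \<and> pt (a (int (\<rho> i + N))) (b (int (\<rho> i + N))) = ts ! i)"
proof -
  obtain a0 b0 where lift: "\<And>j. j < N \<Longrightarrow> ts ! j = pt (a0 j) (b0 j)"
    and box: "\<And>j. j < N \<Longrightarrow> a0 0 - period < a0 j \<and> a0 j \<le> a0 0 \<and> b0 0 \<le> b0 j \<and> b0 j < b0 0 + period"
    and anti: "\<And>i j. i < N \<Longrightarrow> j < N \<Longrightarrow> b0 i < b0 j \<Longrightarrow> a0 j < a0 i"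
    and inj: "inj_on b0 {..<N}"
    using lift_terminals[of N ts, OF N(2) nr apart] by blast
  let ?key = "\<lambda>j. meet_length \<alpha> r (ts ! 0) (ts ! j)"
  \<comment> \<open>The meeting point takes \<open>a\<close> from terminal 0 and \<open>b\<close>
    from terminal \<open>j\<close>, so only \<open>b\<close> varies.\<close>
  have key: "?key j = stretch * exp (- (a0 0 + b0 j) / 2)" if "j < N" for j
    unfolding lift[OF that] lift[OF N(2)] using box[OF that] by (intro meet_length_pt) auto
  have key_less: "?key i < ?key j \<longleftrightarrow> b0 j < b0 i" if "i < N" "j < N" for i j
    unfolding key[OF that(1)] key[OF that(2)] using stretch_pos by simp
  have key_inj: "inj_on ?key {..<N}"
  proof (rule inj_onI)
    fix i j assume ij: "i \<in> {..<N}" "j \<in> {..<N}" "?key i = ?key j"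
    then have "b0 i = b0 j" using key_less[of i j] key_less[of j i] by auto
    with inj ij show "i = j" by (auto dest: inj_onD)
  qed
  have \<rho>_less: "\<rho> i < N" if "i < N" for i unfolding \<rho>_def by (rule rank_less[OF that])
  have \<rho>_inj: "inj_on \<rho> {..<N}" unfolding \<rho>_def by (rule rank_inj[OF key_inj])
  have \<rho>_image: "\<rho> ` {..<N} = {..<N}" using \<rho>_less \<rho>_inj by (intro endo_inj_surj) auto
  define \<sigma> where "\<sigma> = inv_into {..<N} \<rho>"
  have \<sigma>: "\<sigma> q < N" "\<rho> (\<sigma> q) = q" if "q < N" for q
    using inv_into_into[of q \<rho> "{..<N}"] f_inv_into_f[of q \<rho> "{..<N}"] \<rho>_image that by (auto simp: \<sigma>_def)
  have \<sigma>_\<rho>: "\<sigma> (\<rho> i) = i" if "i < N" for i using inv_into_f_f[OF \<rho>_inj] that by (simp add: \<sigma>_def)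
  have \<sigma>_b: "b0 (\<sigma> q) < b0 (\<sigma> q')" if "q < q'" "q' < N" for q q'
  proof -
    have "q < N" using that by simp
    note s = \<sigma>[OF \<open>q < N\<close>] \<sigma>[OF \<open>q' < N\<close>]
    have "\<not> ?key (\<sigma> q) < ?key (\<sigma> q')"
      using rank_strict_antimono[of ?key "\<sigma> q" "\<sigma> q'" N] s that(1) unfolding \<rho>_def by auto
    moreover have "?key (\<sigma> q) \<noteq> ?key (\<sigma> q')"
    proof
      assume "?key (\<sigma> q) = ?key (\<sigma> q')"
      then have "\<sigma> q = \<sigma> q'" using key_inj s by (auto dest: inj_onD)
      with s that(1) show False by simp
    qed
    ultimately show ?thesis using key_less[of "\<sigma> q'" "\<sigma> q"] s by auto
  qed
  \<comment> \<open>Position \<open>k\<close> is terminal \<open>k mod N\<close> of the sorted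
    order, moved by \<open>k div N\<close> full turns.\<close>
  define \<tau> where "\<tau> k = \<sigma> (nat (k mod int N))" for k
  define a where "a k = a0 (\<tau> k) - of_int (k div int N) * period" for k
  define b where "b k = b0 (\<tau> k) + of_int (k div int N) * period" for k
  have \<tau>: "\<tau> k < N" for k using \<sigma>(1)[of "nat (k mod int N)"] N(2) by (simp add: \<tau>_def nat_less_iff)
  have order: "a l < a k \<and> b k < b l" if "k < l" for k l
  proof (cases "k div int N = l div int N")
    case True
    then have less: "k mod int N < l mod int N" using that by (metis add.commute div_mult_mod_eq add_less_cancel_right)
    have "nat (k mod int N) < nat (l mod int N)"
      using less pos_mod_sign[of "int N" k] N(2) by linarith
    moreover have "nat (l mod int N) < N" using N(2) by (simp add: nat_less_iff)
    ultimately have "b0 (\<tau> k) < b0 (\<tau> l)" unfolding \<tau>_def by (rule \<sigma>_b)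
    moreover from this have "a0 (\<tau> l) < a0 (\<tau> k)" using anti \<tau> by blast
    ultimately show ?thesis using True by (simp add: a_def b_def)
  next
    case False
    \<comment> \<open>Different turns: each turn is confined to a half-open box, so the order across
      turns is strict.\<close>
    then have "k div int N + 1 \<le> l div int N" using that zdiv_mono1[of k l "int N"] N(2) by simp
    then have "real_of_int (k div int N + 1) \<le> real_of_int (l div int N)"
      by (rule of_int_le_iff[THEN iffD2])
    then have "real_of_int (k div int N + 1) * period \<le> of_int (l div int N) * period"
      using less_imp_le[OF period_pos] by (rule mult_right_mono)
    then have "(of_int (k div int N) + 1) * period \<le> of_int (l div int N) * period" by simp
    with box[OF \<tau>[of k]] box[OF \<tau>[of l]] show ?thesis by (simp add: a_def b_def distrib_right)
  qed
  have shift: "a (k + int N) = a k - period" "b (k + int N) = b k + period" for k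
    using N(2) by (simp_all add: a_def b_def \<tau>_def algebra_simps)
  have pt_ab: "pt (a k) (b k) = ts ! \<tau> k" for k
  proof -
    have "pt (a0 (\<tau> k)) (b0 (\<tau> k)) = pt (a k) (b k)" unfolding pt_eq_iff a_def b_def by blast
    with lift[OF \<tau>[of k]] show ?thesis by simp
  qed
  have \<tau>_\<rho>: "\<tau> (int (\<rho> i)) = i" "\<tau> (int (\<rho> i + N)) = i" if "i < N" for i
    using \<rho>_less[OF that] \<sigma>_\<rho>[OF that] by (simp_all add: \<tau>_def)
  have "spiral_terminals \<alpha> (int N) a b"
    by unfold_locales (use N(2) order shift in auto)
  moreover have "range (\<lambda>k. pt (a k) (b k)) = set ts"
  proof
    show "range (\<lambda>k. pt (a k) (b k)) \<subseteq> set ts" using \<tau> N(1) by (auto simp: pt_ab)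
    show "set ts \<subseteq> range (\<lambda>k. pt (a k) (b k))"
    proof
      fix v assume "v \<in> set ts"
      then obtain i where "i < N" "v = ts ! i" using N(1) by (auto simp: in_set_conv_nth)
      then show "v \<in> range (\<lambda>k. pt (a k) (b k))" using \<tau>_\<rho>(1)[of i] by (auto simp: pt_ab intro!: image_eqI[of _ _ "int (\<rho> i)"])
    qed
  qed
  moreover have "\<forall>i<N. pt (a (int (\<rho> i))) (b (int (\<rho> i))) = ts ! i \<and>
      pt (a (int (\<rho> i + N))) (b (int (\<rho> i + N))) = ts ! i"
    unfolding pt_ab using \<tau>_\<rho> by (simp del: of_nat_add)
  ultimately show ?thesis using \<rho>_inj by blast
qed

end

section \<open>Correctness and running time\<close>

text \<open>No terminal is at the root, where the coordinates do not exist. The facts on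
  \<open>parent\<close>, \<open>turn\<close>, \<open>X\<close> and \<open>Y\<close> supply the arc
  data of entry 1 and the root of the output, which this phase does not write.\<close>

lemma run_solve:
  assumes alpha: "0 < \<alpha>" "\<alpha> < pi / 2"
    and N: "0 < N" "N = length ts" and nr: "\<And>j. j < N \<Longrightarrow> ts ! j \<noteq> r"
    and apart: "\<And>i j. i < N \<Longrightarrow> j < N \<Longrightarrow> i \<noteq> j \<Longrightarrow> ts ! i \<notin> spiral_region \<alpha> r (ts ! j)"
    and s: "idx s ''n'' 0 = N" "root_of s = r" "\<And>j. j < N \<Longrightarrow> Complex (dat s ''x'' j) (dat s ''y'' j) = ts ! j"
    and init: "\<And>i. dat s ''S'' i = 0" "idx s ''best'' 0 = 0" "idx s ''parent'' 1 = 0" "idx s ''turn'' 1 = 0"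
      "Complex (dat s ''X'' 0) (dat s ''Y'' 0) = r"
  shows "run \<alpha> (Seq rank_com (Seq table_com (Seq best_com output_com))) s
    ((N * (N * 100 + 100) + 20) + ((N * (2 * N * (N * 150 + 170) + 40) + 20) + ((N * 70 + 20) + (2 * N * 300 + 100))))
    (\<lambda>s'. \<exists>T. output_tree \<alpha> r s' T \<and> optimal_spiral_tree \<alpha> r (set ts) T)"
proof -
  interpret spirals \<alpha> r by unfold_locales (use alpha in auto)
  let ?\<rho> = "key_rank (\<lambda>j. meet_length \<alpha> r (ts ! 0) (ts ! j)) N"
  obtain a b where ab: "spiral_terminals \<alpha> (int N) a b" and \<rho>_inj: "inj_on ?\<rho> {..<N}"
    and range: "range (\<lambda>k. pt (a k) (b k)) = set ts"
    and sites: "\<And>i. i < N \<Longrightarrow> pt (a (int (?\<rho> i))) (b (int (?\<rho> i))) = ts ! i"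
      "\<And>i. i < N \<Longrightarrow> pt (a (int (?\<rho> i + N))) (b (int (?\<rho> i + N))) = ts ! i"
    using ex_spiral_terminals[OF N(2,1) nr apart] by blast
  interpret spiral_terminals \<alpha> r "int N" a b by (rule ab)
  have rank_eq: "key_rank (key \<alpha> s) N i = ?\<rho> i" if "i < N" for i
    using that s(2,3) N(1) by (intro rank_cong) (auto simp: key_def)
  have \<rho>_less: "?\<rho> i < N" if "i < N" for i by (rule rank_less[OF that])
  have \<rho>_image: "?\<rho> ` {..<N} = {..<N}" using \<rho>_less \<rho>_inj by (intro endo_inj_surj) auto
  interpret table_values \<alpha> N "\<lambda>l h. F (int l) (int h)" "\<lambda>l h. saving (int l) (int h)" r "\<lambda>l. node (int l)"
  proof
    show "0 < N" by (rule N(1))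
    show "F (int l) (int l) = 0" for l by simp
    show "0 \<le> F (int l) (int h)" for l h by (rule F_nonneg)
    show "F (int l) (int h) = F (int l) (int c) + F (int (Suc c)) (int h) + saving (int l) (int h)"
      if "l \<le> c" "c < h" and best: "\<And>m. l \<le> m \<Longrightarrow> m < h \<Longrightarrow>
        F (int l) (int m) + F (int (Suc m)) (int h) \<le> F (int l) (int c) + F (int (Suc c)) (int h)" for l c h
    proof -
      have "F (int l) m + F (m + 1) (int h) \<le> F (int l) (int c) + F (int c + 1) (int h)"
        if "int l \<le> m" "m < int h" for m
        using best[of "nat m"] that by (simp add: ac_simps)
      from F_attained[of "int l" "int c" "int h", OF _ _ this] that(1,2) show ?thesis by (simp add: ac_simps)
    qed
    show "meet_length \<alpha> r (node (int l)) (node (int h)) = saving (int l) (int h)"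
      if "l < h" "h < l + N" for l h
      using that first_meet_node[of "int l" "int h"] seg_length_eq[of "pt (a (int l)) (b (int h))" "(Right, None)"]
      by (simp add: meet_length_def dist_pt saving_def)
  qed
  have final: "\<exists>T. output_tree \<alpha> r s' T \<and> optimal_spiral_tree \<alpha> r (set ts) T"
    if i: "i < N" "\<And>j. j < N \<Longrightarrow> F (int j) (int (j + N - 1)) \<le> F (int i) (int (i + N - 1))"
      and W: "worklist i (idx s' ''lo'') (idx s' ''hi'') (idx s' ''parent'') (idx s' ''turn'') (2 * N) (2 * N)"
      and m: "idx s' ''nodes'' 0 = 2 * N" and E: "emitted s' (2 * N)" for s' i
  proof -
    let ?p = "interval_point (idx s' ''lo'') (idx s' ''hi'')"
    obtain T where T: "spiral_tree \<alpha> r (range node) T" "nodes T = ?p ` {..<2 * N}" "inj_on ?p {..<2 * N}"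
      and arcs: "\<And>j. j \<in> {1..<2 * N} \<Longrightarrow> parent T (?p j) = ?p (idx s' ''parent'' j) \<and> idx s' ''parent'' j < j \<and>
         (idx s' ''turn'' j = 0 \<or> idx s' ''turn'' j = 1) \<and>
         (\<exists>e. out_arc T (?p j) = [(if idx s' ''turn'' j = 0 then Right else Left, e)]) \<and>
         path_points \<alpha> r (?p j) (out_arc T (?p j)) = [?p (idx s' ''parent'' j)]"
      and len: "tree_length \<alpha> r T = (\<Sum>x\<in>{i..<i + nat (int N)}. stretch * norm (node (int x) - r)) - F (int i) (int i + int N - 1)"
      using worklist_tree[OF W] by auto
    have "optimal_spiral_tree \<alpha> r (range node) T"
    proof (rule optimal_if_best_window[OF T(1) len])
      fix j assume "0 \<le> j" "j < int N"
      then show "F j (j + int N - 1) \<le> F (int i) (int i + int N - 1)"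
        using i(2)[of "nat j"] i(1) N(1) by (simp add: of_nat_diff)
    qed
    moreover have "output_tree \<alpha> r s' T"
    proof -
      have node_eq: "Complex (dat s' ''X'' k) (dat s' ''Y'' k) = ?p k" if "k < 2 * N" for k
        using E that by (simp add: emitted_def)
      have inj: "inj_on (\<lambda>k. Complex (dat s' ''X'' k) (dat s' ''Y'' k)) {..<2 * N}"
        using T(3) node_eq by (simp add: inj_on_def)
      have im: "nodes T = (\<lambda>k. Complex (dat s' ''X'' k) (dat s' ''Y'' k)) ` {..<2 * N}"
        unfolding T(2) using node_eq by (intro image_cong) auto
      have arc: "idx s' ''parent'' k < 2 * N \<and>
          parent T (?p k) = Complex (dat s' ''X'' (idx s' ''parent'' k)) (dat s' ''Y'' (idx s' ''parent'' k)) \<and>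
          map ((\<lambda>d. case d of Right \<Rightarrow> 0 | Left \<Rightarrow> 1) \<circ> fst) (out_arc T (?p k))
            = map (idx s' ''turn'') [idx s' ''start'' k..<idx s' ''stop'' k] \<and>
          path_points \<alpha> r (?p k) (out_arc T (?p k))
            = map (\<lambda>j. Complex (dat s' ''SX'' j) (dat s' ''SY'' j)) [idx s' ''start'' k..<idx s' ''stop'' k]"
        if k: "k < 2 * N" "?p k \<noteq> r" for k
      proof -
        have "k \<noteq> 0"
        proof
          assume "k = 0"
          with k(2) show False by (simp add: interval_point_def)
        qed
        then have k1: "k \<in> {1..<2 * N}" using k(1) by auto
        have seg: "Complex (dat s' ''SX'' k) (dat s' ''SY'' k) = ?p (idx s' ''parent'' k)"
          "[idx s' ''start'' k..<idx s' ''stop'' k] = [k]"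
          using E k1 by (simp_all add: emitted_def)
        have "idx s' ''parent'' k < 2 * N" using arcs[OF k1] k(1) by simp
        with arcs[OF k1] node_eq[of "idx s' ''parent'' k"] seg show ?thesis by auto
      qed
      show ?thesis
        unfolding output_tree_def Let_def m
      proof (rule conjI[OF inj conjI[OF im]], rule allI, rule impI, rule impI, goal_cases)
        case (1 k)
        from arc[OF 1(1) 1(2)[unfolded node_eq[OF 1(1)]]] show ?case
          unfolding node_eq[OF 1(1)] .
      qed
    qed
    ultimately show ?thesis unfolding range by blast
  qed
  define fresh where "fresh s' \<longleftrightarrow> idx s' ''parent'' 1 = 0 \<and> idx s' ''turn'' 1 = 0 \<and>
    Complex (dat s' ''X'' 0) (dat s' ''Y'' 0) = r" for s' :: store
  let ?filled = "filled (\<lambda>l h. F (int l) (int h)) (\<lambda>l h. saving (int l) (int h)) N (\<lambda>l h. h < l + N)"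
  have output_step: "run \<alpha> output_com s3 (2 * N * 300 + 100) (\<lambda>s'. \<exists>T. output_tree \<alpha> r s' T \<and> optimal_spiral_tree \<alpha> r (set ts) T)"
    if s3: "loaded s3" "?filled s3" "fresh s3" "idx s3 ''best'' 0 < N"
      and best: "\<forall>i<N. F (int i) (int (i + N - 1)) \<le> F (int (idx s3 ''best'' 0)) (int (idx s3 ''best'' 0 + N - 1))" for s3
  proof -
    let ?i = "idx s3 ''best'' 0"
    have "splits ?i (\<lambda>l h. idx s3 ''C'' (cell N l h))"
      unfolding splits_def
    proof (intro allI impI)
      fix l h :: nat assume lh: "?i \<le> l" "l < h" "int h < int ?i + int N"
      then have "h < 2 * N" "h < l + N" using s3(4) by auto
      with s3(2)[unfolded filled_def, rule_format, of l h] lh(2)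
      show "l \<le> idx s3 ''C'' (cell N l h) \<and> idx s3 ''C'' (cell N l h) < h \<and>
        F (int l) (int h) = F (int l) (int (idx s3 ''C'' (cell N l h))) + F (int (Suc (idx s3 ''C'' (cell N l h)))) (int h) + saving (int l) (int h)"
        by (simp add: Let_def)
    qed
    note run_output[OF refl _ _ _ refl s3(4) this]
    then have "run \<alpha> output_com s3 (2 * N * 300 + 100) (\<lambda>s'.
      worklist ?i (idx s' ''lo'') (idx s' ''hi'') (idx s' ''parent'') (idx s' ''turn'') (2 * N) (2 * N) \<and>
      idx s' ''nodes'' 0 = 2 * N \<and> emitted s' (2 * N))"
      using s3(1,3) by (simp add: loaded_def fresh_def)
    then show ?thesis
      by (rule run_mono[OF _ order_refl]) (use final[of ?i] s3(4) best in blast)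
  qed
  have key_rank: "run \<alpha> rank_com s (N * (N * 100 + 100) + 20)
    (\<lambda>s'. loaded s' \<and> fresh s' \<and> idx s' ''best'' 0 = 0 \<and> (\<forall>i. dat s' ''S'' i = 0))"
  proof (rule run_mono[OF run_rank[OF s(1)] order_refl])
    show "inj_on (key_rank (key \<alpha> s) N) {..<N}" using \<rho>_inj rank_eq by (simp add: inj_on_def)
    show "key_rank (key \<alpha> s) N i < N" if "i < N" for i using \<rho>_less[OF that] rank_eq[OF that] by simp
    fix s1 assume R: "frame {''i'', ''j'', ''rank''} {''px'', ''py''} s s1 \<and>
      (\<forall>i<N. \<forall>p\<in>{key_rank (key \<alpha> s) N i, key_rank (key \<alpha> s) N i + N}.
        dat s1 ''px'' p = dat s ''x'' i \<and> dat s1 ''py'' p = dat s ''y'' i)"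
    have "Complex (dat s1 ''px'' l) (dat s1 ''py'' l) = node (int l)" if l: "l < 2 * N" for l
    proof -
      \<comment> \<open>Site \<open>l\<close> is the first copy of the terminal of rank
        \<open>l\<close> or the second copy of that of rank \<open>l - N\<close>.\<close>
      have "(if l < N then l else l - N) \<in> ?\<rho> ` {..<N}" using l unfolding \<rho>_image by auto
      then obtain i where i: "i < N" "?\<rho> i = (if l < N then l else l - N)" by auto
      then have "l = ?\<rho> i \<or> l = ?\<rho> i + N" by (auto split: if_splits)
      then show ?thesis
        using R s(3)[OF i(1)] sites[OF i(1)] i(1) rank_eq[OF i(1)] by auto
    qed
    moreover have "idx s1 ''n'' = idx s ''n''" "idx s1 ''best'' = idx s ''best''" "idx s1 ''parent'' = idx s ''parent''"
      "idx s1 ''turn'' = idx s ''turn''" "dat s1 ''rx'' = dat s ''rx''" "dat s1 ''ry'' = dat s ''ry''"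
      "dat s1 ''X'' = dat s ''X''" "dat s1 ''Y'' = dat s ''Y''" "dat s1 ''S'' = dat s ''S''"
      using R by (simp_all add: frame_def)
    ultimately show "loaded s1 \<and> fresh s1 \<and> idx s1 ''best'' 0 = 0 \<and> (\<forall>i. dat s1 ''S'' i = 0)"
      using s init by (simp add: loaded_def fresh_def)
  qed
  have table: "run \<alpha> table_com s1 (N * (2 * N * (N * 150 + 170) + 40) + 20)
      (\<lambda>s'. loaded s' \<and> ?filled s' \<and> fresh s' \<and> idx s' ''best'' 0 = 0)"
    if s1: "loaded s1 \<and> fresh s1 \<and> idx s1 ''best'' 0 = 0 \<and> (\<forall>i. dat s1 ''S'' i = 0)" for s1
  proof (rule run_mono[OF run_table order_refl])
    fix s2 assume post: "frame {''d'', ''l'', ''m'', ''C''} {''S''} s1 s2 \<and> ?filled s2"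
    then have fr: "frame {''d'', ''l'', ''m'', ''C''} {''S''} s1 s2" by blast
    have "loaded s2" using s1 fr by (rule loaded_frame[OF conjunct1]) simp_all
    moreover have "fresh s2" "idx s2 ''best'' 0 = 0" using s1 fr by (simp_all add: fresh_def frame_def)
    ultimately show "loaded s2 \<and> ?filled s2 \<and> fresh s2 \<and> idx s2 ''best'' 0 = 0" using post by blast
  qed (use s1 in simp_all)
  have best: "run \<alpha> best_com s2 (N * 70 + 20) (\<lambda>s'. loaded s' \<and> ?filled s' \<and> fresh s' \<and> idx s' ''best'' 0 < N \<and>
      (\<forall>i<N. F (int i) (int (i + N - 1)) \<le> F (int (idx s' ''best'' 0)) (int (idx s' ''best'' 0 + N - 1))))"
    if s2: "loaded s2 \<and> ?filled s2 \<and> fresh s2 \<and> idx s2 ''best'' 0 = 0" for s2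
  proof (rule run_mono[OF run_best order_refl])
    fix s3 assume post: "frame {''i'', ''best''} {} s2 s3 \<and> idx s3 ''best'' 0 < N \<and>
      (\<forall>i<N. F (int i) (int (i + N - 1)) \<le> F (int (idx s3 ''best'' 0)) (int (idx s3 ''best'' 0 + N - 1)))"
    then have fr: "frame {''i'', ''best''} {} s2 s3" by blast
    have "loaded s3" using s2 fr by (rule loaded_frame[OF conjunct1]) simp_all
    moreover have "fresh s3" using s2 fr by (simp add: fresh_def frame_def)
    moreover have "?filled s3 = ?filled s2" by (rule filled_cong) (use fr in \<open>simp_all add: frame_def\<close>)
    ultimately show "loaded s3 \<and> ?filled s3 \<and> fresh s3 \<and> idx s3 ''best'' 0 < N \<and>
      (\<forall>i<N. F (int i) (int (i + N - 1)) \<le> F (int (idx s3 ''best'' 0)) (int (idx s3 ''best'' 0 + N - 1)))"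
      using post s2 by blast
  qed (use s2 in blast)+
  have "run \<alpha> (Seq best_com output_com) s2 ((N * 70 + 20) + (2 * N * 300 + 100))
      (\<lambda>s'. \<exists>T. output_tree \<alpha> r s' T \<and> optimal_spiral_tree \<alpha> r (set ts) T)"
    if "loaded s2 \<and> ?filled s2 \<and> fresh s2 \<and> idx s2 ''best'' 0 = 0" for s2
    by (rule run_Seq[OF run_mono[OF best[OF that] order_refl] order_refl]) (use output_step in blast)
  then have "run \<alpha> (Seq table_com (Seq best_com output_com)) s1
      ((N * (2 * N * (N * 150 + 170) + 40) + 20) + ((N * 70 + 20) + (2 * N * 300 + 100)))
      (\<lambda>s'. \<exists>T. output_tree \<alpha> r s' T \<and> optimal_spiral_tree \<alpha> r (set ts) T)"
    if "loaded s1 \<and> fresh s1 \<and> idx s1 ''best'' 0 = 0 \<and> (\<forall>i. dat s1 ''S'' i = 0)" for s1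
    by (rule run_Seq[OF run_mono[OF table[OF that] order_refl] order_refl])
  then show ?thesis by (rule run_Seq[OF run_mono[OF key_rank order_refl] order_refl])
qed

text \<open>Equality of terminal 0 with the root is tested by failed comparisons. A terminal at the
  root lies in every region, so it is the only one; then, as for an empty input, the preset single
  node is the answer.\<close>

definition solve_com :: com where
  "solve_com = Seq (ISet ''nodes'' (IConst 0) (IConst 1))
    (Seq (RSet ''X'' (IConst 0) (RGet ''rx'' (IConst 0)))
    (Seq (RSet ''Y'' (IConst 0) (RGet ''ry'' (IConst 0)))
    (Cond (BAnd (ILess (IConst 0) (var ''n''))
        (BNot (BAnd
          (BAnd (BNot (RLess (RGet ''x'' (IConst 0)) (RGet ''rx'' (IConst 0))))
                (BNot (RLess (RGet ''rx'' (IConst 0)) (RGet ''x'' (IConst 0)))))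
          (BAnd (BNot (RLess (RGet ''y'' (IConst 0)) (RGet ''ry'' (IConst 0))))
                (BNot (RLess (RGet ''ry'' (IConst 0)) (RGet ''y'' (IConst 0))))))))
      (Seq rank_com (Seq table_com (Seq best_com output_com))) Skip)))"

definition solve_time :: "nat \<Rightarrow> nat" where
  "solve_time N = (N * (N * 100 + 100) + 20) + ((N * (2 * N * (N * 150 + 170) + 40) + 20) +
     ((N * 70 + 20) + (2 * N * 300 + 100))) + 100"

lemma solve_time_bigo: "(\<lambda>N. real (solve_time N)) \<in> O(\<lambda>N. real N ^ 3)"
proof (rule bigoI[where c = 3000], rule eventually_mono[OF eventually_ge_at_top[of 1]])
  fix N :: nat assume N: "1 \<le> N"
  have "1 \<le> N ^ 3" "N \<le> N ^ 3" "N ^ 2 \<le> N ^ 3"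
    using N power_increasing[of 1 3 N] power_increasing[of 2 3 N] one_le_power[of N 3] by simp_all
  \<comment> \<open>The coefficients add up to 1810, so 3000 suffices once
    \<open>1 \<le> N\<close>.\<close>
  moreover have "solve_time N = 300 * N ^ 3 + 440 * N ^ 2 + 810 * N + 260"
    unfolding solve_time_def by (simp add: power2_eq_square power3_eq_cube algebra_simps)
  ultimately have "solve_time N \<le> 3000 * N ^ 3" by linarith
  then have "real (solve_time N) \<le> real (3000 * N ^ 3)" by (rule of_nat_mono)
  then show "norm (real (solve_time N)) \<le> 3000 * norm (real N ^ 3)" by simp
qed

lemma run_solve_com:
  assumes alpha: "0 < \<alpha>" "\<alpha> < pi / 2"
    and apart: "\<forall>i<length ts. \<forall>j<length ts. i \<noteq> j \<longrightarrow> ts ! i \<notin> spiral_region \<alpha> r (ts ! j)"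
  shows "run \<alpha> solve_com (input_store r ts) (solve_time (length ts))
    (\<lambda>s. \<exists>T. output_tree \<alpha> r s T \<and> optimal_spiral_tree \<alpha> r (set ts) T)"
proof -
  interpret spirals \<alpha> r by unfold_locales (use alpha in auto)
  let ?N = "length ts"
  define s where "s = set_dat ''Y'' 0 (Im r) (set_dat ''X'' 0 (Re r) (set_idx ''nodes'' 0 1 (input_store r ts)))"
  have s: "idx s ''n'' 0 = ?N" "root_of s = r" "\<And>j. j < ?N \<Longrightarrow> Complex (dat s ''x'' j) (dat s ''y'' j) = ts ! j"
    "\<And>i. dat s ''S'' i = 0" "idx s ''best'' 0 = 0" "idx s ''parent'' 1 = 0" "idx s ''turn'' 1 = 0"
    "Complex (dat s ''X'' 0) (dat s ''Y'' 0) = r" "idx s ''nodes'' 0 = 1"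
    by (simp_all add: s_def input_store_def numeral_eq_Suc)
  let ?b = "BAnd (ILess (IConst 0) (var ''n''))
        (BNot (BAnd
          (BAnd (BNot (RLess (RGet ''x'' (IConst 0)) (RGet ''rx'' (IConst 0))))
                (BNot (RLess (RGet ''rx'' (IConst 0)) (RGet ''x'' (IConst 0)))))
          (BAnd (BNot (RLess (RGet ''y'' (IConst 0)) (RGet ''ry'' (IConst 0))))
                (BNot (RLess (RGet ''ry'' (IConst 0)) (RGet ''y'' (IConst 0)))))))"
  have test: "bval \<alpha> ?b s \<longleftrightarrow> 0 < ?N \<and> ts ! 0 \<noteq> r"
    using s(1,2) s(3)[of 0] by (auto simp: complex_eq_iff not_less)
  let ?Q = "\<lambda>s. \<exists>T. output_tree \<alpha> r s T \<and> optimal_spiral_tree \<alpha> r (set ts) T"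
  have "run \<alpha> (Cond ?b (Seq rank_com (Seq table_com (Seq best_com output_com))) Skip) s (solve_time ?N - 20) ?Q"
  proof (rule run_Cond)
    assume "bval \<alpha> ?b s"
    then have N: "0 < ?N" "ts ! 0 \<noteq> r" unfolding test by auto
    \<comment> \<open>A further terminal at the root would lie in the region of terminal 0.\<close>
    have nr: "ts ! j \<noteq> r" if "j < ?N" for j
      using apart[rule_format, of j 0] N that root_in_region[of "ts ! 0"] by (cases "j = 0") auto
    show "run \<alpha> (Seq rank_com (Seq table_com (Seq best_com output_com))) s (solve_time ?N - 20 - (1 + bcost ?b)) ?Q"
      by (rule run_mono[OF run_solve[OF alpha N(1) refl nr apart[rule_format] s(1-8)]])
        (simp_all add: solve_time_def)
  next
    assume "\<not> bval \<alpha> ?b s"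
    then have "?N = 0 \<or> ts ! 0 = r" unfolding test by auto
    have "set ts \<subseteq> {r}"
    proof
      fix v assume "v \<in> set ts"
      then obtain j where j: "j < ?N" "v = ts ! j" by (auto simp: in_set_conv_nth)
      then have "ts ! 0 = r" using \<open>?N = 0 \<or> ts ! 0 = r\<close> by auto
      have "j = 0"
      proof (rule ccontr)
        assume "j \<noteq> 0"
        with j apart have "ts ! 0 \<notin> spiral_region \<alpha> r (ts ! j)" by fastforce
        with \<open>ts ! 0 = r\<close> root_in_region show False by simp
      qed
      with j \<open>ts ! 0 = r\<close> show "v \<in> {r}" by simp
    qed
    \<comment> \<open>With no terminal off the root, the one-node tree has length 0, the least
      possible.\<close>
    define T where "T = \<lparr>nodes = {r}, parent = (\<lambda>_. r), out_arc = (\<lambda>_. [])\<rparr>"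
    have "spiral_tree \<alpha> r (set ts) T" using \<open>set ts \<subseteq> {r}\<close> by (simp add: spiral_tree_def T_def)
    moreover have "tree_length \<alpha> r T = 0" by (simp add: tree_length_def T_def)
    ultimately have "optimal_spiral_tree \<alpha> r (set ts) T"
      using tree_length_nonneg[OF alpha] by (simp add: optimal_spiral_tree_def)
    moreover have "output_tree \<alpha> r s T"
      unfolding output_tree_def Let_def using s(8,9) by (simp add: T_def lessThan_Suc)
    ultimately show "run \<alpha> Skip s (solve_time ?N - 20 - (1 + bcost ?b)) ?Q"
      by (intro run_Skip) (auto simp: solve_time_def)
  qed (simp add: solve_time_def)
  \<comment> \<open>The three assignments before the test cost 3 + 4 + 4 = 11 steps.\<close>
  then have "run \<alpha> (Cond ?b (Seq rank_com (Seq table_com (Seq best_com output_com))) Skip) s (solve_time ?N - 11) ?Q"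
    by (rule run_mono) auto
  moreover have "100 \<le> solve_time ?N" by (simp add: solve_time_def)
  ultimately show ?thesis
    unfolding solve_com_def
    by (intro run_Seq_ISet run_Seq_RSet) (simp_all add: s_def input_store_def numeral_eq_Suc)
qed

theorem mainTheorem11:
  fixes \<alpha> :: real
  assumes "0 < \<alpha>" and "\<alpha> < pi / 2"
  shows "\<exists>prog :: com. \<exists>time :: nat \<Rightarrow> nat.
    (\<lambda>n. real (time n)) \<in> O(\<lambda>n. real n ^ 3) \<and>
    (\<forall>(r :: complex) (ts :: complex list).
       (\<forall>i<length ts. \<forall>j<length ts. i \<noteq> j \<longrightarrow> ts ! i \<notin> spiral_region \<alpha> r (ts ! j)) \<longrightarrow>
       (\<exists>k s T. exec \<alpha> prog (input_store r ts) k s \<and> k \<le> time (length ts) \<and>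
          output_tree \<alpha> r s T \<and> optimal_spiral_tree \<alpha> r (set ts) T))"
  using solve_time_bigo run_solve_com[OF assms] unfolding run_def by blast

end
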